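(* Let $T\in\mathcal{BC}^{0,1}(V_5)$ be such that its components $T_i$, $i=1,2,3,4,5$, have real spectra and $T_0=0$. Let $U\subset\mathbb{R}^6$ be a bounded slice Cauchy domain. If $f\in\mathcal{N}_{\sigma_S(T)}(U)$ and $g\in\mathcal{SH}^L_{\sigma_S(T)}(U)$, then $$(fg)_D(T)=f_D(T)\,g(T)+f(\overline{T})\,g_D(T).$$
   Context: $\mathbb{R}_5$ is the real Clifford algebra with imaginary units $e_1,\dots,e_5$, $e_\ell e_m+e_me_\ell=0$ for $\ell\ne m$, $e_\ell^2=-1$. A point of $\mathbb{R}^{6}$ is identified with the paravector $x=x_0+\underline{x}=x_0+\sum_{j=1}^5x_je_j\in\mathbb{R}_5$; $\bar x=x_0-\underline{x}$, $|x|^2=\sum_{j=0}^5x_j^2$, $\mathrm{Re}(x)=x_0$. $\mathbb{S}=\{\underline{x}:\ x_1^2+\dots+x_5^2=1\}$, $[x]=\{\mathrm{Re}(x)+I|\underline{x}|:\ I\in\mathbb{S}\}$, and $\mathbb{C}_I=\mathbb{R}+I\mathbb{R}$ for $I\in\mathbb{S}$. $V$ is a real Banach space, $V_5=V\otimes\mathbb{R}_5$ the associated two-sided Clifford Banach module, $\mathcal{B}(V_5)$ the bounded right-linear operators on $V_5$. Elements $a\in\mathbb{R}_5$ act on $V_5$ by left multiplication, and products such as $aT$, $Ta$ are compositions of operators. $\mathcal{BC}^{0,1}(V_5)$ is the set of operators $T=T_0+\sum_{j=1}^5e_jT_j$ whose components $T_0,\dots,T_5$ are bounded operators on $V$ that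 commute pairwise. For such $T$, $\overline{T}=T_0-\sum_{j=1}^5e_jT_j$. For $T\in\mathcal{BC}^{0,1}(V_5)$ the $S$-spectrum is $\sigma_S(T)=\{s\in\mathbb{R}^6: T^2-2\mathrm{Re}(s)T+|s|^2\mathcal{I}\text{ is not invertible in }\mathcal{B}(V_5)\}$; it is known to coincide with the set of $s\in\mathbb{R}^6$ for which $s^2\mathcal{I}-s(T+\overline{T})+T\overline{T}$ is not invertible (so $\sigma_S(\overline T)=\sigma_S(T)$). $\rho_S(T)=\mathbb{R}^6\setminus\sigma_S(T)$. For $s\in\rho_S(T)$: $$\mathcal{Q}_{c,s}^{-1}(T)=(s^2\mathcal{I}-s(T+\overline{T})+T\overline{T})^{-1},\quad S_L^{-1}(s,T)=(s\mathcal{I}-\overline{T})\mathcal{Q}_{c,s}^{-1}(T),\quad S_R^{-1}(s,T)=\mathcal{Q}_{c,s}^{-1}(T)(s\mathcal{I}-\overline{T}).$$ A set $U\subset\mathbb{R}^6$ is axially symmetric if $[x]\subset U$ for all $x\in U$. A slice Cauchy domain is an axially symmetric open set $U$ such that, for every $I\in\mathbb{S}$, $\partial(U\cap\mathbb{C}_I)$ is a finite union of pairwise disjoint piecewise $C^1$ Jordan curves (positively oriented with respect to $U\cap\mathbb{C}_I$). A function $f$ on an axially symmetric open set $W$ is left slice hyperholomorphic if $f(u+Iv)=\alpha(u,v)+I\beta(u,v)$ for all $u+Iv\in W$, $I\in\mathbb S$, where $\alpha,\beta$ are $\mathbb{R}_5$-valued functions on $\{(u,v)\in\mathbb{R}^2: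 u+Iv\in W\ \forall I\in\mathbb{S}\}$ with $\alpha(u,-v)=\alpha(u,v)$, $\beta(u,-v)=-\beta(u,v)$, satisfying $\partial_u\alpha=\partial_v\beta$, $\partial_v\alpha=-\partial_u\beta$. It is intrinsic if moreover $\alpha,\beta$ are real-valued. $\mathcal{SH}^L_{\sigma_S(T)}(U)$, resp. $\mathcal{N}_{\sigma_S(T)}(U)$, is the set of left slice hyperholomorphic, resp. intrinsic, functions $f$ with $\sigma_S(T)\subset U$ and with domain $\mathrm{dom}(f)\supset\overline{U}$. $fg$ is the pointwise product. For $I\in\mathbb{S}$ put $ds_I=ds(-I)$. For $h\in\mathcal{SH}^L_{\sigma_S(T)}(U)$ define $$h(T)=\frac1{2\pi}\int_{\partial(U\cap\mathbb{C}_I)}S_L^{-1}(s,T)\,ds_I\,h(s),\qquad h_D(T)=\frac1{2\pi}\int_{\partial(U\cap\mathbb{C}_I)}\big(-4\mathcal{Q}_{c,s}^{-1}(T)\big)\,ds_I\,h(s)$$ (these do not depend on $I$ or $U$; $h_D(T)$ is the bi-harmonic functional calculus, associated with $h_D=Dh$ where $D=\partial_{x_0}+\sum_{i=1}^5e_i\partial_{x_i}$). $f(\overline{T})$ is defined by the same formula with $\overline{T}$ in place of $T$. *)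

theory Defs
  imports "HOL-Complex_Analysis.Winding_Numbers"
begin

unbundle no fps_syntax

section \<open>The Clifford algebra and the Clifford module over a real vector space\<close>

text \<open>
  The basis element \<open>e\<^sub>A = e\<^sub>i\<^sub>1 \<cdots> e\<^sub>i\<^sub>k\<close> (with \<open>i\<^sub>1 < \<dots> < i\<^sub>k\<close>) is indexed by the set
  \<open>A = {i\<^sub>1, \<dots>, i\<^sub>k}\<close> of elements of the five-element type \<open>5\<close>.  An element of
  \<open>V \<otimes> \<real>\<^sub>5\<close> is the family of its coefficients with respect to this basis; the
  Clifford algebra itself is the case \<open>V = \<real>\<close>.  The norm is the Euclidean combination of
  the norms of the coefficients.

  The type \<^typ>\<open>real ^ 5 set\<close> also carries the componentwise ring structure of
  the library (including \<open>*\<close>, \<open>1\<close> and numerals).  That structure is never used here: the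
  Clifford product is \<open>\<star>\<close>.
\<close>

type_synonym 'v cliffmod = "('v, 5 set) vec"
type_synonym cliff = "real cliffmod"
type_synonym 'v cliffop = "'v cliffmod \<Rightarrow>\<^sub>L 'v cliffmod"

text \<open>\<open>e\<^sub>A e\<^sub>B = clsign A B e\<^bsub>A \<triangle> B\<^esub>\<close>: one sign for each transposition needed to sort the
  factors (the pairs with \<open>j < i\<close>) and one for each square \<open>e\<^sub>i\<^sup>2 = -1\<close> (the pairs with \<open>j = i\<close>).\<close>

definition clsign :: "5 set \<Rightarrow> 5 set \<Rightarrow> real" where
  "clsign A B = (- 1) ^ card {(i, j). i \<in> A \<and> j \<in> B \<and> j \<le> i}"

text \<open>Left action of the Clifford algebra on the module; for \<open>'v = real\<close> it is the Clifford product.\<close>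

definition clmul :: "cliff \<Rightarrow> 'v::real_vector cliffmod \<Rightarrow> 'v cliffmod" (infixr \<open>\<star>\<close> 70) where
  "a \<star> v = (\<Sum>A\<in>UNIV. \<Sum>B\<in>UNIV. axis (sym_diff A B) ((clsign A B * a $ A) *\<^sub>R v $ B))"

definition clmul_right :: "'v::real_vector cliffmod \<Rightarrow> cliff \<Rightarrow> 'v cliffmod" where
  "clmul_right v a = (\<Sum>A\<in>UNIV. \<Sum>B\<in>UNIV. axis (sym_diff A B) ((clsign A B * a $ B) *\<^sub>R v $ A))"

definition cl_basis :: "5 set \<Rightarrow> cliff" where
  "cl_basis A = axis A 1"

abbreviation cl_unit :: "5 \<Rightarrow> cliff" where
  "cl_unit j \<equiv> cl_basis {j}"

lemma clsign_prod: "clsign A B = (\<Prod>i\<in>A. \<Prod>j\<in>B. if j \<le> i then - 1 else 1)"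
proof -
  have "(\<Prod>i\<in>A. \<Prod>j\<in>B. if j \<le> i then - 1 else (1::real)) =
      (\<Prod>p\<in>A \<times> B. if snd p \<le> fst p then - 1 else 1)"
    by (simp add: prod.cartesian_product case_prod_beta)
  also have "\<dots> = (\<Prod>p\<in>{p\<in>A \<times> B. snd p \<le> fst p}. - 1)"
    by (rule prod.inter_filter [symmetric]) simp
  also have "\<dots> = (- 1) ^ card {p\<in>A \<times> B. snd p \<le> fst p}"
    by simp
  also have "{p\<in>A \<times> B. snd p \<le> fst p} = {(i, j). i \<in> A \<and> j \<in> B \<and> j \<le> i}"
    by auto
  finally show ?thesis by (simp add: clsign_def)
qed

lemma prod_sym_diff:
  fixes f :: "'i::finite \<Rightarrow> real"
  assumes "\<And>i. f i * f i = 1"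
  shows "prod f (sym_diff A B) = prod f A * prod f B"
proof -
  have A: "prod f A = prod f (A - B) * prod f (A \<inter> B)"
    by (subst prod.union_disjoint [symmetric]) (auto intro!: prod.cong)
  have B: "prod f B = prod f (B - A) * prod f (A \<inter> B)"
    by (subst prod.union_disjoint [symmetric]) (auto intro!: prod.cong)
  have sq: "prod f (A \<inter> B) * prod f (A \<inter> B) = 1"
    by (simp add: assms flip: prod.distrib)
  have "prod f (sym_diff A B) = prod f (A - B) * prod f (B - A)"
    by (subst prod.union_disjoint [symmetric]) auto
  also have "\<dots> = prod f (A - B) * prod f (B - A) * (prod f (A \<inter> B) * prod f (A \<inter> B))"
    by (simp only: sq mult_1_right)
  finally show ?thesis by (simp add: A B mult_ac)
qed

lemma clsign_sym_diff_left: "clsign (sym_diff A A') B = clsign A B * clsign A' B"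
  unfolding clsign_prod by (intro prod_sym_diff) (simp flip: prod.distrib add: if_distrib cong: if_cong)

lemma clsign_sym_diff_right: "clsign A (sym_diff B B') = clsign A B * clsign A B'"
  unfolding clsign_prod by (subst prod_sym_diff) (auto simp flip: prod.distrib)

lemma bounded_linear_axis: "bounded_linear (axis i :: 'v::real_normed_vector \<Rightarrow> 'v ^ 'n)"
proof (rule bounded_linear_intro [where K = 1])
  fix x y :: 'v and r :: real
  show "axis i (x + y) = (axis i x + axis i y :: 'v ^ 'n)"
    by (simp add: vec_eq_iff axis_def)
  show "axis i (r *\<^sub>R x) = (r *\<^sub>R axis i x :: 'v ^ 'n)"
    by (simp add: vec_eq_iff axis_def)
  have "norm (axis i x :: 'v ^ 'n) = L2_set (\<lambda>j. if j = i then norm x else 0) UNIV"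
    by (auto simp: norm_vec_def axis_def intro!: arg_cong [where f = "\<lambda>f. L2_set f UNIV"])
  also have "\<dots> = norm x"
    by (simp add: L2_set_def if_distrib [where f = "\<lambda>t. t\<^sup>2"] cong: if_cong)
  finally show "norm (axis i x :: 'v ^ 'n) \<le> norm x * 1" by simp
qed

lemma bounded_linear_clmul: "bounded_linear (\<lambda>v::'v::real_normed_vector cliffmod. a \<star> v)"
  unfolding clmul_def
  by (intro bounded_linear_sum bounded_linear_compose [OF bounded_linear_axis]
      bounded_linear_compose [OF bounded_linear_scaleR_right] bounded_linear_vec_nth)

lemma cl_axis_sum: "v = (\<Sum>A\<in>UNIV. axis A (v $ A))" for v :: "'v::real_vector cliffmod"
  by (simp add: vec_eq_iff axis_def)

lemma axis_0: "axis i (0::'v::zero) = 0"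
  by (simp add: vec_eq_iff axis_def)

lemma clmul_axis_axis:
  "axis A r \<star> axis B x = axis (sym_diff A B) ((clsign A B * r) *\<^sub>R x)"
proof -
  have "axis A r \<star> axis B x = (\<Sum>A'\<in>UNIV. \<Sum>B'\<in>UNIV.
      if A' = A \<and> B' = B then axis (sym_diff A B) ((clsign A B * r) *\<^sub>R x) else 0)"
    unfolding clmul_def by (intro sum.cong refl) (auto simp: axis_def vec_eq_iff)
  also have "\<dots> = (\<Sum>A'\<in>UNIV. if A' = A then \<Sum>B'\<in>UNIV.
      if B' = B then axis (sym_diff A B) ((clsign A B * r) *\<^sub>R x) else 0 else 0)"
    by (intro sum.cong refl) auto
  also have "\<dots> = axis (sym_diff A B) ((clsign A B * r) *\<^sub>R x)"
    by simp
  finally show ?thesis .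
qed

lemma clmul_right_axis_axis:
  "clmul_right (axis A x) (axis B r) = axis (sym_diff A B) ((clsign A B * r) *\<^sub>R x)"
proof -
  have "clmul_right (axis A x) (axis B r) = (\<Sum>A'\<in>UNIV. \<Sum>B'\<in>UNIV.
      if A' = A \<and> B' = B then axis (sym_diff A B) ((clsign A B * r) *\<^sub>R x) else 0)"
    unfolding clmul_right_def by (intro sum.cong refl) (auto simp: axis_def vec_eq_iff)
  also have "\<dots> = (\<Sum>A'\<in>UNIV. if A' = A then \<Sum>B'\<in>UNIV.
      if B' = B then axis (sym_diff A B) ((clsign A B * r) *\<^sub>R x) else 0 else 0)"
    by (intro sum.cong refl) auto
  also have "\<dots> = axis (sym_diff A B) ((clsign A B * r) *\<^sub>R x)"
    by simp
  finally show ?thesis .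
qed

lemma axis_add: "axis i (x + y) = axis i x + axis i (y::'v::monoid_add)"
  by (simp add: vec_eq_iff axis_def)

lemma clmul_sum_left: "finite I \<Longrightarrow> sum f I \<star> v = (\<Sum>i\<in>I. f i \<star> v)"
proof (induction I rule: finite_induct)
  case empty
  show ?case by (simp add: clmul_def axis_0)
next
  case (insert i I)
  then show ?case
    by (simp add: clmul_def distrib_left scaleR_add_left axis_add sum.distrib)
qed

lemma clmul_sum_right: "finite I \<Longrightarrow> a \<star> sum f I = (\<Sum>i\<in>I. a \<star> f i)"
proof (induction I rule: finite_induct)
  case empty
  show ?case by (simp add: clmul_def axis_0)
next
  case (insert i I)
  then show ?case
    by (simp add: clmul_def scaleR_add_right axis_add sum.distrib)
qed

lemma clmul_right_sum_left: "finite I \<Longrightarrow> clmul_right (sum f I) a = (\<Sum>i\<in>I. clmul_right (f i) a)"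
proof (induction I rule: finite_induct)
  case empty
  show ?case by (simp add: clmul_right_def axis_0)
next
  case (insert i I)
  then show ?case
    by (simp add: clmul_right_def scaleR_add_right axis_add sum.distrib)
qed

lemma clmul_right_sum_right: "finite I \<Longrightarrow> clmul_right v (sum f I) = (\<Sum>i\<in>I. clmul_right v (f i))"
proof (induction I rule: finite_induct)
  case empty
  show ?case by (simp add: clmul_right_def axis_0)
next
  case (insert i I)
  then show ?case
    by (simp add: clmul_right_def distrib_left scaleR_add_left axis_add sum.distrib)
qed

lemma sym_diff_assoc: "sym_diff (sym_diff A B) C = sym_diff A (sym_diff B C)"
  by auto

lemma clmul_assoc: "(a \<star> b) \<star> v = a \<star> (b \<star> v)"
proof -
  have *: "(axis A r \<star> axis B s) \<star> axis C x = axis A r \<star> (axis B s \<star> axis C x)"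
    for A B C r s and x :: "'a"
    by (simp only: clmul_axis_axis sym_diff_assoc clsign_sym_diff_left clsign_sym_diff_right)
      (simp add: mult_ac)
  have "((\<Sum>A\<in>UNIV. axis A (a $ A)) \<star> (\<Sum>B\<in>UNIV. axis B (b $ B))) \<star> (\<Sum>C\<in>UNIV. axis C (v $ C)) =
    (\<Sum>A\<in>UNIV. axis A (a $ A)) \<star> ((\<Sum>B\<in>UNIV. axis B (b $ B)) \<star> (\<Sum>C\<in>UNIV. axis C (v $ C)))"
    by (simp add: clmul_sum_left clmul_sum_right *)
  then show ?thesis by (simp flip: cl_axis_sum)
qed

lemma clmul_clmul_right: "clmul_right (a \<star> v) b = a \<star> clmul_right v b"
proof -
  have *: "clmul_right (axis A r \<star> axis C x) (axis B s) = axis A r \<star> clmul_right (axis C x) (axis B s)"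
    for A B C r s and x :: "'a"
    by (simp only: clmul_axis_axis clmul_right_axis_axis sym_diff_assoc clsign_sym_diff_left
        clsign_sym_diff_right) (simp add: mult_ac)
  have "clmul_right ((\<Sum>A\<in>UNIV. axis A (a $ A)) \<star> (\<Sum>C\<in>UNIV. axis C (v $ C)))
      (\<Sum>B\<in>UNIV. axis B (b $ B)) =
    (\<Sum>A\<in>UNIV. axis A (a $ A)) \<star> clmul_right (\<Sum>C\<in>UNIV. axis C (v $ C)) (\<Sum>B\<in>UNIV. axis B (b $ B))"
    by (simp add: clmul_sum_left clmul_sum_right clmul_right_sum_left clmul_right_sum_right *)
  then show ?thesis by (simp flip: cl_axis_sum)
qed

lemma cl_basis_empty_left: "cl_basis {} \<star> v = v"
proof -
  have "cl_basis {} \<star> (\<Sum>C\<in>UNIV. axis C (v $ C)) = (\<Sum>C\<in>UNIV. axis C (v $ C))"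
    by (simp add: clmul_sum_right cl_basis_def clmul_axis_axis clsign_def)
  then show ?thesis by (simp flip: cl_axis_sum)
qed

lemma cl_unit_square: "cl_unit j \<star> cl_unit j = - cl_basis {}"
  by (simp add: cl_basis_def clmul_axis_axis clsign_prod) (simp add: axis_def vec_eq_iff)

lemma cl_unit_anticommute:
  assumes "i \<noteq> j"
  shows "cl_unit i \<star> cl_unit j + cl_unit j \<star> cl_unit i = 0"
proof -
  have sign: "clsign {j} {i} = - clsign {i} {j}"
    using assms linear [of i j] antisym [of i j] by (auto simp: clsign_prod)
  have "sym_diff {j} {i} = sym_diff {i} {j}"
    by (rule Un_commute)
  then show ?thesis
    unfolding cl_basis_def clmul_axis_axis sign by (simp add: vec_eq_iff axis_def)
qed


section \<open>Paravectors and slices\<close>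

text \<open>\<open>\<real>\<^sup>6\<close> is \<^typ>\<open>real \<times> (real ^ 5)\<close>: scalar part and vector part.  The product norm is the Euclidean one.\<close>

type_synonym paravector = "real \<times> (real ^ 5)"

definition para :: "paravector \<Rightarrow> cliff" where
  "para x = fst x *\<^sub>R cl_basis {} + (\<Sum>j\<in>UNIV. (snd x $ j) *\<^sub>R cl_unit j)"

definition imag_sphere :: "(real ^ 5) set" where
  "imag_sphere = {I. norm I = 1}"

text \<open>The identification \<open>u + \<i>v \<mapsto> u + I v\<close> of the complex plane with \<open>\<complex>\<^sub>I\<close>.\<close>

definition slice :: "real ^ 5 \<Rightarrow> complex \<Rightarrow> paravector" where
  "slice I z = (Re z, Im z *\<^sub>R I)"

definition sphere_of :: "paravector \<Rightarrow> paravector set" where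
  "sphere_of x = {slice I (Complex (fst x) (norm (snd x))) | I. I \<in> imag_sphere}"

definition axially_symmetric :: "paravector set \<Rightarrow> bool" where
  "axially_symmetric U \<longleftrightarrow> (\<forall>x\<in>U. sphere_of x \<subseteq> U)"

text \<open>
  The usual notion of a piecewise \<open>C\<^sup>1\<close> curve: \<open>C\<^sup>1\<close> up to the end points (with one-sided
  derivatives) on each closed piece of some partition.  The library's \<^const>\<open>valid_path\<close>
  is more permissive, since derivatives may blow up at the partition points.
\<close>

definition piecewise_C1_path :: "(real \<Rightarrow> complex) \<Rightarrow> bool" where
  "piecewise_C1_path \<gamma> \<longleftrightarrow> path \<gamma> \<and>
     (\<exists>P. finite P \<and> {0, 1} \<subseteq> P \<and> P \<subseteq> {0..1} \<and>
        (\<forall>a\<in>P. \<forall>b\<in>P. a < b \<longrightarrow> {a<..<b} \<inter> P = {} \<longrightarrow>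
          (\<exists>D. continuous_on {a..b} D \<and>
             (\<forall>t\<in>{a..b}. (\<gamma> has_vector_derivative D t) (at t within {a..b})))))"

text \<open>
  \<open>\<Gamma>\<close> is a positively oriented parametrisation of the boundary of the bounded planar open set \<open>D\<close>
  by finitely many pairwise disjoint piecewise \<open>C\<^sup>1\<close> Jordan curves.  The orientation is
  expressed by the total winding number: 1 around points of \<open>D\<close>, 0 around exterior points.
\<close>

definition positive_boundary :: "complex set \<Rightarrow> (real \<Rightarrow> complex) set \<Rightarrow> bool" where
  "positive_boundary D \<Gamma> \<longleftrightarrow>
     finite \<Gamma> \<and>
     (\<forall>\<gamma>\<in>\<Gamma>. piecewise_C1_path \<gamma> \<and> simple_path \<gamma> \<and> pathfinish \<gamma> = pathstart \<gamma>) \<and>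
     pairwise (\<lambda>\<gamma> \<delta>. disjnt (path_image \<gamma>) (path_image \<delta>)) \<Gamma> \<and>
     frontier D = (\<Union>\<gamma>\<in>\<Gamma>. path_image \<gamma>) \<and>
     (\<forall>z\<in>D. (\<Sum>\<gamma>\<in>\<Gamma>. winding_number \<gamma> z) = 1) \<and>
     (\<forall>z. z \<notin> closure D \<longrightarrow> (\<Sum>\<gamma>\<in>\<Gamma>. winding_number \<gamma> z) = 0)"

definition bounded_slice_Cauchy_domain :: "paravector set \<Rightarrow> bool" where
  "bounded_slice_Cauchy_domain U \<longleftrightarrow>
     open U \<and> bounded U \<and> axially_symmetric U \<and>
     (\<forall>I\<in>imag_sphere. \<exists>\<Gamma>. positive_boundary (slice I -` U) \<Gamma>)"


section \<open>Slice hyperholomorphic functions\<close>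

definition slice_domain :: "paravector set \<Rightarrow> (real \<times> real) set" where
  "slice_domain W = {(u, v). \<forall>I\<in>imag_sphere. slice I (Complex u v) \<in> W}"

text \<open>\<open>f(u + I v) = \<alpha>(u, v) + I \<beta>(u, v)\<close> on \<open>W\<close>, with the parity and Cauchy-Riemann conditions.\<close>

definition slice_components ::
  "paravector set \<Rightarrow> (paravector \<Rightarrow> cliff) \<Rightarrow> (real \<times> real \<Rightarrow> cliff) \<Rightarrow> (real \<times> real \<Rightarrow> cliff) \<Rightarrow> bool" where
  "slice_components W f \<alpha> \<beta> \<longleftrightarrow>
     (\<forall>I\<in>imag_sphere. \<forall>u v. slice I (Complex u v) \<in> W \<longrightarrow>
        f (slice I (Complex u v)) = \<alpha> (u, v) + para (0, I) \<star> \<beta> (u, v)) \<and>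
     (\<forall>(u, v)\<in>slice_domain W. \<alpha> (u, - v) = \<alpha> (u, v) \<and> \<beta> (u, - v) = - \<beta> (u, v)) \<and>
     (\<forall>p\<in>slice_domain W. \<alpha> differentiable (at p) \<and> \<beta> differentiable (at p) \<and>
        frechet_derivative \<alpha> (at p) (1, 0) = frechet_derivative \<beta> (at p) (0, 1) \<and>
        frechet_derivative \<alpha> (at p) (0, 1) = - frechet_derivative \<beta> (at p) (1, 0))"

definition left_slice_hyperholomorphic_on ::
  "paravector set \<Rightarrow> (paravector \<Rightarrow> cliff) \<Rightarrow> bool" where
  "left_slice_hyperholomorphic_on W f \<longleftrightarrow>
     open W \<and> axially_symmetric W \<and> (\<exists>\<alpha> \<beta>. slice_components W f \<alpha> \<beta>)"

definition intrinsic_slice_hyperholomorphic_on ::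
  "paravector set \<Rightarrow> (paravector \<Rightarrow> cliff) \<Rightarrow> bool" where
  "intrinsic_slice_hyperholomorphic_on W f \<longleftrightarrow>
     open W \<and> axially_symmetric W \<and>
     (\<exists>\<alpha> \<beta>. slice_components W f \<alpha> \<beta> \<and>
        (\<forall>p\<in>slice_domain W. \<alpha> p \<in> range (\<lambda>r. r *\<^sub>R cl_basis {}) \<and> \<beta> p \<in> range (\<lambda>r. r *\<^sub>R cl_basis {})))"


section \<open>Operators\<close>

definition right_linear :: "'v::real_normed_vector cliffop \<Rightarrow> bool" where
  "right_linear A \<longleftrightarrow> (\<forall>v a. A (clmul_right v a) = clmul_right (A v) a)"

lift_definition left_mult :: "cliff \<Rightarrow> 'v::real_normed_vector cliffop" is "\<lambda>a v. a \<star> v"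
  by (rule bounded_linear_clmul)

lift_definition extend_op ::
  "('v::real_normed_vector \<Rightarrow>\<^sub>L 'v) \<Rightarrow> 'v cliffop" is "\<lambda>B v. \<Sum>A\<in>UNIV. axis A (B (v $ A))"
  subgoal premises B
    by (intro bounded_linear_sum)
      (rule bounded_linear_compose [OF bounded_linear_axis
          bounded_linear_compose [OF B bounded_linear_vec_nth]])
  done

text \<open>A right-linear \<open>T\<close> is \<open>\<Sum>\<^sub>A e\<^sub>A T\<^sub>A\<close>; its coefficients \<open>T\<^sub>A\<close> are read off on \<open>V \<otimes> 1\<close>.\<close>

lift_definition coeff_op ::
  "'v::real_normed_vector cliffop \<Rightarrow> 5 set \<Rightarrow> ('v \<Rightarrow>\<^sub>L 'v)" is "\<lambda>T A x. T (axis {} x) $ A"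
  subgoal premises T
    by (rule bounded_linear_compose [OF bounded_linear_vec_nth
          bounded_linear_compose [OF T bounded_linear_axis]])
  done

definition paravector_op ::
  "('v::real_normed_vector \<Rightarrow>\<^sub>L 'v) \<Rightarrow> (5 \<Rightarrow> 'v \<Rightarrow>\<^sub>L 'v) \<Rightarrow> 'v cliffop" where
  "paravector_op T0 Ts = extend_op T0 + (\<Sum>j\<in>UNIV. left_mult (cl_unit j) o\<^sub>L extend_op (Ts j))"

definition BC01 :: "'v::real_normed_vector cliffop set" where
  "BC01 = {paravector_op T0 Ts | T0 Ts.
     (\<forall>j. T0 o\<^sub>L Ts j = Ts j o\<^sub>L T0) \<and> (\<forall>i j. Ts i o\<^sub>L Ts j = Ts j o\<^sub>L Ts i)}"

definition conj_op :: "'v::real_normed_vector cliffop \<Rightarrow> 'v cliffop" where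
  "conj_op T = extend_op (coeff_op T {}) -
     (\<Sum>j\<in>UNIV. left_mult (cl_unit j) o\<^sub>L extend_op (coeff_op T {j}))"

definition inverse_pair :: "'v::real_normed_vector cliffop \<Rightarrow> 'v cliffop \<Rightarrow> bool" where
  "inverse_pair A B \<longleftrightarrow> right_linear B \<and> A o\<^sub>L B = id_blinfun \<and> B o\<^sub>L A = id_blinfun"

definition op_inv :: "'v::real_normed_vector cliffop \<Rightarrow> 'v cliffop" where
  "op_inv A = (THE B. inverse_pair A B)"

definition S_spectrum :: "'v::real_normed_vector cliffop \<Rightarrow> paravector set" where
  "S_spectrum T = {s. \<not> (\<exists>B. inverse_pair
     ((T o\<^sub>L T) - (2 * fst s) *\<^sub>R T + (norm s)\<^sup>2 *\<^sub>R id_blinfun) B)}"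

text \<open>
  The spectrum of an operator on a real Banach space is the spectrum of its complexification.
  Here \<open>V \<times> V\<close> stands for \<open>V + \<i>V\<close>, and \<open>complexified_minus z A\<close> is \<open>z - A\<close> there.
\<close>

lift_definition complexified_minus ::
  "complex \<Rightarrow> ('v::real_normed_vector \<Rightarrow>\<^sub>L 'v) \<Rightarrow> (('v \<times> 'v) \<Rightarrow>\<^sub>L ('v \<times> 'v))" is
  "\<lambda>z A p. (Re z *\<^sub>R fst p - Im z *\<^sub>R snd p - A (fst p),
            Im z *\<^sub>R fst p + Re z *\<^sub>R snd p - A (snd p))"
  subgoal premises A
    by (intro bounded_linear_Pair bounded_linear_sub bounded_linear_add
        bounded_linear_compose [OF bounded_linear_scaleR_right]
        bounded_linear_compose [OF A] bounded_linear_fst bounded_linear_snd)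
  done

definition complex_spectrum :: "('v::real_normed_vector \<Rightarrow>\<^sub>L 'v) \<Rightarrow> complex set" where
  "complex_spectrum A = {z. \<not> (\<exists>B. complexified_minus z A o\<^sub>L B = id_blinfun \<and>
     B o\<^sub>L complexified_minus z A = id_blinfun)}"

lemma right_linear_left_mult: "right_linear (left_mult a)"
  by (simp add: right_linear_def left_mult.rep_eq clmul_clmul_right)

lemma extend_op_nth: "extend_op B v $ A = B (v $ A)"
  by (simp add: extend_op.rep_eq axis_def)

lemma coeff_op_paravector_op:
  fixes T0 :: "'a::real_normed_vector \<Rightarrow>\<^sub>L 'a"
  shows "coeff_op (paravector_op T0 Ts) {} = T0"
    and "coeff_op (paravector_op T0 Ts) {j} = Ts j"
proof -
  have ext: "extend_op B (axis {} x) = axis {} (B x)" for B :: "'a \<Rightarrow>\<^sub>L 'a" and x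
    by (simp add: vec_eq_iff extend_op_nth axis_def blinfun.zero_right)
  have app: "paravector_op T0 Ts (axis {} x) = axis {} (T0 x) + (\<Sum>j\<in>UNIV. axis {j} (Ts j x))" for x
    by (simp add: paravector_op_def blinfun.add_left blinfun.sum_left ext left_mult.rep_eq
        cl_basis_def clmul_axis_axis clsign_def)
  show "coeff_op (paravector_op T0 Ts) {} = T0"
    by (rule blinfun_eqI, simp only: coeff_op.rep_eq app) (simp add: axis_def)
  show "coeff_op (paravector_op T0 Ts) {j} = Ts j"
    by (rule blinfun_eqI, simp only: coeff_op.rep_eq app) (simp add: axis_def)
qed


section \<open>Functional calculi\<close>

definition Qc :: "paravector \<Rightarrow> 'v::real_normed_vector cliffop \<Rightarrow> 'v cliffop" where
  "Qc s T = left_mult (para s \<star> para s) - (left_mult (para s) o\<^sub>L (T + conj_op T)) + (T o\<^sub>L conj_op T)"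

definition Qc_inv :: "paravector \<Rightarrow> 'v::real_normed_vector cliffop \<Rightarrow> 'v cliffop" where
  "Qc_inv s T = op_inv (Qc s T)"

definition SL_inv :: "paravector \<Rightarrow> 'v::real_normed_vector cliffop \<Rightarrow> 'v cliffop" where
  "SL_inv s T = (left_mult (para s) - conj_op T) o\<^sub>L Qc_inv s T"

text \<open>
  \<open>\<integral> K(s) ds\<^sub>I h(s)\<close> over the curves in \<open>\<complex>\<^sub>I\<close> that correspond to the curves \<open>\<Gamma>\<close> in the complex
  plane, where \<open>ds\<^sub>I = ds (-I)\<close>.
\<close>

definition slice_integral ::
  "real ^ 5 \<Rightarrow> (real \<Rightarrow> complex) set \<Rightarrow> (paravector \<Rightarrow> 'v::real_normed_vector cliffop) \<Rightarrow>
    (paravector \<Rightarrow> cliff) \<Rightarrow> 'v cliffop" where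
  "slice_integral I \<Gamma> K h = (\<Sum>\<gamma>\<in>\<Gamma>. integral {0..1} (\<lambda>t.
     K (slice I (\<gamma> t)) o\<^sub>L
     left_mult (para (slice I (vector_derivative \<gamma> (at t within {0..1}))) \<star> (- para (0, I))
       \<star> h (slice I (\<gamma> t)))))"

definition SL_calculus ::
  "real ^ 5 \<Rightarrow> (real \<Rightarrow> complex) set \<Rightarrow> (paravector \<Rightarrow> cliff) \<Rightarrow> 'v::real_normed_vector cliffop \<Rightarrow>
    'v cliffop" where
  "SL_calculus I \<Gamma> h T = (1 / (2 * pi)) *\<^sub>R slice_integral I \<Gamma> (\<lambda>s. SL_inv s T) h"

definition biharmonic_calculus ::
  "real ^ 5 \<Rightarrow> (real \<Rightarrow> complex) set \<Rightarrow> (paravector \<Rightarrow> cliff) \<Rightarrow> 'v::real_normed_vector cliffop \<Rightarrow>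
    'v cliffop" where
  "biharmonic_calculus I \<Gamma> h T =
     (1 / (2 * pi)) *\<^sub>R slice_integral I \<Gamma> (\<lambda>s. (- 4) *\<^sub>R Qc_inv s T) h"

text \<open>Functions are total here; the domain of \<open>f\<close> is represented by the existentially quantified \<open>W\<close>.\<close>

definition SHL :: "'v::real_normed_vector cliffop \<Rightarrow> paravector set \<Rightarrow> (paravector \<Rightarrow> cliff) set" where
  "SHL T U = {f. S_spectrum T \<subseteq> U \<and> (\<exists>W. closure U \<subseteq> W \<and> left_slice_hyperholomorphic_on W f)}"

definition SN :: "'v::real_normed_vector cliffop \<Rightarrow> paravector set \<Rightarrow> (paravector \<Rightarrow> cliff) set" where
  "SN T U = {f. S_spectrum T \<subseteq> U \<and> (\<exists>W. closure U \<subseteq> W \<and> intrinsic_slice_hyperholomorphic_on W f)}"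

end

theory Submission
  imports Defs "HOL-Complex_Analysis.Cauchy_Integral_Formula"
begin

text \<open>The components of \<open>T\<close> commute and \<open>T\<^sub>0 = 0\<close>, so \<open>T\<^sup>2 = - (T\<^sub>1\<^sup>2 + \<dots> + T\<^sub>5\<^sup>2)\<close> acts
componentwise and commutes with left multiplication by Clifford numbers, while \<open>conj_op T = - T\<close>.
Write \<open>N = - T\<^sup>2\<close> and let \<open>J\<close> be left multiplication by the imaginary unit \<open>I\<close>.  As
\<open>J\<^sup>2 = - 1\<close>, the points \<open>z\<close> of the slice act as \<open>M z = Re z + Im z J\<close>, and
\<open>Q\<^sub>c\<^sub>,\<^sub>z = M (z\<^sup>2) + N\<close>: on the slice everything is a holomorphic functional calculus for the
quadratic pencil \<open>z\<^sup>2 + N\<close> on a Banach space with a complex structure \<open>J\<close> that commutes with \<open>N\<close>.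

Let \<open>R z = (z\<^sup>2 + N)\<^sup>-\<^sup>1\<close>, let \<open>\<phi>\<close> be the complex function of which \<open>f\<close> is the
intrinsic extension, \<open>G z\<close> left multiplication by \<open>g\<close>, and \<open>\<integral>\<close> the integral over the boundary
divided by \<open>2 \<pi> \<i>\<close>.  With \<open>X\<^sub>0 = \<integral> \<phi> R\<close>, \<open>X\<^sub>1 = \<integral> \<phi> z R\<close>, \<open>G\<^sub>0 = \<integral> R G\<close> and
\<open>G\<^sub>1 = \<integral> z R G\<close>, the operators of the theorem are \<open>f\<^sub>D(T) = - 4 X\<^sub>0\<close>,
\<open>g\<^sub>D(T) = - 4 G\<^sub>0\<close>, \<open>g(T) = G\<^sub>1 + T G\<^sub>0\<close>, \<open>f(conj_op T) = X\<^sub>1 - T X\<^sub>0\<close> and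
\<open>(f g)\<^sub>D(T) = - 4 \<integral> \<phi> R G\<close>.  Two facts remain.

First, \<open>X\<^sub>0\<close> commutes with \<open>T\<close> (\<open>loop_integral_intrinsic_commute_all\<close>), so that the two terms with
\<open>T\<close> on the right-hand side cancel.  The part of \<open>T\<close> that commutes with \<open>J\<close> is harmless.  The part that
anticommutes with \<open>J\<close> conjugates the integrand and the curves; since \<open>\<phi>\<close> takes conjugate values at
conjugate points and the domain is symmetric, Cauchy's theorem gives the same integral back.

Second, \<open>X\<^sub>0 G\<^sub>1 + X\<^sub>1 G\<^sub>0 = \<integral> \<phi> R G\<close> (\<open>loop_integral_product\<close>).  If \<open>N = - w\<^sup>2\<close>,
this says that the coefficient \<open>(h(w) - h(- w)) / (2 w)\<close> of a product obeys a Leibniz rule together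
with \<open>(h(w) + h(- w)) / 2\<close>.  The usual proof integrates the resolvent equation
\<open>R s - R p = (p\<^sup>2 - s\<^sup>2) R s R p\<close> over two nested contours.  Here both integrals run over the same
curves, and the singular factor is replaced by the divided difference \<open>(\<phi> s - \<phi> p) / (s - p)\<close>,
which is regular on the diagonal.

Both facts need Cauchy's theorem for operator-valued functions and several curves.  The
operator-valued case follows from the scalar one by composing with functionals, of which there
are enough by a Hahn-Banach argument; several curves are joined to one loop in each component of
the domain.  Finally, the resolvent exists outside \<open>U\<close>: the product of the operators
\<open>T\<^sup>2 \<plusminus> 2 Re(s) T + \<bar>s\<bar>\<^sup>2\<close> is the product of the pencil at \<open>s\<close> and at its conjugate, and the grade
involution of the Clifford module carries one of these operators to the other
(\<open>not_S_spectrum_imp_regular\<close>).\<close>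


section \<open>Bounded functionals separate points\<close>

definition sublinear :: "('a::real_vector \<Rightarrow> real) \<Rightarrow> bool" where
  "sublinear p \<longleftrightarrow> (\<forall>x y. p (x + y) \<le> p x + p y) \<and> (\<forall>c>0. \<forall>x. p (c *\<^sub>R x) \<le> c * p x)"

lemma sublinear_scaleR:
  assumes p: "sublinear p" and c: "c > 0"
  shows "p (c *\<^sub>R x) = c * p x"
proof (rule antisym)
  show "p (c *\<^sub>R x) \<le> c * p x" using assms by (auto simp: sublinear_def)
  have "p (inverse c *\<^sub>R c *\<^sub>R x) \<le> inverse c * p (c *\<^sub>R x)"
    using assms unfolding sublinear_def by (metis inverse_positive_iff_positive)
  then show "c * p x \<le> p (c *\<^sub>R x)" using c by (simp add: field_simps)
qed

lemma sublinear_zero: "sublinear p \<Longrightarrow> p 0 = 0"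
  using sublinear_scaleR [of p 2 0] by simp

lemma sublinear_add: "sublinear p \<Longrightarrow> p (x + y) \<le> p x + p y"
  by (simp add: sublinear_def)

text \<open>The function \<open>q x = inf\<^sub>t (p (x + t y) - t p y)\<close> over \<open>t \<ge> 0\<close>, the largest way to force \<open>p\<close> to be
additive in the direction \<open>y\<close>: the last property for \<open>q = p\<close> is half of additivity.\<close>

lemma sublinear_shift:
  fixes y :: "'a::real_vector"
  assumes p: "sublinear p"
  obtains q where "sublinear q" "q \<le> p" "\<And>x. q x \<le> p (x + y) - p y"
proof -
  define q where "q x = (INF t\<in>{0..}. p (x + t *\<^sub>R y) - t * p y)" for x
  have hom: "p (t *\<^sub>R z) = t * p z" if "t \<ge> 0" for t z
    using that sublinear_scaleR [OF p, of t z] sublinear_zero [OF p] by (cases "t = 0") auto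
  have bdd: "bdd_below ((\<lambda>t. p (x + t *\<^sub>R y) - t * p y) ` {0..})" for x
  proof (rule bdd_belowI2 [of _ "- p (- x)"])
    fix t :: real assume "t \<in> {0..}"
    then have "t * p y = p ((x + t *\<^sub>R y) + (- x))" by (simp add: hom)
    also have "\<dots> \<le> p (x + t *\<^sub>R y) + p (- x)" by (rule sublinear_add [OF p])
    finally show "- p (- x) \<le> p (x + t *\<^sub>R y) - t * p y" by simp
  qed
  have le: "q x \<le> p (x + t *\<^sub>R y) - t * p y" if "t \<ge> 0" for x t
    unfolding q_def by (rule cINF_lower [OF bdd]) (use that in auto)
  have ge: "b \<le> q x" if "\<And>t. t \<ge> 0 \<Longrightarrow> b \<le> p (x + t *\<^sub>R y) - t * p y" for b x
    unfolding q_def by (rule cINF_greatest) (use that in auto)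
  have "sublinear q"
    unfolding sublinear_def
  proof (intro conjI allI impI)
    fix x z
    have "q (x + z) - q z \<le> q x"
    proof (rule ge)
      fix t :: real assume t: "t \<ge> 0"
      have "q (x + z) - (p (x + t *\<^sub>R y) - t * p y) \<le> q z"
      proof (rule ge)
        fix u :: real assume u: "u \<ge> 0"
        have "q (x + z) \<le> p ((x + t *\<^sub>R y) + (z + u *\<^sub>R y)) - (t + u) * p y"
          using le [of "t + u" "x + z"] t u by (simp add: algebra_simps)
        also have "\<dots> \<le> p (x + t *\<^sub>R y) + p (z + u *\<^sub>R y) - (t + u) * p y"
          using sublinear_add [OF p] by simp
        finally show "q (x + z) - (p (x + t *\<^sub>R y) - t * p y) \<le> p (z + u *\<^sub>R y) - u * p y"
          by (simp add: algebra_simps)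
      qed
      then show "q (x + z) - q z \<le> p (x + t *\<^sub>R y) - t * p y" by simp
    qed
    then show "q (x + z) \<le> q x + q z" by simp
  next
    fix c :: real and x assume c: "c > 0"
    have "q (c *\<^sub>R x) / c \<le> q x"
    proof (rule ge)
      fix t :: real assume t: "t \<ge> 0"
      have "q (c *\<^sub>R x) \<le> p (c *\<^sub>R (x + t *\<^sub>R y)) - (c * t) * p y"
        using le [of "c * t" "c *\<^sub>R x"] t c by (simp add: algebra_simps)
      also have "\<dots> = c * (p (x + t *\<^sub>R y) - t * p y)"
        using c by (simp add: hom algebra_simps del: scaleR_add_right)
      finally show "q (c *\<^sub>R x) / c \<le> p (x + t *\<^sub>R y) - t * p y"
        using c by (simp add: field_simps)
    qed
    then show "q (c *\<^sub>R x) \<le> c * q x" using c by (simp add: field_simps)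
  qed
  moreover have "q \<le> p" using le [of 0] by (simp add: le_fun_def)
  moreover have "q x \<le> p (x + y) - p y" for x using le [of 1 x] by simp
  ultimately show ?thesis by (rule that)
qed

lemma sublinear_Inf_chain:
  fixes C :: "('a::real_vector \<Rightarrow> real) set"
  assumes ne: "C \<noteq> {}" and sub: "\<And>p. p \<in> C \<Longrightarrow> sublinear p \<and> p \<le> p0"
    and chain: "\<And>p q. p \<in> C \<Longrightarrow> q \<in> C \<Longrightarrow> p \<le> q \<or> q \<le> p"
  obtains q where "sublinear q" "\<And>p. p \<in> C \<Longrightarrow> q \<le> p"
proof -
  define q where "q x = (INF p\<in>C. p x)" for x
  have bdd: "bdd_below ((\<lambda>p. p x) ` C)" for x
  proof (rule bdd_belowI2 [of _ "- p0 (- x)"])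
    fix p assume "p \<in> C"
    then have p: "sublinear p" "p (- x) \<le> p0 (- x)" using sub by (auto simp: le_fun_def)
    then show "- p0 (- x) \<le> p x" using sublinear_add [of p x "- x"] sublinear_zero [of p] by simp
  qed
  have le: "q x \<le> p x" if "p \<in> C" for x p
    unfolding q_def by (rule cINF_lower [OF bdd that])
  have ge: "b \<le> q x" if "\<And>p. p \<in> C \<Longrightarrow> b \<le> p x" for b x
    unfolding q_def by (rule cINF_greatest [OF ne]) (use that in auto)
  have "sublinear q"
    unfolding sublinear_def
  proof (intro conjI allI impI)
    fix x y
    have "q (x + y) - q y \<le> q x"
    proof (rule ge)
      fix p assume p: "p \<in> C"
      have "q (x + y) - p x \<le> q y"
      proof (rule ge)
        fix r assume r: "r \<in> C"
        obtain s where s: "s \<in> C" "s \<le> p" "s \<le> r" using chain [OF p r] p r by auto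
        have "q (x + y) \<le> s (x + y)" by (rule le [OF s(1)])
        also have "\<dots> \<le> s x + s y" using sub [OF s(1)] by (simp add: sublinear_add)
        also have "\<dots> \<le> p x + r y" using s by (simp add: le_fun_def add_mono)
        finally show "q (x + y) - p x \<le> r y" by simp
      qed
      then show "q (x + y) - q y \<le> p x" by simp
    qed
    then show "q (x + y) \<le> q x + q y" by simp
  next
    fix c :: real and x assume c: "c > 0"
    have "q (c *\<^sub>R x) / c \<le> q x"
    proof (rule ge)
      fix p assume p: "p \<in> C"
      then have "q (c *\<^sub>R x) \<le> c * p x"
        using le [OF p, of "c *\<^sub>R x"] sub [OF p] c by (simp add: sublinear_scaleR)
      then show "q (c *\<^sub>R x) / c \<le> p x" using c by (simp add: field_simps)
    qed
    then show "q (c *\<^sub>R x) \<le> c * q x" using c by (simp add: field_simps)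
  qed
  then show ?thesis using that le by (auto simp: le_fun_def)
qed

text \<open>A minimal sublinear function below \<open>p0\<close> cannot be lowered by \<open>sublinear_shift\<close>, which makes it additive and
hence linear.  Working with sublinear functions on the whole space avoids the extension of
functionals from subspaces.\<close>

lemma linear_below_sublinear:
  fixes p0 :: "'a::real_vector \<Rightarrow> real"
  assumes p0: "sublinear p0"
  obtains \<phi> where "linear \<phi>" "\<And>x. \<phi> x \<le> p0 x"
proof -
  define A where "A = {p. sublinear p \<and> p \<le> p0}"
  have "\<exists>m\<in>A. \<forall>a\<in>A. a \<le> m \<longrightarrow> a = m"
  proof (rule predicate_Zorn [where P = "\<lambda>a b. b \<le> a"])
    show "partial_order_on A (relation_of (\<lambda>a b. b \<le> a) A)"
      by (rule partial_order_on_relation_ofI) auto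
    fix C assume C: "C \<in> Chains (relation_of (\<lambda>a b. b \<le> a) A)"
    show "\<exists>u\<in>A. \<forall>a\<in>C. u \<le> a"
    proof (cases "C = {}")
      case True
      then show ?thesis using p0 by (auto simp: A_def)
    next
      case False
      have CA: "p \<in> A" if "p \<in> C" for p using C that by (auto simp: Chains_def relation_of_def)
      have "p \<le> q \<or> q \<le> p" if "p \<in> C" "q \<in> C" for p q
        using C that by (auto simp: Chains_def relation_of_def)
      moreover have "sublinear p \<and> p \<le> p0" if "p \<in> C" for p
        using CA [OF that] by (simp add: A_def)
      ultimately obtain q where q: "sublinear q" "\<And>p. p \<in> C \<Longrightarrow> q \<le> p"
        using sublinear_Inf_chain [OF False] by metis
      obtain p where "p \<in> C" using False by auto
      then have "q \<le> p0" using q(2) [of p] CA [of p] by (auto simp: A_def intro: order.trans)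
      then show ?thesis using q by (auto simp: A_def)
    qed
  qed
  then obtain m where m: "m \<in> A" and min: "\<And>a. a \<in> A \<Longrightarrow> a \<le> m \<Longrightarrow> a = m" by blast
  have sub: "sublinear m" and mle: "m \<le> p0" using m by (auto simp: A_def)
  have add: "m (x + y) = m x + m y" for x y
  proof (rule antisym)
    obtain q where q: "sublinear q" "q \<le> m" "\<And>x. q x \<le> m (x + y) - m y"
      using sublinear_shift [OF sub] by metis
    have "q = m" using q mle by (intro min) (auto simp: A_def)
    then show "m x + m y \<le> m (x + y)" using q(3) [of x] by simp
  qed (rule sublinear_add [OF sub])
  have neg: "m (- x) = - m x" for x using add [of x "- x"] sublinear_zero [OF sub] by simp
  have scale: "m (c *\<^sub>R x) = c * m x" for c x
  proof -
    consider "c > 0" | "c = 0" | "- c > 0" by linarith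
    then show ?thesis
    proof cases
      case 3
      then show ?thesis using sublinear_scaleR [OF sub 3, of x] by (simp add: neg)
    qed (use sublinear_scaleR [OF sub] sublinear_zero [OF sub] in auto)
  qed
  have "linear m" by (rule linearI) (simp_all add: add scale)
  then show ?thesis using that mle by (auto simp: le_fun_def)
qed

text \<open>The norm is first shifted in the direction \<open>x\<close>; every linear function below the result has
\<open>\<phi> (- x) \<le> - norm x\<close>.\<close>

theorem bounded_functional_nonzero:
  fixes x :: "'a::real_normed_vector"
  assumes "x \<noteq> 0"
  obtains \<phi> :: "'a \<Rightarrow> real" where "bounded_linear \<phi>" "\<phi> x \<noteq> 0"
proof -
  have "sublinear (norm :: 'a \<Rightarrow> real)" by (simp add: sublinear_def norm_triangle_ineq)
  then obtain q where q: "sublinear q" "q \<le> norm" "\<And>z. q z \<le> norm (z + x) - norm x"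
    using sublinear_shift [where y = x] by blast
  obtain \<phi> where \<phi>: "linear \<phi>" "\<And>z. \<phi> z \<le> q z" using linear_below_sublinear [OF q(1)] by blast
  have le: "\<phi> z \<le> norm z" for z using \<phi>(2) [of z] q(2) by (auto simp: le_fun_def intro: order.trans)
  have "norm (\<phi> z) \<le> norm z * 1" for z
    using le [of z] le [of "- z"] by (simp add: linear_neg [OF \<phi>(1)] abs_le_iff)
  then have "bounded_linear \<phi>"
    using \<phi>(1) by (intro bounded_linear_intro [where K = 1]) (simp_all add: linear_add linear_scale)
  moreover have "\<phi> (- x) \<le> - norm x" using \<phi>(2) [of "- x"] q(3) [of "- x"] by simp
  then have "\<phi> x \<noteq> 0" using assms by (auto simp: linear_neg [OF \<phi>(1)])
  ultimately show ?thesis by (rule that)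
qed


section \<open>Cauchy's theorem for families of closed curves\<close>

text \<open>Each curve is reached from the base point along a path in \<open>C\<close> and left along the same path, so the
connecting pieces cancel in every integral.\<close>

lemma joined_loops:
  fixes g :: "'i \<Rightarrow> real \<Rightarrow> complex"
  assumes C: "open C" "connected C" and b: "b \<in> C" and "finite A"
    and g: "\<And>i. i \<in> A \<Longrightarrow> valid_path (g i) \<and> pathfinish (g i) = pathstart (g i) \<and> path_image (g i) \<subseteq> C"
  shows "\<exists>h. valid_path h \<and> pathstart h = b \<and> pathfinish h = b \<and> path_image h \<subseteq> C \<and>
    (\<forall>f. f holomorphic_on C \<longrightarrow> contour_integral h f = (\<Sum>i\<in>A. contour_integral (g i) f))"
  using \<open>finite A\<close> g
proof (induction A rule: finite_induct)
  case empty
  have "valid_path (linepath b b)" "pathstart (linepath b b) = b" "pathfinish (linepath b b) = b"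
      "path_image (linepath b b) \<subseteq> C"
    using b by (auto simp only: valid_path_linepath pathstart_linepath pathfinish_linepath
        path_image_linepath closed_segment_idem)
  moreover have "contour_integral (linepath b b) f = (\<Sum>i\<in>{}. contour_integral (g i) f)" for f
    by (simp only: contour_integral_trivial sum.empty)
  ultimately show ?case by blast
next
  case (insert i A)
  obtain h where h: "valid_path h" "pathstart h = b" "pathfinish h = b" "path_image h \<subseteq> C"
    and int_h: "\<And>f. f holomorphic_on C \<Longrightarrow> contour_integral h f = (\<Sum>i\<in>A. contour_integral (g i) f)"
    using insert.IH insert.prems by blast
  have gi: "valid_path (g i)" "pathfinish (g i) = pathstart (g i)" "path_image (g i) \<subseteq> C"
    using insert.prems by auto
  then have "pathstart (g i) \<in> C" by auto
  then obtain p where p: "polynomial_function p" "path_image p \<subseteq> C" "pathstart p = b"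
      "pathfinish p = pathstart (g i)"
    using connected_open_polynomial_connected [OF C b] by metis
  have vp: "valid_path p" using p(1) by (rule valid_path_polynomial_function)
  define k where "k = h +++ (p +++ (g i +++ reversepath p))"
  have "contour_integral k f = (\<Sum>i\<in>insert i A. contour_integral (g i) f)" if f: "f holomorphic_on C" for f
  proof -
    have int: "f contour_integrable_on q" if "valid_path q" "path_image q \<subseteq> C" for q
      using f C(1) that by (rule contour_integrable_holomorphic_simple)
    have "contour_integral k f = contour_integral h f + contour_integral (g i) f"
      unfolding k_def using h gi p vp
      by (simp add: int contour_integrable_join contour_integrable_reversepath contour_integral_reversepath)
    then show ?thesis using insert.hyps by (simp add: int_h [OF f])
  qed
  moreover have "valid_path k" "pathstart k = b" "pathfinish k = b" "path_image k \<subseteq> C"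
    unfolding k_def using h gi p vp by (auto simp: path_image_join)
  ultimately show ?case by blast
qed

text \<open>The curves that lie in one component \<open>C\<close> already satisfy the hypothesis of Cauchy's theorem.  Count
the windings of these curves outside \<open>C\<close>, and minus the windings of the other curves inside \<open>C\<close>.
The two counts agree outside \<open>\<Omega>\<close>, so together they form a continuous integer-valued function on
the plane, which vanishes near infinity.\<close>

lemma winding_number_component:
  fixes g :: "'i \<Rightarrow> real \<Rightarrow> complex"
  assumes \<Omega>: "open \<Omega>" and C: "C \<in> components \<Omega>" and "finite A"
    and g: "\<And>i. i \<in> A \<Longrightarrow> path (g i) \<and> pathfinish (g i) = pathstart (g i) \<and> path_image (g i) \<subseteq> \<Omega>"
    and zero: "\<And>z. z \<notin> \<Omega> \<Longrightarrow> (\<Sum>i\<in>A. winding_number (g i) z) = 0"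
    and z: "z \<notin> C"
  shows "(\<Sum>i\<in>{i\<in>A. path_image (g i) \<subseteq> C}. winding_number (g i) z) = 0"
proof -
  define B where "B = {i\<in>A. path_image (g i) \<subseteq> C}"
  define h where "h z = (if z \<notin> C then \<Sum>i\<in>B. winding_number (g i) z
    else - (\<Sum>i\<in>A - B. winding_number (g i) z))" for z
  have disj: "path_image (g i) \<inter> C = {}" if "i \<in> A - B" for i
  proof (rule ccontr)
    assume "path_image (g i) \<inter> C \<noteq> {}"
    then have "path_image (g i) \<subseteq> C"
      using components_maximal [OF C, of "path_image (g i)"] g [of i] that
      by (auto simp: connected_path_image)
    then show False using that by (auto simp: B_def)
  qed
  have "open C" using \<Omega> C by (rule open_components)
  have "\<Omega> - C = \<Union> (components \<Omega> - {C})"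
  proof (intro equalityI subsetI)
    fix x assume "x \<in> \<Union> (components \<Omega> - {C})"
    then obtain C' where "C' \<in> components \<Omega>" "C' \<noteq> C" "x \<in> C'" by blast
    then show "x \<in> \<Omega> - C"
      using components_nonoverlap [OF C, of C'] in_components_subset [of C' \<Omega>] by blast
  next
    fix x assume x: "x \<in> \<Omega> - C"
    then obtain C' where "C' \<in> components \<Omega>" "x \<in> C'"
      using Union_components [of \<Omega>] by blast
    then show "x \<in> \<Union> (components \<Omega> - {C})" using x by blast
  qed
  then have "open (\<Omega> - C)" using open_components [OF \<Omega>] by auto
  moreover have "- (\<Omega> - C) = C \<union> - \<Omega>"
    using in_components_subset [OF C] by auto
  ultimately have cl: "closed (- C)" "closed (C \<union> - \<Omega>)"
    using \<open>open C\<close> by (metis closed_Compl, metis closed_Compl)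
  have "continuous_on (- C \<union> (C \<union> - \<Omega>)) h"
    unfolding h_def
  proof (rule continuous_on_cases [OF cl])
    show "continuous_on (- C) (\<lambda>z. \<Sum>i\<in>B. winding_number (g i) z)"
      using g by (intro continuous_on_sum continuous_on_subset [OF continuous_on_winding_number])
        (auto simp: B_def)
    show "continuous_on (C \<union> - \<Omega>) (\<lambda>z. - (\<Sum>i\<in>A - B. winding_number (g i) z))"
      using g disj
      by (intro continuous_on_minus continuous_on_sum continuous_on_subset [OF continuous_on_winding_number]) blast+
    show "\<forall>z. z \<in> - C \<and> \<not> z \<notin> C \<or> z \<in> C \<union> - \<Omega> \<and> z \<notin> C \<longrightarrow>
      (\<Sum>i\<in>B. winding_number (g i) z) = - (\<Sum>i\<in>A - B. winding_number (g i) z)"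
    proof (intro allI impI)
      fix z assume "z \<in> - C \<and> \<not> z \<notin> C \<or> z \<in> C \<union> - \<Omega> \<and> z \<notin> C"
      then have "(\<Sum>i\<in>A. winding_number (g i) z) = 0" using zero by blast
      moreover have "B \<subseteq> A" by (auto simp: B_def)
      ultimately show "(\<Sum>i\<in>B. winding_number (g i) z) = - (\<Sum>i\<in>A - B. winding_number (g i) z)"
        using sum.subset_diff [OF \<open>B \<subseteq> A\<close> \<open>finite A\<close>, of "\<lambda>i. winding_number (g i) z"]
        by (simp add: eq_neg_iff_add_eq_0 add.commute)
    qed
  qed
  then have cont: "continuous_on UNIV h" by (simp add: Un_assoc [symmetric])
  have int: "h z \<in> \<int>" for z
  proof (cases "z \<in> C")
    case True
    then show ?thesis using disj g
      by (auto simp: h_def intro!: Ints_sum Ints_minus integer_winding_number)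
  next
    case False
    then show ?thesis using g
      by (auto simp: h_def B_def intro!: Ints_sum integer_winding_number)
  qed
  have "h constant_on UNIV"
  proof (rule continuous_discrete_range_constant [OF connected_UNIV cont])
    fix x :: complex
    have "1 \<le> norm (h y - h x)" if "h y \<noteq> h x" for y
      using int [of x] int [of y] that by (auto simp: Ints_def simp flip: of_int_diff)
    then show "\<exists>e>0. \<forall>y. y \<in> UNIV \<and> h y \<noteq> h x \<longrightarrow> e \<le> norm (h y - h x)"
      by (intro exI [of _ 1]) auto
  qed
  then obtain c where c: "\<And>z. h z = c" by (auto simp: constant_on_def)
  have "\<forall>i\<in>A. eventually (\<lambda>z. winding_number (g i) z = 0) at_infinity"
    using g winding_number_zero_at_infinity unfolding eventually_at_infinity by blast
  then have "eventually (\<lambda>z. \<forall>i\<in>A. winding_number (g i) z = 0) at_infinity"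
    using \<open>finite A\<close> by (simp add: eventually_ball_finite)
  then obtain w where "\<forall>i\<in>A. winding_number (g i) w = 0"
    using eventually_happens [of _ "at_infinity :: complex filter"] trivial_limit_at_infinity by blast
  then have "h w = 0" by (auto simp: h_def B_def)
  then have "h z = 0" using c by simp
  then show ?thesis using z by (simp add: h_def B_def)
qed

text \<open>The curves in one component are joined to a single loop, to which the homology version of
Cauchy's theorem for one curve applies.\<close>

theorem Cauchy_theorem_cycle:
  fixes g :: "'i \<Rightarrow> real \<Rightarrow> complex"
  assumes \<Omega>: "open \<Omega>" and f: "f holomorphic_on \<Omega>" and "finite A"
    and g: "\<And>i. i \<in> A \<Longrightarrow> valid_path (g i) \<and> pathfinish (g i) = pathstart (g i) \<and> path_image (g i) \<subseteq> \<Omega>"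
    and zero: "\<And>z. z \<notin> \<Omega> \<Longrightarrow> (\<Sum>i\<in>A. winding_number (g i) z) = 0"
  shows "(\<Sum>i\<in>A. contour_integral (g i) f) = 0"
proof -
  have comp: "(\<Sum>i\<in>{i\<in>A. path_image (g i) \<subseteq> C}. contour_integral (g i) f) = 0" if C: "C \<in> components \<Omega>" for C
  proof -
    define B where "B = {i\<in>A. path_image (g i) \<subseteq> C}"
    have "open C" using \<Omega> C by (rule open_components)
    obtain b where "b \<in> C" using in_components_nonempty [OF C] by blast
    have "finite B" using \<open>finite A\<close> by (simp add: B_def)
    have gB: "valid_path (g i) \<and> pathfinish (g i) = pathstart (g i) \<and> path_image (g i) \<subseteq> C" if "i \<in> B" for i
      using g that by (auto simp: B_def)
    obtain h where h: "valid_path h" "pathstart h = b" "pathfinish h = b" "path_image h \<subseteq> C"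
      and int_h: "\<And>f. f holomorphic_on C \<Longrightarrow> contour_integral h f = (\<Sum>i\<in>B. contour_integral (g i) f)"
      using joined_loops [OF \<open>open C\<close> in_components_connected [OF C] \<open>b \<in> C\<close> \<open>finite B\<close>, of g] gB
      by blast
    have "winding_number h z = 0" if z: "z \<notin> C" for z
    proof -
      have "(\<lambda>w. 1 / (w - z)) holomorphic_on C" using z by (intro holomorphic_intros) auto
      then have "winding_number h z = 1 / (2 * pi * \<i>) * (\<Sum>i\<in>B. contour_integral (g i) (\<lambda>w. 1 / (w - z)))"
        using h z by (subst winding_number_valid_path) (auto simp: int_h)
      also have "\<dots> = (\<Sum>i\<in>B. winding_number (g i) z)"
        unfolding sum_distrib_left
      proof (intro sum.cong refl)
        fix i assume "i \<in> B"
        then have "valid_path (g i)" "z \<notin> path_image (g i)" using gB z by auto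
        then show "1 / (2 * pi * \<i>) * contour_integral (g i) (\<lambda>w. 1 / (w - z)) = winding_number (g i) z"
          by (simp add: winding_number_valid_path)
      qed
      also have "\<dots> = 0"
        unfolding B_def using g
        by (intro winding_number_component [OF \<Omega> C \<open>finite A\<close> _ zero z]) (auto simp: valid_path_imp_path)
      finally show ?thesis .
    qed
    moreover have hol: "f holomorphic_on C"
      using f in_components_subset [OF C] by (rule holomorphic_on_subset)
    ultimately have "contour_integral h f = 0"
      using h by (intro contour_integral_unique Cauchy_theorem_global [OF \<open>open C\<close>]) auto
    then show ?thesis using int_h [OF hol] by (simp add: B_def)
  qed
  define K where "K i = connected_component_set \<Omega> (pathstart (g i))" for i
  have K: "K i \<in> components \<Omega>" "path_image (g i) \<subseteq> K i" if "i \<in> A" for i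
  proof -
    have "pathstart (g i) \<in> \<Omega>" using g [OF that] by auto
    then show "K i \<in> components \<Omega>" by (auto simp: K_def components_def)
    show "path_image (g i) \<subseteq> K i"
      unfolding K_def using g [OF that]
      by (intro connected_component_maximal) (auto simp: connected_path_image valid_path_imp_path)
  qed
  have K_iff: "path_image (g i) \<subseteq> C \<longleftrightarrow> K i = C" if "i \<in> A" "C \<in> components \<Omega>" for i C
    using K [OF that(1)] that(2) components_nonoverlap [of C \<Omega> "K i"]
      pathstart_in_path_image [of "g i"] by blast
  have "(\<Sum>i\<in>A. contour_integral (g i) f) = (\<Sum>C\<in>K ` A. \<Sum>i\<in>{i\<in>A. K i = C}. contour_integral (g i) f)"
    by (rule sum.image_gen [OF \<open>finite A\<close>])
  also have "\<dots> = (\<Sum>C\<in>K ` A. \<Sum>i\<in>{i\<in>A. path_image (g i) \<subseteq> C}. contour_integral (g i) f)"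
    using K K_iff by (intro sum.cong) auto
  also have "\<dots> = 0"
    using K comp by (intro sum.neutral) auto
  finally show ?thesis .
qed

text \<open>If all singularities are encircled once, the integral only sees the expansion at infinity: the
curves together with a large circle in the opposite direction satisfy the hypothesis of Cauchy's
theorem.\<close>

theorem contour_integral_around_everything:
  fixes g :: "'i \<Rightarrow> real \<Rightarrow> complex"
  assumes \<Omega>: "open \<Omega>" and f: "f holomorphic_on \<Omega>" and "finite A" and bdd: "bounded (- \<Omega>)"
    and g: "\<And>i. i \<in> A \<Longrightarrow> valid_path (g i) \<and> pathfinish (g i) = pathstart (g i) \<and> path_image (g i) \<subseteq> \<Omega>"
    and one: "\<And>z. z \<notin> \<Omega> \<Longrightarrow> (\<Sum>i\<in>A. winding_number (g i) z) = 1"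
    and lim: "((\<lambda>z. z * f z) \<longlongrightarrow> c) at_infinity"
  shows "(\<Sum>i\<in>A. contour_integral (g i) f) = 2 * pi * \<i> * c"
proof -
  define S where "S = (\<Sum>i\<in>A. contour_integral (g i) f)"
  have "norm (S - 2 * pi * \<i> * c) \<le> e" if "e > 0" for e
  proof -
    have "eventually (\<lambda>z. dist (z * f z) c < e / (2 * pi)) at_infinity"
      using lim \<open>e > 0\<close> by (intro tendstoD) auto
    then obtain r1 where r1: "\<And>z. r1 \<le> norm z \<Longrightarrow> dist (z * f z) c < e / (2 * pi)"
      by (auto simp: eventually_at_infinity)
    obtain r2 where "r2 > 0" and r2: "- \<Omega> \<subseteq> ball 0 r2"
      using bounded_subset_ballD [OF bdd] by blast
    define r where "r = max r1 r2"
    have r: "r > 0" "r \<ge> r1" "- \<Omega> \<subseteq> ball 0 r"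
      using \<open>r2 > 0\<close> r2 by (auto simp: r_def subset_eq less_max_iff_disj)
    have sph: "sphere 0 r \<subseteq> \<Omega>" using r by (auto simp: subset_eq)
    \<comment> \<open>\<open>None\<close> is the index of the additional circle.\<close>
    define G where "G = case_option (reversepath (circlepath 0 r)) g"
    have "(\<Sum>i\<in>insert None (Some ` A). contour_integral (G i) f) = 0"
    proof (rule Cauchy_theorem_cycle [OF \<Omega> f])
      show "valid_path (G i) \<and> pathfinish (G i) = pathstart (G i) \<and> path_image (G i) \<subseteq> \<Omega>"
        if "i \<in> insert None (Some ` A)" for i
        using that g sph r by (cases i) (auto simp: G_def dest!: subsetD)
      show "(\<Sum>i\<in>insert None (Some ` A). winding_number (G i) z) = 0" if z: "z \<notin> \<Omega>" for z
      proof -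
        have "z \<in> ball 0 r" using z r by auto
        then have "winding_number (reversepath (circlepath 0 r)) z = - 1"
          using r by (subst winding_number_reversepath) (auto simp: winding_number_circlepath)
        then show ?thesis using one [OF z] \<open>finite A\<close> by (simp add: G_def sum.reindex)
      qed
    qed (use \<open>finite A\<close> in auto)
    then have S: "S = contour_integral (circlepath 0 r) f"
      using \<open>finite A\<close> by (simp add: G_def S_def sum.reindex contour_integral_reversepath)
    have "f contour_integrable_on circlepath 0 r"
      using sph r by (intro contour_integrable_holomorphic_simple [OF f \<Omega>]) auto
    moreover have "((\<lambda>w. 1 / (w - 0)) has_contour_integral 2 * pi * \<i>) (circlepath 0 r)"
      using r contour_integral_circlepath [of r 0] contour_integrable_inversediff [of "circlepath 0 r" 0]
      by (metis has_contour_integral_integral norm_eq_zero order_less_irrefl path_image_circlepath_nonneg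
          sphere_empty valid_path_circlepath mem_sphere_0 less_imp_le of_real_mult of_real_numeral)
    then have "((\<lambda>w. c * (1 / (w - 0))) has_contour_integral c * (2 * pi * \<i>)) (circlepath 0 r)"
      by (rule has_contour_integral_lmul)
    ultimately have "((\<lambda>w. f w - c * (1 / (w - 0))) has_contour_integral S - c * (2 * pi * \<i>)) (circlepath 0 r)"
      unfolding S by (intro has_contour_integral_diff has_contour_integral_integral)
    then have "norm (S - c * (2 * pi * \<i>)) \<le> e / (2 * pi) / r * (2 * pi * r)"
    proof (rule has_contour_integral_bound_circlepath)
      fix z :: complex assume "norm (z - 0) = r"
      then have z: "norm z = r" "z \<noteq> 0" using r by auto
      then have "f z - c * (1 / (z - 0)) = (z * f z - c) / z" by (simp add: field_simps)
      then have "norm (f z - c * (1 / (z - 0))) = dist (z * f z) c / r"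
        using z by (simp add: norm_divide dist_norm)
      also have "\<dots> \<le> e / (2 * pi) / r"
        using r r1 [of z] z by (intro divide_right_mono less_imp_le) auto
      finally show "norm (f z - c * (1 / (z - 0))) \<le> e / (2 * pi) / r" .
    qed (use \<open>e > 0\<close> r in auto)
    then show ?thesis using r by (simp add: mult_ac)
  qed
  then have "norm (S - 2 * pi * \<i> * c) \<le> 0" by (rule field_le_epsilon [where y = 0, simplified])
  then show ?thesis by (simp add: S_def)
qed


section \<open>Piecewise smooth curves\<close>

interpretation blinfun_compose: bounded_bilinear "(o\<^sub>L)"
  by (rule bounded_bilinear_blinfun_compose)

lemmas compose_simps = blinfun_compose.add_left blinfun_compose.add_right blinfun_compose.diff_left
  blinfun_compose.diff_right blinfun_compose.minus_left blinfun_compose.minus_right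
  blinfun_compose.scaleR_left blinfun_compose.scaleR_right
  blinfun_compose.zero_left blinfun_compose.zero_right

lemma compose_assoc: "(A o\<^sub>L B) o\<^sub>L C = A o\<^sub>L (B o\<^sub>L C)"
  by (rule blinfun_eqI) simp

lemma id_compose [simp]: "id_blinfun o\<^sub>L A = A" "A o\<^sub>L id_blinfun = A"
  by (rule blinfun_eqI, simp)+

abbreviation path_velocity :: "(real \<Rightarrow> complex) \<Rightarrow> real \<Rightarrow> complex" where
  "path_velocity \<gamma> t \<equiv> vector_derivative \<gamma> (at t within {0..1})"

lemma piecewise_C1_pathE:
  assumes "piecewise_C1_path \<gamma>"
  obtains P where "path \<gamma>" "finite P" "{0, 1} \<subseteq> P" "P \<subseteq> {0..1}"
    "\<forall>a\<in>P. \<forall>b\<in>P. a < b \<longrightarrow> {a<..<b} \<inter> P = {} \<longrightarrow>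
      (\<exists>D. continuous_on {a..b} D \<and> (\<forall>t\<in>{a..b}. (\<gamma> has_vector_derivative D t) (at t within {a..b})))"
proof -
  have "path \<gamma>" using assms by (simp add: piecewise_C1_path_def)
  obtain P where P: "finite P \<and> {0, 1} \<subseteq> P \<and> P \<subseteq> {0..1} \<and>
      (\<forall>a\<in>P. \<forall>b\<in>P. a < b \<longrightarrow> {a<..<b} \<inter> P = {} \<longrightarrow>
        (\<exists>D. continuous_on {a..b} D \<and>
           (\<forall>t\<in>{a..b}. (\<gamma> has_vector_derivative D t) (at t within {a..b}))))"
    using assms unfolding piecewise_C1_path_def by (elim conjE exE) (rule that, intro conjI)
  show ?thesis
    by (rule that [of P, OF \<open>path \<gamma>\<close>]) (use P in blast)+
qed

lemma piecewise_C1_path_imp_valid_path: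
  assumes "piecewise_C1_path \<gamma>"
  shows "valid_path \<gamma>"
proof -
  obtain P where "path \<gamma>" and P: "finite P" "{0, 1} \<subseteq> P" "P \<subseteq> {0..1}"
    and D: "\<forall>a\<in>P. \<forall>b\<in>P. a < b \<longrightarrow> {a<..<b} \<inter> P = {} \<longrightarrow>
      (\<exists>D. continuous_on {a..b} D \<and> (\<forall>t\<in>{a..b}. (\<gamma> has_vector_derivative D t) (at t within {a..b})))"
    using piecewise_C1_pathE [OF assms] .
  note D = D [rule_format]
  have "\<gamma> differentiable at t \<and> isCont (\<lambda>t. vector_derivative \<gamma> (at t)) t" if t: "t \<in> {0..1} - P" for t
  proof -
    define a where "a = Max {p\<in>P. p < t}"
    define b where "b = Min {p\<in>P. t < p}"
    have "0 < t" "t < 1" using t P by (auto simp: less_le)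
    have "a \<in> {p\<in>P. p < t}" unfolding a_def by (rule Max_in) (use P \<open>0 < t\<close> in auto)
    moreover have "b \<in> {p\<in>P. t < p}" unfolding b_def by (rule Min_in) (use P \<open>t < 1\<close> in auto)
    moreover have "p \<le> a" if "p \<in> P" "p < t" for p
      unfolding a_def using P that by (intro Max_ge) auto
    moreover have "b \<le> p" if "p \<in> P" "t < p" for p
      unfolding b_def using P that by (intro Min_le) auto
    ultimately have ab: "a \<in> P" "b \<in> P" "a < t" "t < b" "{a<..<b} \<inter> P = {}"
      using t by (auto simp: not_le) (metis linorder_neqE_linordered_idom not_le)
    then obtain D where D: "continuous_on {a..b} D"
      "\<And>t. t \<in> {a..b} \<Longrightarrow> (\<gamma> has_vector_derivative D t) (at t within {a..b})"
      using D [OF ab(1,2) _ ab(5)] ab(3,4) by auto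
    have deriv: "(\<gamma> has_vector_derivative D s) (at s)" if "s \<in> {a<..<b}" for s
      using D(2) [of s] that by (simp add: at_within_Icc_at)
    then have "\<gamma> differentiable at t"
      using ab by (auto simp: has_vector_derivative_def differentiable_def)
    moreover have "isCont D t"
      using D(1) ab by (intro continuous_on_interior [OF D(1)]) (auto simp: interior_atLeastAtMost_real)
    then have "isCont (\<lambda>t. vector_derivative \<gamma> (at t)) t"
    proof (rule iffD1 [OF isCont_cong, rotated])
      show "\<forall>\<^sub>F s in nhds t. D s = vector_derivative \<gamma> (at s)"
        using eventually_nhds_in_open [of "{a<..<b}" t] ab
        by (auto elim!: eventually_mono simp: vector_derivative_at [OF deriv])
    qed
    ultimately show ?thesis by simp
  qed
  then have "\<gamma> C1_differentiable_on ({0..1} - P)"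
    unfolding C1_differentiable_on_eq by (auto intro: continuous_at_imp_continuous_on)
  then show ?thesis
    using P \<open>path \<gamma>\<close> unfolding valid_path_def piecewise_C1_differentiable_on_def path_def by blast
qed

lemma piecewise_C1_path_cnj:
  assumes "piecewise_C1_path \<gamma>"
  shows "piecewise_C1_path (cnj \<circ> \<gamma>)"
proof -
  obtain P where path: "path \<gamma>" and P: "finite P" "{0, 1} \<subseteq> P" "P \<subseteq> {0..1}"
    and D: "\<forall>a\<in>P. \<forall>b\<in>P. a < b \<longrightarrow> {a<..<b} \<inter> P = {} \<longrightarrow>
      (\<exists>D. continuous_on {a..b} D \<and> (\<forall>t\<in>{a..b}. (\<gamma> has_vector_derivative D t) (at t within {a..b})))"
    using piecewise_C1_pathE [OF assms] .
  note D = D [rule_format]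
  have ex: "\<exists>D. continuous_on {a..b} D \<and>
      (\<forall>t\<in>{a..b}. (cnj \<circ> \<gamma> has_vector_derivative D t) (at t within {a..b}))"
    if ab: "a \<in> P" "b \<in> P" "a < b" "{a<..<b} \<inter> P = {}" for a b
  proof -
    obtain D where D: "continuous_on {a..b} D"
      "\<And>t. t \<in> {a..b} \<Longrightarrow> (\<gamma> has_vector_derivative D t) (at t within {a..b})"
      using D [OF ab] by auto
    then show ?thesis
      by (intro exI [of _ "\<lambda>t. cnj (D t)"])
        (auto intro!: continuous_intros has_vector_derivative_cnj simp: o_def)
  qed
  have "path (cnj \<circ> \<gamma>)" using path by (auto simp: path_def o_def intro!: continuous_intros)
  then show ?thesis
    unfolding piecewise_C1_path_def using P
    by (intro conjI exI [of _ P] ballI impI ex)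
qed

text \<open>At the break points the vector derivative is an unspecified value, which conjugation need not
respect.\<close>

lemma path_velocity_cnj:
  assumes "piecewise_C1_path \<gamma>"
  obtains S where "finite S" "\<forall>t\<in>{0..1} - S. path_velocity (cnj \<circ> \<gamma>) t = cnj (path_velocity \<gamma> t)"
proof -
  obtain S where S: "finite S" "\<gamma> C1_differentiable_on ({0..1} - S)"
    using piecewise_C1_path_imp_valid_path [OF assms]
    by (auto simp: valid_path_def piecewise_C1_differentiable_on_def)
  have "path_velocity (cnj \<circ> \<gamma>) t = cnj (path_velocity \<gamma> t)" if t: "t \<in> {0..1} - S" for t
  proof -
    obtain D where D: "(\<gamma> has_vector_derivative D) (at t)"
      using S(2) t unfolding C1_differentiable_on_def by blast
    have "(cnj \<circ> \<gamma> has_vector_derivative cnj D) (at t)"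
      using has_vector_derivative_cnj [OF D] by (simp add: o_def)
    then show ?thesis
      using D t by (simp add: vector_derivative_at_within_ivl)
  qed
  then show ?thesis using that S(1) by blast
qed


section \<open>Contour integrals of operator-valued functions\<close>

text \<open>A complex structure on a real Banach space.  The algebra of operators becomes a complex vector
space by composition with \<open>M z\<close> on the left.\<close>

locale complex_structure =
  fixes J :: "'a::banach \<Rightarrow>\<^sub>L 'a"
  assumes J_square: "J o\<^sub>L J = - id_blinfun"
begin

definition M :: "complex \<Rightarrow> 'a \<Rightarrow>\<^sub>L 'a" where
  "M z = Re z *\<^sub>R id_blinfun + Im z *\<^sub>R J"

lemma J_J: "J o\<^sub>L (J o\<^sub>L A) = - A"
  by (simp add: J_square blinfun_compose.minus_left flip: compose_assoc)

lemma M_add: "M (z + w) = M z + M w" and M_diff: "M (z - w) = M z - M w"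
  and M_minus: "M (- z) = - M z" and M_0 [simp]: "M 0 = 0" and M_1 [simp]: "M 1 = id_blinfun"
  and M_scaleR: "M (r *\<^sub>R z) = r *\<^sub>R M z" and M_ii: "M \<i> = J"
  and M_of_real: "M (of_real r) = r *\<^sub>R id_blinfun"
  by (simp_all add: M_def algebra_simps)

lemma M_mult: "M (z * w) = M z o\<^sub>L M w"
  by (simp add: M_def compose_simps J_square algebra_simps)

lemma M_commute: "M z o\<^sub>L M w = M w o\<^sub>L M z"
  by (metis M_mult mult.commute)

lemma M_commute_left: "M z o\<^sub>L (M w o\<^sub>L A) = M w o\<^sub>L (M z o\<^sub>L A)"
  by (metis M_commute compose_assoc)

lemma commutes_M: "A o\<^sub>L J = J o\<^sub>L A \<Longrightarrow> A o\<^sub>L M z = M z o\<^sub>L A"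
  by (simp add: M_def compose_simps)

lemma M_J: "M z o\<^sub>L J = J o\<^sub>L M z"
  by (rule commutes_M [OF refl, symmetric])

lemma M_J_left: "M z o\<^sub>L (J o\<^sub>L A) = J o\<^sub>L (M z o\<^sub>L A)"
  using M_J [of z] by (simp flip: compose_assoc)

lemma norm_M: "norm (M z) \<le> (1 + norm J) * norm z"
proof -
  have "norm (M z) \<le> \<bar>Re z\<bar> * norm (id_blinfun :: 'a \<Rightarrow>\<^sub>L 'a) + \<bar>Im z\<bar> * norm J"
    unfolding M_def by (rule order.trans [OF norm_triangle_ineq]) simp
  also have "\<dots> \<le> norm z * 1 + norm z * norm J"
    by (intro add_mono mult_mono norm_blinfun_id_le abs_Re_le_cmod abs_Im_le_cmod) auto
  finally show ?thesis by (simp add: algebra_simps)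
qed

lemma bounded_linear_M: "bounded_linear M"
  by (rule bounded_linear_intro [where K = "1 + norm J"])
    (use norm_M in \<open>auto simp: M_add M_scaleR mult.commute\<close>)

lemmas continuous_on_M [continuous_intros] = bounded_linear.continuous_on [OF bounded_linear_M]

lemmas continuous_on_compose_blinfun [continuous_intros] =
  bounded_bilinear.continuous_on [OF bounded_bilinear_blinfun_compose]

text \<open>The complex-linear functional with real part \<open>\<phi>\<close> is \<open>Y \<mapsto> \<phi> Y - \<i> \<phi> (J Y)\<close>.\<close>

lemma complex_functional_nonzero:
  fixes X :: "'a \<Rightarrow>\<^sub>L 'a"
  assumes "X \<noteq> 0"
  obtains \<psi> :: "('a \<Rightarrow>\<^sub>L 'a) \<Rightarrow> complex"
  where "bounded_linear \<psi>" "\<And>z Y. \<psi> (M z o\<^sub>L Y) = z * \<psi> Y" "\<psi> X \<noteq> 0"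
proof -
  obtain \<phi> :: "('a \<Rightarrow>\<^sub>L 'a) \<Rightarrow> real" where \<phi>: "bounded_linear \<phi>" "\<phi> X \<noteq> 0"
    using bounded_functional_nonzero [OF assms] by blast
  define \<psi> where "\<psi> Y = of_real (\<phi> Y) - \<i> * of_real (\<phi> (J o\<^sub>L Y))" for Y
  have "bounded_linear \<psi>"
    unfolding \<psi>_def
    by (intro bounded_linear_sub bounded_linear_const_mult bounded_linear_compose [OF bounded_linear_of_real]
        \<phi> bounded_linear_compose [OF \<phi>(1)] bounded_linear_compose [OF \<phi>(1) blinfun_compose.bounded_linear_right])
  moreover have "\<psi> (M z o\<^sub>L Y) = z * \<psi> Y" for z Y
  proof -
    interpret \<phi>: bounded_linear \<phi> by fact
    have "\<psi> (M z o\<^sub>L Y) = Re z * \<psi> Y + Im z * (\<i> * \<psi> Y)"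
      by (simp add: \<psi>_def M_def compose_simps J_J \<phi>.add \<phi>.diff \<phi>.scaleR \<phi>.neg algebra_simps)
    also have "\<dots> = z * \<psi> Y"
      by (subst (3) complex_eq [of z]) (simp add: algebra_simps)
    finally show ?thesis .
  qed
  moreover have "\<psi> X \<noteq> 0" using \<phi>(2) by (auto simp: \<psi>_def complex_eq_iff)
  ultimately show ?thesis by (rule that)
qed

definition contour :: "(real \<Rightarrow> complex) \<Rightarrow> (complex \<Rightarrow> 'a \<Rightarrow>\<^sub>L 'a) \<Rightarrow> 'a \<Rightarrow>\<^sub>L 'a" where
  "contour \<gamma> F = integral {0..1} (\<lambda>t. M (path_velocity \<gamma> t) o\<^sub>L F (\<gamma> t))"

text \<open>\<open>Q\<close> lists the smooth pieces \<open>{a..b}\<close> of a curve with velocity \<open>w\<close>, together with the continuous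
extension \<open>D\<close> of the velocity to the closed piece.  Integrals over a curve thereby become finite
sums of integrals of continuous functions.\<close>

definition pieces :: "(real \<Rightarrow> complex) \<Rightarrow> (real \<times> real \<times> (real \<Rightarrow> complex)) set \<Rightarrow> bool" where
  "pieces w Q \<longleftrightarrow> finite Q \<and>
    (\<forall>(a, b, D)\<in>Q. 0 \<le> a \<and> a < b \<and> b \<le> 1 \<and> continuous_on {a..b} D) \<and>
    (\<forall>F :: real \<Rightarrow> 'a \<Rightarrow>\<^sub>L 'a. continuous_on {0..1} F \<longrightarrow> ((\<lambda>t. M (w t) o\<^sub>L F t) has_integral
       (\<Sum>(a, b, D)\<in>Q. integral {a..b} (\<lambda>t. M (D t) o\<^sub>L F t))) {0..1})"

lemma piecesD:
  fixes F :: "real \<Rightarrow> 'a \<Rightarrow>\<^sub>L 'a"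
  assumes "pieces w Q"
  shows "finite Q"
    and "(a, b, D) \<in> Q \<Longrightarrow> 0 \<le> a \<and> a < b \<and> b \<le> 1 \<and> continuous_on {a..b} D"
    and "continuous_on {0..1} F \<Longrightarrow> ((\<lambda>t. M (w t) o\<^sub>L F t) has_integral
       (\<Sum>(a, b, D)\<in>Q. integral {a..b} (\<lambda>t. M (D t) o\<^sub>L F t))) {0..1}"
proof -
  note Q = assms [unfolded pieces_def]
  show "finite Q" using Q by (rule conjunct1)
  show "0 \<le> a \<and> a < b \<and> b \<le> 1 \<and> continuous_on {a..b} D" if "(a, b, D) \<in> Q"
    using bspec [OF Q [THEN conjunct2, THEN conjunct1] that] by simp
  show "((\<lambda>t. M (w t) o\<^sub>L F t) has_integral
       (\<Sum>(a, b, D)\<in>Q. integral {a..b} (\<lambda>t. M (D t) o\<^sub>L F t))) {0..1}" if "continuous_on {0..1} F"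
    by (rule Q [THEN conjunct2, THEN conjunct2, rule_format, OF that])
qed

text \<open>Induction on the number of break points between two given ones.\<close>

lemma piecewise_C1_path_pieces:
  assumes "piecewise_C1_path \<gamma>"
  obtains Q where "pieces (path_velocity \<gamma>) Q"
proof -
  obtain P where "path \<gamma>" and P: "finite P" "{0, 1} \<subseteq> P" "P \<subseteq> {0..1}"
    and D: "\<forall>a\<in>P. \<forall>b\<in>P. a < b \<longrightarrow> {a<..<b} \<inter> P = {} \<longrightarrow>
      (\<exists>D. continuous_on {a..b} D \<and> (\<forall>t\<in>{a..b}. (\<gamma> has_vector_derivative D t) (at t within {a..b})))"
    using piecewise_C1_pathE [OF assms] .
  note D = D [rule_format]
  define good where "good Q c d \<longleftrightarrow> finite Q \<and>
    (\<forall>(a, b, D)\<in>Q. c \<le> a \<and> a < b \<and> b \<le> d \<and> continuous_on {a..b} D) \<and>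
    (\<forall>F :: real \<Rightarrow> 'a \<Rightarrow>\<^sub>L 'a. continuous_on {c..d} F \<longrightarrow> ((\<lambda>t. M (path_velocity \<gamma> t) o\<^sub>L F t) has_integral
       (\<Sum>(a, b, D)\<in>Q. integral {a..b} (\<lambda>t. M (D t) o\<^sub>L F t))) {c..d})"
    for Q :: "(real \<times> real \<times> (real \<Rightarrow> complex)) set" and c d
  have "\<exists>Q. good Q c d" if "c \<in> P" "d \<in> P" "c < d" for c d
    using that
  proof (induction "card (P \<inter> {c<..<d})" arbitrary: c d rule: less_induct)
    case less
    show ?case
    proof (cases "{c<..<d} \<inter> P = {}")
      case True
      obtain D where D: "continuous_on {c..d} D"
        "\<And>t. t \<in> {c..d} \<Longrightarrow> (\<gamma> has_vector_derivative D t) (at t within {c..d})"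
        using D [OF less.prems True] by auto
      have vel: "path_velocity \<gamma> t = D t" if t: "t \<in> {c<..<d}" for t
      proof (rule vector_derivative_at_within_ivl)
        show "(\<gamma> has_vector_derivative D t) (at t)"
          using D(2) [of t] t by (simp add: at_within_Icc_at)
      qed (use t less.prems P in \<open>auto simp: subset_eq intro: order.trans less_imp_le\<close>)
      have "good {(c, d, D)} c d"
        unfolding good_def
      proof (intro conjI allI impI)
        fix F :: "real \<Rightarrow> 'a \<Rightarrow>\<^sub>L 'a" assume F: "continuous_on {c..d} F"
        have "((\<lambda>t. M (D t) o\<^sub>L F t) has_integral integral {c..d} (\<lambda>t. M (D t) o\<^sub>L F t)) {c..d}"
          by (intro integrable_integral integrable_continuous_interval continuous_intros D F)
        then have "((\<lambda>t. M (path_velocity \<gamma> t) o\<^sub>L F t) has_integral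
            integral {c..d} (\<lambda>t. M (D t) o\<^sub>L F t)) {c..d}"
          by (rule has_integral_spike_finite [of "{c, d}", rotated 2]) (auto simp: vel)
        then show "((\<lambda>t. M (path_velocity \<gamma> t) o\<^sub>L F t) has_integral
            (\<Sum>(a, b, D)\<in>{(c, d, D)}. integral {a..b} (\<lambda>t. M (D t) o\<^sub>L F t))) {c..d}" by simp
      qed (use less.prems D in auto)
      then show ?thesis by blast
    next
      case False
      then obtain m where m: "m \<in> P" "c < m" "m < d" by auto
      have "card (P \<inter> {c<..<m}) < card (P \<inter> {c<..<d})" "card (P \<inter> {m<..<d}) < card (P \<inter> {c<..<d})"
        using P m by (auto intro!: psubset_card_mono)
      then obtain Q1 Q2 where Q: "good Q1 c m" "good Q2 m d"
        using less.hyps less.prems m by metis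
      have disj: "Q1 \<inter> Q2 = {}" using Q by (fastforce simp: good_def)
      have "good (Q1 \<union> Q2) c d"
        unfolding good_def
      proof (intro conjI allI impI)
        show "finite (Q1 \<union> Q2)" using Q by (simp add: good_def)
        show "\<forall>(a, b, D)\<in>Q1 \<union> Q2. c \<le> a \<and> a < b \<and> b \<le> d \<and> continuous_on {a..b} D"
          using Q m by (fastforce simp: good_def)
        fix F :: "real \<Rightarrow> 'a \<Rightarrow>\<^sub>L 'a" assume F: "continuous_on {c..d} F"
        have "continuous_on {c..m} F" "continuous_on {m..d} F"
          using F m by (auto intro: continuous_on_subset)
        then have "((\<lambda>t. M (path_velocity \<gamma> t) o\<^sub>L F t) has_integral
            (\<Sum>(a, b, D)\<in>Q1. integral {a..b} (\<lambda>t. M (D t) o\<^sub>L F t)) +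
            (\<Sum>(a, b, D)\<in>Q2. integral {a..b} (\<lambda>t. M (D t) o\<^sub>L F t))) {c..d}"
          using Q m by (intro has_integral_combine [of c m d]) (auto simp: good_def)
        then show "((\<lambda>t. M (path_velocity \<gamma> t) o\<^sub>L F t) has_integral
            (\<Sum>(a, b, D)\<in>Q1 \<union> Q2. integral {a..b} (\<lambda>t. M (D t) o\<^sub>L F t))) {c..d}"
          using Q disj by (subst sum.union_disjoint) (auto simp: good_def)
      qed
      then show ?thesis by blast
    qed
  qed
  then have "\<exists>Q. good Q 0 1" using P by auto
  then show ?thesis using that by (auto simp: good_def pieces_def)
qed

lemma continuous_on_along_path:
  assumes "piecewise_C1_path \<gamma>" "continuous_on (path_image \<gamma>) F"
  shows "continuous_on {0..1} (\<lambda>t. F (\<gamma> t))"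
  using assms unfolding piecewise_C1_path_def path_def path_image_def
  by (auto intro: continuous_on_compose2)

lemma has_integral_contour:
  assumes "piecewise_C1_path \<gamma>" "continuous_on (path_image \<gamma>) F"
  shows "((\<lambda>t. M (path_velocity \<gamma> t) o\<^sub>L F (\<gamma> t)) has_integral contour \<gamma> F) {0..1}"
proof -
  obtain Q where "pieces (path_velocity \<gamma>) Q" using piecewise_C1_path_pieces [OF assms(1)] .
  then show ?thesis
    using continuous_on_along_path [OF assms]
    unfolding contour_def by (auto intro!: integrable_integral dest: piecesD(3))
qed

lemma contour_add:
  assumes "piecewise_C1_path \<gamma>" "continuous_on (path_image \<gamma>) F" "continuous_on (path_image \<gamma>) G"
  shows "contour \<gamma> (\<lambda>z. F z + G z) = contour \<gamma> F + contour \<gamma> G"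
  using has_integral_add [OF has_integral_contour [OF assms(1,2)] has_integral_contour [OF assms(1,3)]]
  unfolding contour_def [of \<gamma> "\<lambda>z. F z + G z"] by (simp add: integral_unique compose_simps)

lemma contour_diff:
  assumes "piecewise_C1_path \<gamma>" "continuous_on (path_image \<gamma>) F" "continuous_on (path_image \<gamma>) G"
  shows "contour \<gamma> (\<lambda>z. F z - G z) = contour \<gamma> F - contour \<gamma> G"
  using has_integral_diff [OF has_integral_contour [OF assms(1,2)] has_integral_contour [OF assms(1,3)]]
  unfolding contour_def [of \<gamma> "\<lambda>z. F z - G z"] by (simp add: integral_unique compose_simps)

lemma contour_compose_left:
  assumes "piecewise_C1_path \<gamma>" "continuous_on (path_image \<gamma>) F" and A: "A o\<^sub>L J = J o\<^sub>L A"
  shows "contour \<gamma> (\<lambda>z. A o\<^sub>L F z) = A o\<^sub>L contour \<gamma> F"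
proof -
  have comm: "M w o\<^sub>L (A o\<^sub>L X) = A o\<^sub>L (M w o\<^sub>L X)" for w X
    using commutes_M [OF A, of w] by (simp flip: compose_assoc)
  then show ?thesis
    using has_integral_linear [OF has_integral_contour [OF assms(1,2)] blinfun_compose.bounded_linear_right [of A]]
    unfolding contour_def [of \<gamma> "\<lambda>z. A o\<^sub>L F z"] by (simp add: comm integral_unique o_def)
qed

lemma contour_compose_right:
  assumes "piecewise_C1_path \<gamma>" "continuous_on (path_image \<gamma>) F"
  shows "contour \<gamma> (\<lambda>z. F z o\<^sub>L A) = contour \<gamma> F o\<^sub>L A"
  using has_integral_linear [OF has_integral_contour [OF assms(1,2)] blinfun_compose.bounded_linear_left [of A]]
  unfolding contour_def [of \<gamma> "\<lambda>z. F z o\<^sub>L A"] by (simp add: integral_unique o_def compose_assoc)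

lemma contour_sum:
  assumes "finite A" "piecewise_C1_path \<gamma>" "\<And>i. i \<in> A \<Longrightarrow> continuous_on (path_image \<gamma>) (F i)"
  shows "contour \<gamma> (\<lambda>z. \<Sum>i\<in>A. F i z) = (\<Sum>i\<in>A. contour \<gamma> (F i))"
proof -
  have "((\<lambda>t. \<Sum>i\<in>A. M (path_velocity \<gamma> t) o\<^sub>L F i (\<gamma> t)) has_integral (\<Sum>i\<in>A. contour \<gamma> (F i))) {0..1}"
    using assms by (intro has_integral_sum has_integral_contour)
  then show ?thesis
    unfolding contour_def [of \<gamma> "\<lambda>z. \<Sum>i\<in>A. F i z"] blinfun_compose.sum_right by (rule integral_unique)
qed

text \<open>Needed to integrate the inner integral of an iterated contour integral once more.\<close>

lemma continuous_on_contour_parameter: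
  assumes \<delta>: "piecewise_C1_path \<delta>"
    and F: "continuous_on (S \<times> path_image \<delta>) (\<lambda>x. F (fst x) (snd x))"
  shows "continuous_on S (\<lambda>s. contour \<delta> (\<lambda>p. F s p))"
proof -
  obtain P where P: "pieces (path_velocity \<delta>) P" using piecewise_C1_path_pieces [OF \<delta>] .
  have cont_\<delta>: "continuous_on {0..1} \<delta>" using \<delta> by (auto simp: piecewise_C1_path_def path_def)
  have eq: "contour \<delta> (\<lambda>p. F s p) = (\<Sum>(c, d, E)\<in>P. integral {c..d} (\<lambda>u. M (E u) o\<^sub>L F s (\<delta> u)))"
    if "s \<in> S" for s
    unfolding contour_def
  proof (intro integral_unique piecesD(3) [OF P])
    show "continuous_on {0..1} (\<lambda>u. F s (\<delta> u))"
      by (rule continuous_on_compose2 [OF F, of _ "\<lambda>u. (s, \<delta> u)", simplified])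
        (use that in \<open>auto simp: path_image_def intro!: continuous_intros cont_\<delta>\<close>)
  qed
  have "continuous_on S (\<lambda>s. \<Sum>x\<in>P. integral (cbox (fst x) (fst (snd x))) (\<lambda>u. M (snd (snd x) u) o\<^sub>L F s (\<delta> u)))"
  proof (rule continuous_on_sum, rule integral_continuous_on_param)
    fix x assume x: "x \<in> P"
    obtain c d E where [simp]: "x = (c, d, E)" by (cases x)
    note cd = piecesD(2) [OF P x [simplified]]
    have "continuous_on (S \<times> {c..d}) (\<lambda>x. F (fst x) (\<delta> (snd x)))"
      by (rule continuous_on_compose2 [OF F, of _ "\<lambda>x. (fst x, \<delta> (snd x))", simplified])
        (use cd in \<open>auto simp: path_image_def intro!: continuous_intros continuous_on_compose2 [OF cont_\<delta>]\<close>)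
    moreover have "continuous_on (S \<times> {c..d}) (\<lambda>x. E (snd x))"
      by (rule continuous_on_compose2 [of "{c..d}" E]) (use cd in \<open>auto intro!: continuous_intros\<close>)
    ultimately have "continuous_on (S \<times> {c..d}) (\<lambda>x. M (E (snd x)) o\<^sub>L F (fst x) (\<delta> (snd x)))"
      by (intro continuous_intros)
    then show "continuous_on (S \<times> cbox (fst x) (fst (snd x))) (\<lambda>(s, u). M (snd (snd x) u) o\<^sub>L F s (\<delta> u))"
      by (simp add: case_prod_beta)
  qed
  then show ?thesis
    by (rule continuous_on_eq) (simp add: eq case_prod_beta)
qed

lemma iterated_integral_pieces:
  fixes G :: "real \<Rightarrow> real \<Rightarrow> 'a \<Rightarrow>\<^sub>L 'a"
  assumes Q: "pieces v Q" and R: "pieces w R"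
    and G: "continuous_on ({0..1} \<times> {0..1}) (\<lambda>p. G (fst p) (snd p))"
  shows "integral {0..1} (\<lambda>t. M (v t) o\<^sub>L integral {0..1} (\<lambda>u. M (w u) o\<^sub>L G t u)) =
    (\<Sum>(a, b, D)\<in>Q. \<Sum>(c, d, E)\<in>R.
      integral {a..b} (\<lambda>t. integral {c..d} (\<lambda>u. M (D t) o\<^sub>L M (E u) o\<^sub>L G t u)))"
proof -
  note Qp = piecesD(1,2) [OF Q] and int_Q = piecesD(3) [OF Q]
  note Rp = piecesD(1,2) [OF R] and int_R = piecesD(3) [OF R]
  have G2: "continuous_on {0..1} (\<lambda>u. G t u)" if "t \<in> {0..1}" for t
    by (rule continuous_on_compose2 [OF G, of _ "\<lambda>u. (t, u)", simplified])
      (use that in \<open>auto intro!: continuous_intros\<close>)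
  define K where "K c d E t = integral {c..d} (\<lambda>u. M (E u) o\<^sub>L G t u)" for c d E t
  have K: "continuous_on {0..1} (K c d E)" if "(c, d, E) \<in> R" for c d E
  proof -
    have "continuous_on ({0..1} \<times> cbox c d) (\<lambda>(t, u). M (E u) o\<^sub>L G t u)"
      unfolding case_prod_beta
      using Rp(2) [OF that]
      by (intro continuous_intros continuous_on_subset [OF G] continuous_on_compose2 [of "{c..d}" E _ snd]) auto
    then show ?thesis unfolding K_def using integral_continuous_on_param by fastforce
  qed
  have comp_K: "M z o\<^sub>L K c d E t = integral {c..d} (\<lambda>u. M z o\<^sub>L M (E u) o\<^sub>L G t u)"
    if "(c, d, E) \<in> R" "t \<in> {0..1}" for c d E t z
  proof -
    have "(\<lambda>u. M (E u) o\<^sub>L G t u) integrable_on {c..d}"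
      using Rp(2) [OF that(1)] that(2)
      by (intro integrable_continuous_interval continuous_intros continuous_on_subset [OF G2]) auto
    from integral_linear [OF this blinfun_compose.bounded_linear_right, of "M z"]
    show ?thesis by (simp add: K_def o_def compose_assoc)
  qed
  have "integral {0..1} (\<lambda>t. M (v t) o\<^sub>L integral {0..1} (\<lambda>u. M (w u) o\<^sub>L G t u)) =
      integral {0..1} (\<lambda>t. M (v t) o\<^sub>L (\<Sum>(c, d, E)\<in>R. K c d E t))"
  proof (rule integral_cong)
    fix t :: real assume "t \<in> {0..1}"
    from integral_unique [OF int_R [OF G2 [OF this]]]
    show "M (v t) o\<^sub>L integral {0..1} (\<lambda>u. M (w u) o\<^sub>L G t u) = M (v t) o\<^sub>L (\<Sum>(c, d, E)\<in>R. K c d E t)"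
      by (simp add: K_def)
  qed
  also have "\<dots> = (\<Sum>(a, b, D)\<in>Q. integral {a..b} (\<lambda>t. M (D t) o\<^sub>L (\<Sum>(c, d, E)\<in>R. K c d E t)))"
    by (intro integral_unique int_Q) (use K in \<open>auto simp: case_prod_beta intro!: continuous_on_sum\<close>)
  also have "\<dots> = (\<Sum>(a, b, D)\<in>Q. \<Sum>(c, d, E)\<in>R.
      integral {a..b} (\<lambda>t. integral {c..d} (\<lambda>u. M (D t) o\<^sub>L M (E u) o\<^sub>L G t u)))"
  proof (intro sum.cong refl, clarify)
    fix a b D assume D: "(a, b, D) \<in> Q"
    note ab = Qp(2) [OF D]
    have "integral {a..b} (\<lambda>t. M (D t) o\<^sub>L (\<Sum>(c, d, E)\<in>R. K c d E t)) =
      integral {a..b} (\<lambda>t. \<Sum>(c, d, E)\<in>R. M (D t) o\<^sub>L K c d E t)"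
      by (simp add: blinfun_compose.sum_right case_prod_beta)
    also have "\<dots> = (\<Sum>(c, d, E)\<in>R. integral {a..b} (\<lambda>t. M (D t) o\<^sub>L K c d E t))"
      unfolding case_prod_beta
    proof (rule integral_sum [OF Rp(1)])
      fix r assume r: "r \<in> R"
      obtain c d E where "r = (c, d, E)" by (cases r)
      then show "(\<lambda>t. M (D t) o\<^sub>L K (fst r) (fst (snd r)) (snd (snd r)) t) integrable_on {a..b}"
        using ab r by (auto intro!: integrable_continuous_interval continuous_intros continuous_on_subset [OF K])
    qed
    also have "\<dots> = (\<Sum>(c, d, E)\<in>R. integral {a..b} (\<lambda>t. integral {c..d} (\<lambda>u. M (D t) o\<^sub>L M (E u) o\<^sub>L G t u)))"
      using ab by (intro sum.cong refl) (auto intro!: integral_cong comp_K)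
    finally show "integral {a..b} (\<lambda>t. M (D t) o\<^sub>L (\<Sum>(c, d, E)\<in>R. K c d E t)) =
      (\<Sum>(c, d, E)\<in>R. integral {a..b} (\<lambda>t. integral {c..d} (\<lambda>u. M (D t) o\<^sub>L M (E u) o\<^sub>L G t u)))" .
  qed
  finally show ?thesis .
qed

text \<open>On each pair of pieces the integrand is continuous on a closed rectangle, where the order of
integration may be exchanged.\<close>

lemma contour_swap:
  assumes \<gamma>: "piecewise_C1_path \<gamma>" and \<delta>: "piecewise_C1_path \<delta>"
    and F: "continuous_on (path_image \<gamma> \<times> path_image \<delta>) (\<lambda>p. F (fst p) (snd p))"
  shows "contour \<gamma> (\<lambda>s. contour \<delta> (\<lambda>p. F s p)) = contour \<delta> (\<lambda>p. contour \<gamma> (\<lambda>s. F s p))"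
proof -
  obtain Q where Q: "pieces (path_velocity \<gamma>) Q" using piecewise_C1_path_pieces [OF \<gamma>] .
  obtain R where R: "pieces (path_velocity \<delta>) R" using piecewise_C1_path_pieces [OF \<delta>] .
  have paths: "continuous_on {0..1} \<gamma>" "continuous_on {0..1} \<delta>"
    using \<gamma> \<delta> by (auto simp: piecewise_C1_path_def path_def)
  define G where "G t u = F (\<gamma> t) (\<delta> u)" for t u
  have G: "continuous_on ({0..1} \<times> {0..1}) (\<lambda>p. G (fst p) (snd p))"
    unfolding G_def
    by (rule continuous_on_compose2 [OF F, of _ "\<lambda>p. (\<gamma> (fst p), \<delta> (snd p))", simplified])
      (auto simp: path_image_def intro!: continuous_intros continuous_on_compose2 [OF paths(1)]
          continuous_on_compose2 [OF paths(2)])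
  have G': "continuous_on ({0..1} \<times> {0..1}) (\<lambda>p. G (snd p) (fst p))"
    by (rule continuous_on_compose2 [OF G, of _ "\<lambda>p. (snd p, fst p)", simplified])
      (auto intro!: continuous_intros)
  have "(\<Sum>(a, b, D)\<in>Q. \<Sum>(c, d, E)\<in>R.
      integral {a..b} (\<lambda>t. integral {c..d} (\<lambda>u. M (D t) o\<^sub>L M (E u) o\<^sub>L G t u))) =
    (\<Sum>(a, b, D)\<in>Q. \<Sum>(c, d, E)\<in>R.
      integral {c..d} (\<lambda>u. integral {a..b} (\<lambda>t. M (E u) o\<^sub>L M (D t) o\<^sub>L G t u)))"
  proof (intro sum.cong refl, clarify, intro sum.cong refl, clarify)
    fix a b D c d E assume DE: "(a, b, D) \<in> Q" "(c, d, E) \<in> R"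
    have ab: "0 \<le> a" "b \<le> 1" "continuous_on {a..b} D" "0 \<le> c" "d \<le> 1" "continuous_on {c..d} E"
      using piecesD(2) [OF Q DE(1)] piecesD(2) [OF R DE(2)] by auto
    have "continuous_on (cbox (a, c) (b, d)) (\<lambda>(t, u). M (D t) o\<^sub>L M (E u) o\<^sub>L G t u)"
      unfolding case_prod_beta cbox_Pair_eq
      using ab by (intro continuous_intros continuous_on_subset [OF G]
          continuous_on_compose2 [of "{a..b}" D _ fst] continuous_on_compose2 [of "{c..d}" E _ snd]) auto
    from integral_swap_continuous [OF this]
    show "integral {a..b} (\<lambda>t. integral {c..d} (\<lambda>u. M (D t) o\<^sub>L M (E u) o\<^sub>L G t u)) =
      integral {c..d} (\<lambda>u. integral {a..b} (\<lambda>t. M (E u) o\<^sub>L M (D t) o\<^sub>L G t u))"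
      by (simp add: M_commute [of "D _"])
  qed
  also have "\<dots> = (\<Sum>(c, d, E)\<in>R. \<Sum>(a, b, D)\<in>Q.
      integral {c..d} (\<lambda>u. integral {a..b} (\<lambda>t. M (E u) o\<^sub>L M (D t) o\<^sub>L G t u)))"
    unfolding case_prod_beta by (rule sum.swap)
  finally show ?thesis
    using iterated_integral_pieces [OF Q R G] iterated_integral_pieces [OF R Q G']
    by (simp add: contour_def G_def)
qed

lemma contour_cnj:
  assumes "piecewise_C1_path \<gamma>"
  shows "contour (cnj \<circ> \<gamma>) F = integral {0..1} (\<lambda>t. M (cnj (path_velocity \<gamma> t)) o\<^sub>L F (cnj (\<gamma> t)))"
proof -
  obtain S where "finite S" "\<forall>t\<in>{0..1} - S. path_velocity (cnj \<circ> \<gamma>) t = cnj (path_velocity \<gamma> t)"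
    using path_velocity_cnj [OF assms] .
  then show ?thesis
    unfolding contour_def by (intro integral_spike [of S]) (auto intro: negligible_finite)
qed

end


section \<open>Divided differences of holomorphic functions\<close>

text \<open>On the diagonal the value is the limit, so that the function is continuous in both variables.\<close>

definition divdiff :: "(complex \<Rightarrow> complex) \<Rightarrow> complex \<Rightarrow> complex \<Rightarrow> complex" where
  "divdiff \<phi> s p = (if s = p then deriv \<phi> p else (\<phi> s - \<phi> p) / (s - p))"

lemma divdiff_mult: "(s - p) * divdiff \<phi> s p = \<phi> s - \<phi> p"
  by (simp add: divdiff_def)

lemma holomorphic_divdiff_left:
  assumes "\<phi> holomorphic_on S" "open S"
  shows "(\<lambda>s. divdiff \<phi> s p) holomorphic_on S"
  using pole_lemma_open [OF assms, of p] by (simp add: divdiff_def)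

lemma divdiff_commute: "divdiff \<phi> s p = divdiff \<phi> p s"
  by (simp add: divdiff_def divide_simps) (simp add: algebra_simps)

text \<open>Near a diagonal point \<open>(b, b)\<close> the function \<open>\<phi> z - \<phi>'(b) z\<close> has small derivative, so the mean value
inequality bounds the difference between the divided difference and \<open>\<phi>'(b)\<close>.\<close>

lemma continuous_on_divdiff:
  assumes \<phi>: "\<phi> holomorphic_on S" and S: "open S"
  shows "continuous_on (S \<times> S) (\<lambda>x. divdiff \<phi> (fst x) (snd x))"
proof (rule continuous_at_imp_continuous_on, rule ballI, clarify)
  fix a b assume ab: "a \<in> S" "b \<in> S"
  have cont: "isCont f x" if "f holomorphic_on S" "x \<in> S" for f x
    using holomorphic_on_imp_continuous_on [OF that(1)] that(2) continuous_on_eq_continuous_at [OF S] by blast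
  show "isCont (\<lambda>x. divdiff \<phi> (fst x) (snd x)) (a, b)"
  proof (cases "a = b")
    case False
    have "isCont \<phi> (fst (a, b))" "isCont \<phi> (snd (a, b))"
      using cont [OF \<phi>] ab by simp_all
    then have "isCont (\<lambda>x. (\<phi> (fst x) - \<phi> (snd x)) / (fst x - snd x)) (a, b)"
      using False by (intro continuous_intros isCont_o2 [of _ fst] isCont_o2 [of _ snd]) auto
    moreover have "eventually (\<lambda>x. (\<phi> (fst x) - \<phi> (snd x)) / (fst x - snd x) = divdiff \<phi> (fst x) (snd x)) (nhds (a, b))"
    proof -
      have "open {x :: complex \<times> complex. fst x \<noteq> snd x}"
        by (intro open_Collect_neq continuous_intros)
      then have "eventually (\<lambda>x. x \<in> {x. fst x \<noteq> snd x}) (nhds (a, b))"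
        using False by (intro eventually_nhds_in_open) auto
      then show ?thesis by (rule eventually_mono) (auto simp: divdiff_def)
    qed
    ultimately show ?thesis by (rule isCont_cong [THEN iffD1, rotated])
  next
    case True
    show ?thesis
      unfolding True continuous_at_eps_delta
    proof (intro allI impI)
      fix e :: real assume "e > 0"
      have "deriv \<phi> holomorphic_on S" using \<phi> S by (rule holomorphic_deriv)
      then have "isCont (deriv \<phi>) b"
        using cont ab by blast
      then obtain d1 where d1: "d1 > 0" "\<And>x. dist x b < d1 \<Longrightarrow> dist (deriv \<phi> x) (deriv \<phi> b) < e / 2"
        using \<open>e > 0\<close> unfolding continuous_at_eps_delta by (meson half_gt_zero)
      obtain d2 where d2: "d2 > 0" "ball b d2 \<subseteq> S" using S ab open_contains_ball by blast
      define d where "d = min d1 d2"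
      have d: "d > 0" using d1 d2 by (simp add: d_def)
      have bound: "norm (\<phi> s - deriv \<phi> b * s - (\<phi> p - deriv \<phi> b * p)) \<le> e / 2 * norm (s - p)"
        if "s \<in> ball b d" "p \<in> ball b d" for s p
      proof (rule field_differentiable_bound [OF convex_ball [of b d]])
        fix z assume z: "z \<in> ball b d"
        then have "z \<in> S" using d2 by (auto simp: d_def)
        then have "(\<phi> has_field_derivative deriv \<phi> z) (at z)"
          using \<phi> S by (rule holomorphic_derivI [rotated 2])
        then show "((\<lambda>z. \<phi> z - deriv \<phi> b * z) has_field_derivative deriv \<phi> z - deriv \<phi> b) (at z within ball b d)"
          using has_field_derivative_at_within [OF DERIV_diff [OF _ DERIV_cmult_Id]] by blast
        have "dist z b < d1" using z by (simp add: d_def dist_commute)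
        then show "norm (deriv \<phi> z - deriv \<phi> b) \<le> e / 2"
          using d1(2) [of z] by (simp add: dist_norm)
      qed (use that in auto)
      have close: "dist (divdiff \<phi> s p) (deriv \<phi> b) \<le> e / 2" if sp: "s \<in> ball b d" "p \<in> ball b d" for s p
      proof (cases "s = p")
        case True
        then show ?thesis using d1(2) [of p] sp by (simp add: divdiff_def d_def dist_commute)
      next
        case False
        then have "divdiff \<phi> s p - deriv \<phi> b = (\<phi> s - deriv \<phi> b * s - (\<phi> p - deriv \<phi> b * p)) / (s - p)"
          by (simp add: divdiff_def field_simps)
        then have "dist (divdiff \<phi> s p) (deriv \<phi> b) =
            norm (\<phi> s - deriv \<phi> b * s - (\<phi> p - deriv \<phi> b * p)) / norm (s - p)"
          unfolding dist_norm by (simp only: norm_divide)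
        then show ?thesis
          using bound [OF sp] False by (simp add: pos_divide_le_eq)
      qed
      show "\<exists>d>0. \<forall>x. dist x (b, b) < d \<longrightarrow> dist (divdiff \<phi> (fst x) (snd x)) (divdiff \<phi> (fst (b, b)) (snd (b, b))) < e"
      proof (intro exI [of _ d] conjI allI impI d)
        fix x :: "complex \<times> complex" assume x: "dist x (b, b) < d"
        have "dist (fst x) b \<le> dist x (b, b)" "dist (snd x) b \<le> dist x (b, b)"
          using dist_fst_le [of x "(b, b)"] dist_snd_le [of x "(b, b)"] by simp_all
        then have "dist (divdiff \<phi> (fst x) (snd x)) (deriv \<phi> b) \<le> e / 2"
          using x by (intro close) (auto simp: dist_commute)
        then show "dist (divdiff \<phi> (fst x) (snd x)) (divdiff \<phi> (fst (b, b)) (snd (b, b))) < e"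
          using \<open>e > 0\<close> by (simp add: divdiff_def)
      qed
    qed
  qed
qed


section \<open>Operator-valued holomorphic functions\<close>

context complex_structure
begin

text \<open>Complex differentiability: the real derivative is multiplication by complex numbers, acting through \<open>M\<close>.\<close>

definition J_holomorphic :: "(complex \<Rightarrow> 'a \<Rightarrow>\<^sub>L 'a) \<Rightarrow> complex set \<Rightarrow> bool" where
  "J_holomorphic F S \<longleftrightarrow> (\<forall>z\<in>S. \<exists>c. (F has_derivative (\<lambda>h. M h o\<^sub>L c)) (at z))"

lemma J_holomorphic_subset: "J_holomorphic F S \<Longrightarrow> T \<subseteq> S \<Longrightarrow> J_holomorphic F T"
  by (auto simp: J_holomorphic_def)

lemma J_holomorphic_imp_continuous_on: "J_holomorphic F S \<Longrightarrow> continuous_on S F"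
  unfolding J_holomorphic_def
  by (meson continuous_at_imp_continuous_on has_derivative_continuous)

lemma J_holomorphic_M:
  assumes "\<phi> holomorphic_on S" "open S"
  shows "J_holomorphic (\<lambda>z. M (\<phi> z)) S"
  unfolding J_holomorphic_def
proof (intro ballI exI)
  fix z assume "z \<in> S"
  then have "(\<phi> has_derivative (\<lambda>h. h * deriv \<phi> z)) (at z)"
    using holomorphic_derivI [OF assms] by (simp add: has_field_derivative_def mult_commute_abs)
  from bounded_linear.has_derivative [OF bounded_linear_M this]
  show "((\<lambda>z. M (\<phi> z)) has_derivative (\<lambda>h. M h o\<^sub>L M (deriv \<phi> z))) (at z)"
    by (simp add: M_mult)
qed

text \<open>Composition is complex-linear in its right factor only if the left factor commutes with \<open>J\<close>.\<close>

lemma J_holomorphic_compose: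
  assumes F: "J_holomorphic F S" and comm: "\<And>z. z \<in> S \<Longrightarrow> F z o\<^sub>L J = J o\<^sub>L F z" and G: "J_holomorphic G S"
  shows "J_holomorphic (\<lambda>z. F z o\<^sub>L G z) S"
  unfolding J_holomorphic_def
proof
  fix z assume z: "z \<in> S"
  obtain c where c: "(F has_derivative (\<lambda>h. M h o\<^sub>L c)) (at z)" using F z by (auto simp: J_holomorphic_def)
  obtain d where d: "(G has_derivative (\<lambda>h. M h o\<^sub>L d)) (at z)" using G z by (auto simp: J_holomorphic_def)
  have "((\<lambda>z. F z o\<^sub>L G z) has_derivative (\<lambda>h. (F z o\<^sub>L (M h o\<^sub>L d)) + ((M h o\<^sub>L c) o\<^sub>L G z))) (at z)"
    by (rule blinfun_compose.FDERIV [OF c d])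
  moreover have "(F z o\<^sub>L (M h o\<^sub>L d)) + ((M h o\<^sub>L c) o\<^sub>L G z) = M h o\<^sub>L ((F z o\<^sub>L d) + (c o\<^sub>L G z))" for h
    using commutes_M [OF comm [OF z], of h]
    by (simp add: compose_simps compose_assoc) (simp flip: compose_assoc)
  ultimately show "\<exists>c. ((\<lambda>z. F z o\<^sub>L G z) has_derivative (\<lambda>h. M h o\<^sub>L c)) (at z)" by auto
qed

text \<open>Caratheodory's form of differentiability.  It suits the resolvent, whose increments factor by the
resolvent equation.\<close>

lemma J_holomorphic_factorI:
  assumes "\<And>z. z \<in> S \<Longrightarrow> \<exists>K. isCont K z \<and> eventually (\<lambda>w. F w = F z + (M (w - z) o\<^sub>L K w)) (nhds z)"
  shows "J_holomorphic F S"
  unfolding J_holomorphic_def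
proof
  fix z assume "z \<in> S"
  then obtain K where K: "isCont K z" "eventually (\<lambda>w. F w = F z + (M (w - z) o\<^sub>L K w)) (nhds z)"
    using assms by blast
  have "((\<lambda>w. F z + (M (w - z) o\<^sub>L K w)) has_derivative (\<lambda>h. M h o\<^sub>L K z)) (at z)"
    unfolding has_derivative_at_within
  proof (intro conjI)
    show "bounded_linear (\<lambda>h. M h o\<^sub>L K z)"
      by (rule bounded_linear_compose [OF blinfun_compose.bounded_linear_left bounded_linear_M])
    have "((\<lambda>w. (1 + norm J) * norm (K w - K z)) \<longlongrightarrow> 0) (at z)"
      using K(1) unfolding isCont_def by (intro tendsto_mult_right_zero tendsto_norm_zero) (simp add: LIM_zero)
    then show "((\<lambda>w. (F z + (M (w - z) o\<^sub>L K w) - (F z + (M (z - z) o\<^sub>L K z)) - (M (w - z) o\<^sub>L K z)) /\<^sub>R norm (w - z)) \<longlongrightarrow> 0) (at z)"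
    proof (rule Lim_null_comparison [rotated])
      show "\<forall>\<^sub>F w in at z. norm ((F z + (M (w - z) o\<^sub>L K w) - (F z + (M (z - z) o\<^sub>L K z)) - (M (w - z) o\<^sub>L K z)) /\<^sub>R norm (w - z))
          \<le> (1 + norm J) * norm (K w - K z)"
      proof (intro eventually_at_filter [THEN iffD2] always_eventually allI impI)
        fix w assume "w \<noteq> z"
        have "F z + (M (w - z) o\<^sub>L K w) - (F z + (M (z - z) o\<^sub>L K z)) - (M (w - z) o\<^sub>L K z) = M (w - z) o\<^sub>L (K w - K z)"
          by (simp add: compose_simps)
        moreover have "norm (M (w - z) o\<^sub>L (K w - K z)) \<le> (1 + norm J) * norm (w - z) * norm (K w - K z)"
          by (rule order.trans [OF norm_blinfun_compose mult_right_mono [OF norm_M]]) simp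
        ultimately show "norm ((F z + (M (w - z) o\<^sub>L K w) - (F z + (M (z - z) o\<^sub>L K z)) - (M (w - z) o\<^sub>L K z)) /\<^sub>R norm (w - z))
          \<le> (1 + norm J) * norm (K w - K z)"
          using \<open>w \<noteq> z\<close> by (simp add: divide_simps mult_ac)
      qed
    qed
  qed
  moreover have "eventually (\<lambda>w. F z + (M (w - z) o\<^sub>L K w) = F w) (at z)"
    using K(2) unfolding eventually_at_filter by (auto elim: eventually_mono)
  ultimately have "(F has_derivative (\<lambda>h. M h o\<^sub>L K z)) (at z)"
    by (rule has_derivative_transform_eventually) (use eventually_nhds_x_imp_x [OF K(2)] in auto)
  then show "\<exists>c. (F has_derivative (\<lambda>h. M h o\<^sub>L c)) (at z)" ..
qed

lemma functional_contour:
  assumes "bounded_linear \<psi>" and \<psi>: "\<And>z Y. \<psi> (M z o\<^sub>L Y) = z * \<psi> Y"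
    and "piecewise_C1_path \<gamma>" "continuous_on (path_image \<gamma>) F"
  shows "contour_integral \<gamma> (\<lambda>z. \<psi> (F z)) = \<psi> (contour \<gamma> F)"
proof (rule contour_integral_unique)
  show "((\<lambda>z. \<psi> (F z)) has_contour_integral \<psi> (contour \<gamma> F)) \<gamma>"
    using has_integral_linear [OF has_integral_contour [OF assms(3,4)] assms(1)]
    by (simp add: has_contour_integral_def o_def \<psi> mult.commute)
qed

lemma functional_J_holomorphic:
  assumes "bounded_linear \<psi>" and \<psi>: "\<And>z Y. \<psi> (M z o\<^sub>L Y) = z * \<psi> Y" and F: "J_holomorphic F S"
  shows "(\<lambda>z. \<psi> (F z)) holomorphic_on S"
  unfolding holomorphic_on_def field_differentiable_def
proof
  fix z assume "z \<in> S"
  then obtain c where "(F has_derivative (\<lambda>h. M h o\<^sub>L c)) (at z)" using F by (auto simp: J_holomorphic_def)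
  from bounded_linear.has_derivative [OF assms(1) this]
  have "((\<lambda>z. \<psi> (F z)) has_field_derivative \<psi> c) (at z)"
    by (simp add: has_field_derivative_def \<psi> mult_commute_abs)
  then show "\<exists>d. ((\<lambda>z. \<psi> (F z)) has_field_derivative d) (at z within S)"
    using has_field_derivative_at_within by blast
qed

text \<open>A nonzero integral would be detected by a complex functional, which commutes with integration.\<close>

theorem Cauchy_theorem_cycle_operator:
  fixes g :: "'i \<Rightarrow> real \<Rightarrow> complex"
  assumes \<Omega>: "open \<Omega>" and F: "J_holomorphic F \<Omega>" and "finite A"
    and g: "\<And>i. i \<in> A \<Longrightarrow> piecewise_C1_path (g i) \<and> pathfinish (g i) = pathstart (g i) \<and> path_image (g i) \<subseteq> \<Omega>"
    and zero: "\<And>z. z \<notin> \<Omega> \<Longrightarrow> (\<Sum>i\<in>A. winding_number (g i) z) = 0"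
  shows "(\<Sum>i\<in>A. contour (g i) F) = 0"
proof (rule ccontr)
  assume "(\<Sum>i\<in>A. contour (g i) F) \<noteq> 0"
  then obtain \<psi> where \<psi>: "bounded_linear \<psi>" "\<And>z Y. \<psi> (M z o\<^sub>L Y) = z * \<psi> Y"
    "\<psi> (\<Sum>i\<in>A. contour (g i) F) \<noteq> 0"
    using complex_functional_nonzero by blast
  have cont: "continuous_on (path_image (g i)) F" if "i \<in> A" for i
    using J_holomorphic_imp_continuous_on [OF F] g [OF that] by (auto intro: continuous_on_subset)
  have "\<psi> (\<Sum>i\<in>A. contour (g i) F) = (\<Sum>i\<in>A. contour_integral (g i) (\<lambda>z. \<psi> (F z)))"
    unfolding linear_sum [OF bounded_linear.linear [OF \<psi>(1)]]
    using g cont by (intro sum.cong refl functional_contour [OF \<psi>(1,2), symmetric]) auto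
  also have "\<dots> = 0"
    using g by (intro Cauchy_theorem_cycle [OF \<Omega> functional_J_holomorphic [OF \<psi>(1,2) F] \<open>finite A\<close> _ zero])
      (auto simp: piecewise_C1_path_imp_valid_path)
  finally show False using \<psi>(3) by simp
qed

theorem contour_around_everything_operator:
  fixes g :: "'i \<Rightarrow> real \<Rightarrow> complex"
  assumes \<Omega>: "open \<Omega>" and F: "J_holomorphic F \<Omega>" and "finite A" and bdd: "bounded (- \<Omega>)"
    and g: "\<And>i. i \<in> A \<Longrightarrow> piecewise_C1_path (g i) \<and> pathfinish (g i) = pathstart (g i) \<and> path_image (g i) \<subseteq> \<Omega>"
    and one: "\<And>z. z \<notin> \<Omega> \<Longrightarrow> (\<Sum>i\<in>A. winding_number (g i) z) = 1"
    and lim: "((\<lambda>z. M z o\<^sub>L F z) \<longlongrightarrow> C) at_infinity"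
  shows "(\<Sum>i\<in>A. contour (g i) F) = M (2 * pi * \<i>) o\<^sub>L C"
proof (rule ccontr)
  assume "(\<Sum>i\<in>A. contour (g i) F) \<noteq> M (2 * pi * \<i>) o\<^sub>L C"
  then have "(\<Sum>i\<in>A. contour (g i) F) - (M (2 * pi * \<i>) o\<^sub>L C) \<noteq> 0" by (simp only: right_minus_eq) simp
  then obtain \<psi> where \<psi>: "bounded_linear \<psi>" "\<And>z Y. \<psi> (M z o\<^sub>L Y) = z * \<psi> Y"
    "\<psi> ((\<Sum>i\<in>A. contour (g i) F) - (M (2 * pi * \<i>) o\<^sub>L C)) \<noteq> 0"
    using complex_functional_nonzero by blast
  have cont: "continuous_on (path_image (g i)) F" if "i \<in> A" for i
    using J_holomorphic_imp_continuous_on [OF F] g [OF that] by (auto intro: continuous_on_subset)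
  have "\<psi> (\<Sum>i\<in>A. contour (g i) F) = (\<Sum>i\<in>A. contour_integral (g i) (\<lambda>z. \<psi> (F z)))"
    unfolding linear_sum [OF bounded_linear.linear [OF \<psi>(1)]]
    using g cont by (intro sum.cong refl functional_contour [OF \<psi>(1,2), symmetric]) auto
  also have "\<dots> = 2 * pi * \<i> * \<psi> C"
  proof (rule contour_integral_around_everything [OF \<Omega> functional_J_holomorphic [OF \<psi>(1,2) F] \<open>finite A\<close> bdd _ one])
    show "((\<lambda>z. z * \<psi> (F z)) \<longlongrightarrow> \<psi> C) at_infinity"
      using bounded_linear.tendsto [OF \<psi>(1) lim] by (simp add: \<psi>(2))
  qed (use g in \<open>auto simp: piecewise_C1_path_imp_valid_path\<close>)
  also have "\<dots> = \<psi> (M (2 * pi * \<i>) o\<^sub>L C)" by (rule \<psi>(2) [symmetric])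
  finally show False
    using \<psi>(3) unfolding linear_diff [OF bounded_linear.linear [OF \<psi>(1)]] by simp
qed

end


section \<open>The resolvent of a quadratic pencil\<close>

definition mutually_inverse :: "('a::real_normed_vector \<Rightarrow>\<^sub>L 'a) \<Rightarrow> ('a \<Rightarrow>\<^sub>L 'a) \<Rightarrow> bool" where
  "mutually_inverse A B \<longleftrightarrow> A o\<^sub>L B = id_blinfun \<and> B o\<^sub>L A = id_blinfun"

lemma mutually_inverse_unique:
  assumes "mutually_inverse A B" "mutually_inverse A C"
  shows "B = C"
proof -
  have "B = B o\<^sub>L (A o\<^sub>L C)" using assms(2) by (simp add: mutually_inverse_def)
  also have "\<dots> = C" using assms(1) by (simp add: mutually_inverse_def flip: compose_assoc)
  finally show ?thesis .
qed

lemma mutually_inverse_commute: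
  assumes AB: "mutually_inverse A B" and XA: "X o\<^sub>L A = C o\<^sub>L X" and CD: "mutually_inverse C D"
  shows "X o\<^sub>L B = D o\<^sub>L X"
proof -
  have "D o\<^sub>L (X o\<^sub>L A) o\<^sub>L B = D o\<^sub>L (C o\<^sub>L X) o\<^sub>L B" by (simp add: XA)
  then have "D o\<^sub>L (X o\<^sub>L (A o\<^sub>L B)) = (D o\<^sub>L C) o\<^sub>L (X o\<^sub>L B)" by (simp add: compose_assoc)
  then show ?thesis using assms by (simp add: mutually_inverse_def)
qed

text \<open>The factor \<open>id_blinfun - X\<close> of \<open>C\<close> has a right inverse, the fixed point of \<open>Y \<mapsto> 1 + X Y\<close>, and
similarly a left inverse; the two coincide.\<close>

lemma mutually_inverse_perturb:
  fixes A :: "'a::banach \<Rightarrow>\<^sub>L 'a"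
  assumes AB: "mutually_inverse A B" and small: "norm (C - A) * norm B \<le> 1 / 2"
  obtains D where "mutually_inverse C D" "norm D \<le> 2 * norm B"
proof -
  define X where "X = - (B o\<^sub>L (C - A))"
  have X: "norm X \<le> 1 / 2"
    using norm_blinfun_compose [of B "C - A"] small by (simp add: X_def mult.commute)
  have XB: "norm (X o\<^sub>L Y) \<le> 1 / 2 * norm Y" "norm (Y o\<^sub>L X) \<le> 1 / 2 * norm Y" for Y :: "'a \<Rightarrow>\<^sub>L 'a"
    using order.trans [OF norm_blinfun_compose [of X Y] mult_right_mono [OF X, of "norm Y"]]
      order.trans [OF norm_blinfun_compose [of Y X] mult_left_mono [OF X, of "norm Y"]] by simp_all
  have "\<exists>!Y. id_blinfun + (X o\<^sub>L Y) = Y"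
    by (rule banach_fix_type [of "1 / 2"])
      (use XB(1) in \<open>auto simp: dist_norm simp flip: blinfun_compose.diff_right\<close>)
  then obtain Y where Y: "id_blinfun + (X o\<^sub>L Y) = Y" by blast
  have "\<exists>!Z. id_blinfun + (Z o\<^sub>L X) = Z"
    by (rule banach_fix_type [of "1 / 2"])
      (use XB(2) in \<open>auto simp: dist_norm simp flip: blinfun_compose.diff_left\<close>)
  then obtain Z where Z: "id_blinfun + (Z o\<^sub>L X) = Z" by blast
  have Y': "(id_blinfun - X) o\<^sub>L Y = id_blinfun" using Y by (simp add: compose_simps algebra_simps)
  have Z': "Z o\<^sub>L (id_blinfun - X) = id_blinfun" using Z by (simp add: compose_simps algebra_simps)
  have "Z = Z o\<^sub>L ((id_blinfun - X) o\<^sub>L Y)" by (simp add: Y')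
  also have "\<dots> = Y" by (simp add: Z' flip: compose_assoc)
  finally have "Z = Y" .
  have C: "C = A o\<^sub>L (id_blinfun - X)"
  proof -
    have "A o\<^sub>L (id_blinfun - X) = A + ((A o\<^sub>L B) o\<^sub>L (C - A))"
      by (simp add: X_def compose_simps compose_assoc)
    then show ?thesis using AB by (simp add: mutually_inverse_def)
  qed
  have "C o\<^sub>L (Y o\<^sub>L B) = A o\<^sub>L (((id_blinfun - X) o\<^sub>L Y) o\<^sub>L B)" by (simp add: C compose_assoc)
  moreover have "(Y o\<^sub>L B) o\<^sub>L C = Y o\<^sub>L ((B o\<^sub>L A) o\<^sub>L (id_blinfun - X))" by (simp add: C compose_assoc)
  ultimately have "mutually_inverse C (Y o\<^sub>L B)"
    using AB Y' Z' \<open>Z = Y\<close> by (simp add: mutually_inverse_def)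
  moreover have "norm (Y o\<^sub>L B) \<le> 2 * norm B"
  proof -
    have "norm Y \<le> norm (id_blinfun :: 'a \<Rightarrow>\<^sub>L 'a) + norm (X o\<^sub>L Y)"
      using norm_triangle_ineq [of id_blinfun "X o\<^sub>L Y"] by (simp add: Y)
    also have "\<dots> \<le> 1 + 1 / 2 * norm Y" by (intro add_mono norm_blinfun_id_le XB)
    finally have "norm Y \<le> 2" by simp
    then show ?thesis
      by (intro order.trans [OF norm_blinfun_compose] mult_right_mono) auto
  qed
  ultimately show ?thesis by (rule that)
qed

text \<open>The resolvent \<open>R\<close> of \<open>z\<^sup>2 + N\<close>, where \<open>N\<close> is complex-linear for the structure \<open>J\<close>.\<close>

locale quadratic_pencil = complex_structure +
  fixes N :: "'a \<Rightarrow>\<^sub>L 'a"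
  assumes N_J: "N o\<^sub>L J = J o\<^sub>L N"
begin

definition Q :: "complex \<Rightarrow> 'a \<Rightarrow>\<^sub>L 'a" where
  "Q z = M (z * z) + N"

definition regular :: "complex set" where
  "regular = {z. \<exists>B. mutually_inverse (Q z) B}"

definition R :: "complex \<Rightarrow> 'a \<Rightarrow>\<^sub>L 'a" where
  "R z = (SOME B. mutually_inverse (Q z) B)"

lemma R: "z \<in> regular \<Longrightarrow> mutually_inverse (Q z) (R z)"
  unfolding regular_def R_def by (auto intro: someI)

lemma R_eqI: "mutually_inverse (Q z) B \<Longrightarrow> R z = B"
  using R [of z] mutually_inverse_unique by (auto simp: regular_def)

lemma R_commute:
  assumes "z \<in> regular" "A o\<^sub>L J = J o\<^sub>L A" "A o\<^sub>L N = N o\<^sub>L A"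
  shows "A o\<^sub>L R z = R z o\<^sub>L A"
  using R [OF assms(1)] _ R [OF assms(1)]
  by (rule mutually_inverse_commute) (simp add: Q_def compose_simps assms(3) commutes_M [OF assms(2)])

lemma R_J: "z \<in> regular \<Longrightarrow> R z o\<^sub>L J = J o\<^sub>L R z"
  using R_commute [of z J] by (simp add: N_J)

text \<open>The resolvent equation.\<close>

lemma R_diff:
  assumes "z \<in> regular" "w \<in> regular"
  shows "R z - R w = M (w * w - z * z) o\<^sub>L (R z o\<^sub>L R w)"
proof -
  have "(R z o\<^sub>L (Q w - Q z)) o\<^sub>L R w = (R z o\<^sub>L (Q w o\<^sub>L R w)) - ((R z o\<^sub>L Q z) o\<^sub>L R w)"
    by (simp add: compose_simps compose_assoc)
  also have "\<dots> = R z - R w" using R [OF assms(1)] R [OF assms(2)] by (simp add: mutually_inverse_def)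
  finally show ?thesis
    by (simp add: Q_def M_diff [symmetric] commutes_M [OF R_J [OF assms(1)]] flip: compose_assoc)
qed

lemma eventually_regular:
  assumes z: "z \<in> regular"
  shows "eventually (\<lambda>w. w \<in> regular \<and> norm (R w) \<le> 2 * norm (R z)) (nhds z)"
proof -
  have "((\<lambda>w. norm (M (w * w - z * z)) * norm (R z)) \<longlongrightarrow> norm (M (z * z - z * z)) * norm (R z)) (nhds z)"
    by (intro tendsto_intros bounded_linear.tendsto [OF bounded_linear_M] filterlim_ident)
  then have "eventually (\<lambda>w. norm (M (w * w - z * z)) * norm (R z) < 1 / 2) (nhds z)"
    by (rule order_tendstoD) simp
  then show ?thesis
  proof (rule eventually_mono)
    fix w assume "norm (M (w * w - z * z)) * norm (R z) < 1 / 2"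
    then have "norm (Q w - Q z) * norm (R z) \<le> 1 / 2" by (simp add: Q_def M_diff)
    then obtain D where "mutually_inverse (Q w) D" "norm D \<le> 2 * norm (R z)"
      by (rule mutually_inverse_perturb [OF R [OF z]])
    then show "w \<in> regular \<and> norm (R w) \<le> 2 * norm (R z)"
      using R_eqI by (auto simp: regular_def)
  qed
qed

lemma open_regular: "open regular"
proof (subst open_subopen, rule ballI)
  fix z assume z: "z \<in> regular"
  have "eventually (\<lambda>w. w \<in> regular) (nhds z)"
    using eventually_regular [OF z] by (rule eventually_mono) (rule conjunct1)
  then show "\<exists>T. open T \<and> z \<in> T \<and> T \<subseteq> regular"
    by (simp only: eventually_nhds subset_iff Ball_def)
qed

lemma isCont_R:
  assumes z: "z \<in> regular"
  shows "isCont R z"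
  unfolding isCont_def
proof (rule LIM_zero_cancel, rule Lim_null_comparison)
  show "eventually (\<lambda>w. norm (R w - R z) \<le> norm (M (z * z - w * w)) * (2 * norm (R z) * norm (R z))) (at z)"
    using eventually_regular [OF z, unfolded eventually_nhds_conv_at, THEN conjunct1]
  proof (rule eventually_mono)
    fix w assume w: "w \<in> regular \<and> norm (R w) \<le> 2 * norm (R z)"
    have "norm (R w - R z) \<le> norm (M (z * z - w * w)) * norm (R w o\<^sub>L R z)"
      using R_diff [of w z] w z by (simp add: norm_blinfun_compose)
    also have "\<dots> \<le> norm (M (z * z - w * w)) * (2 * norm (R z) * norm (R z))"
      using w by (intro mult_left_mono order.trans [OF norm_blinfun_compose] mult_right_mono) auto
    finally show "norm (R w - R z) \<le> norm (M (z * z - w * w)) * (2 * norm (R z) * norm (R z))" .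
  qed
  have "((\<lambda>w. norm (M (z * z - w * w)) * (2 * norm (R z) * norm (R z))) \<longlongrightarrow>
      norm (M (z * z - z * z)) * (2 * norm (R z) * norm (R z))) (at z)"
    by (intro tendsto_intros bounded_linear.tendsto [OF bounded_linear_M])
  then show "((\<lambda>w. norm (M (z * z - w * w)) * (2 * norm (R z) * norm (R z))) \<longlongrightarrow> 0) (at z)" by simp
qed

lemma J_holomorphic_R: "J_holomorphic R regular"
proof (rule J_holomorphic_factorI)
  fix z assume z: "z \<in> regular"
  define K where "K w = - (M (w + z) o\<^sub>L (R w o\<^sub>L R z))" for w
  have "isCont K z"
    unfolding K_def
    by (intro continuous_intros bounded_linear.isCont [OF bounded_linear_M] blinfun_compose.isCont isCont_R z)
  moreover have "eventually (\<lambda>w. R w = R z + (M (w - z) o\<^sub>L K w)) (nhds z)"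
    using eventually_nhds_in_open [OF open_regular z]
  proof (rule eventually_mono)
    fix w assume w: "w \<in> regular"
    have "M (z * z - w * w) = - (M (w - z) o\<^sub>L M (w + z))"
      by (simp add: algebra_simps flip: M_mult M_minus)
    then have "R w - R z = M (w - z) o\<^sub>L K w"
      using R_diff [OF w z] by (simp add: K_def compose_simps compose_assoc)
    then show "R w = R z + (M (w - z) o\<^sub>L K w)" by (simp add: algebra_simps)
  qed
  ultimately show "\<exists>K. isCont K z \<and> eventually (\<lambda>w. R w = R z + (M (w - z) o\<^sub>L K w)) (nhds z)" by blast
qed

text \<open>For large \<open>z\<close> the pencil is a small perturbation of \<open>M (z * z)\<close>.\<close>

lemma R_at_infinity:
  shows "eventually (\<lambda>z. z \<in> regular \<and> norm (R z) \<le> 2 * (1 + norm J) / norm (z * z)) at_infinity"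
proof -
  have "((\<lambda>z :: complex. norm N * ((1 + norm J) * norm (inverse z * inverse z))) \<longlongrightarrow> norm N * ((1 + norm J) * norm (0 * 0 :: complex))) at_infinity"
    by (intro tendsto_intros tendsto_inverse_0)
  then have "eventually (\<lambda>z :: complex. norm N * ((1 + norm J) * norm (inverse z * inverse z)) < 1 / 2) at_infinity"
    by (rule order_tendstoD) simp
  moreover have "eventually (\<lambda>z :: complex. z \<noteq> 0) at_infinity"
    by (rule eventually_not_equal_at_infinity)
  ultimately show ?thesis
  proof eventually_elim
    case (elim z)
    define B where "B = M (inverse (z * z))"
    have B: "mutually_inverse (M (z * z)) B"
      using elim by (simp add: mutually_inverse_def B_def del: inverse_mult_distrib flip: M_mult)
    have norm_B: "norm B \<le> (1 + norm J) * norm (inverse z * inverse z)"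
      using norm_M [of "inverse (z * z)"] by (simp add: B_def)
    have "norm (Q z - M (z * z)) * norm B \<le> norm N * ((1 + norm J) * norm (inverse z * inverse z))"
      unfolding Q_def using mult_left_mono [OF norm_B, of "norm N"] by simp
    also have "\<dots> \<le> 1 / 2" using elim by simp
    finally obtain D where D: "mutually_inverse (Q z) D" "norm D \<le> 2 * norm B"
      using mutually_inverse_perturb [OF B] by blast
    have "norm B \<le> (1 + norm J) * inverse (norm (z * z))"
      using norm_M [of "inverse (z * z)"] by (simp only: B_def norm_inverse)
    then have "2 * norm B \<le> 2 * ((1 + norm J) * inverse (norm (z * z)))" by simp
    then have "2 * norm B \<le> 2 * (1 + norm J) / norm (z * z)" by (simp only: divide_inverse mult.assoc)
    then show ?case using D R_eqI [OF D(1)] by (auto simp: regular_def)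
  qed
qed

lemma bounded_irregular: "bounded (- regular)"
proof -
  obtain b where "\<And>z. b \<le> norm z \<Longrightarrow> z \<in> regular"
    using R_at_infinity unfolding eventually_at_infinity by blast
  then have "- regular \<subseteq> cball 0 b" by (auto simp: not_le) (meson linear)
  then show ?thesis using bounded_cball bounded_subset by blast
qed

text \<open>These are the first coefficients of \<open>R z = z\<^sup>-\<^sup>2 - N z\<^sup>-\<^sup>4 + \<dots>\<close> at infinity.\<close>

lemma tendsto_R_infinity:
  shows "((\<lambda>z. M z o\<^sub>L R z) \<longlongrightarrow> 0) at_infinity"
    and "((\<lambda>z. M z o\<^sub>L (M z o\<^sub>L R z)) \<longlongrightarrow> id_blinfun) at_infinity"
proof -
  have inv: "((\<lambda>z :: complex. inverse (norm z)) \<longlongrightarrow> 0) at_infinity"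
    by (rule tendsto_inverse_0_at_top [OF filterlim_norm_at_top])
  define C where "C = 2 * (1 + norm J)"
  have C: "C \<ge> 0" by (simp add: C_def)
  have bnd: "eventually (\<lambda>z. z \<in> regular \<and> norm (R z) \<le> C * (inverse (norm z) * inverse (norm z)) \<and> z \<noteq> 0) at_infinity"
    using R_at_infinity eventually_not_equal_at_infinity [of 0]
    by eventually_elim (auto simp: C_def norm_mult divide_inverse)
  have "((\<lambda>z :: complex. C * (inverse (norm z) * inverse (norm z))) \<longlongrightarrow> C * (0 * 0)) at_infinity"
    by (intro tendsto_intros inv)
  then have R0: "(R \<longlongrightarrow> 0) at_infinity"
    using bnd by (intro Lim_null_comparison [of R]) (auto elim: eventually_mono)
  show "((\<lambda>z. M z o\<^sub>L R z) \<longlongrightarrow> 0) at_infinity"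
  proof (rule Lim_null_comparison)
    show "eventually (\<lambda>z. norm (M z o\<^sub>L R z) \<le> (1 + norm J) * C * inverse (norm z)) at_infinity"
      using bnd
    proof eventually_elim
      case (elim z)
      have "norm (M z o\<^sub>L R z) \<le> ((1 + norm J) * norm z) * (C * (inverse (norm z) * inverse (norm z)))"
        using elim by (intro order.trans [OF norm_blinfun_compose] mult_mono norm_M) auto
      also have "\<dots> = (1 + norm J) * C * inverse (norm z)" using elim by (simp add: field_simps)
      finally show ?case .
    qed
    show "((\<lambda>z :: complex. (1 + norm J) * C * inverse (norm z)) \<longlongrightarrow> 0) at_infinity"
      by (intro tendsto_mult_right_zero inv)
  qed
  have "((\<lambda>z. id_blinfun - (N o\<^sub>L R z)) \<longlongrightarrow> id_blinfun - (N o\<^sub>L 0)) at_infinity"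
    by (intro tendsto_intros blinfun_compose.tendsto R0)
  then have "((\<lambda>z. id_blinfun - (N o\<^sub>L R z)) \<longlongrightarrow> id_blinfun) at_infinity" by simp
  moreover have "eventually (\<lambda>z. id_blinfun - (N o\<^sub>L R z) = M z o\<^sub>L (M z o\<^sub>L R z)) at_infinity"
    using bnd
  proof eventually_elim
    case (elim z)
    then have "Q z o\<^sub>L R z = id_blinfun" using R by (simp add: mutually_inverse_def)
    then show ?case by (simp add: Q_def compose_simps M_mult compose_assoc algebra_simps)
  qed
  ultimately show "((\<lambda>z. M z o\<^sub>L (M z o\<^sub>L R z)) \<longlongrightarrow> id_blinfun) at_infinity"
    by (rule Lim_transform_eventually)
qed

end


section \<open>Functional calculus of a quadratic pencil\<close>

text \<open>The points where the resolvent does not exist lie in \<open>D\<close>, so the boundary of \<open>D\<close> encircles each of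
them once.\<close>

locale pencil_contour = quadratic_pencil +
  fixes D :: "complex set" and \<Gamma> :: "(real \<Rightarrow> complex) set"
  assumes open_D: "open D" and boundary: "positive_boundary D \<Gamma>" and irregular: "- regular \<subseteq> D"
begin

lemma finite_\<Gamma>: "finite \<Gamma>"
  and winding_in: "z \<in> D \<Longrightarrow> (\<Sum>\<gamma>\<in>\<Gamma>. winding_number \<gamma> z) = 1"
  and winding_out: "z \<notin> closure D \<Longrightarrow> (\<Sum>\<gamma>\<in>\<Gamma>. winding_number \<gamma> z) = 0"
  using boundary unfolding positive_boundary_def by blast+

lemma \<Gamma>_D:
  assumes "\<gamma> \<in> \<Gamma>"
  shows "piecewise_C1_path \<gamma>" "pathfinish \<gamma> = pathstart \<gamma>" "path_image \<gamma> \<subseteq> frontier D"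
  using boundary assms unfolding positive_boundary_def by blast+

lemma frontier_regular: "frontier D \<subseteq> regular"
  using frontier_disjoint_eq [of D] open_D irregular by blast

definition loop_integral :: "(complex \<Rightarrow> 'a \<Rightarrow>\<^sub>L 'a) \<Rightarrow> 'a \<Rightarrow>\<^sub>L 'a" where
  "loop_integral F = M (1 / (2 * pi * \<i>)) o\<^sub>L (\<Sum>\<gamma>\<in>\<Gamma>. contour \<gamma> F)"

lemma loop_integral_cong:
  assumes "\<And>z. z \<in> frontier D \<Longrightarrow> F z = G z"
  shows "loop_integral F = loop_integral G"
proof -
  have "contour \<gamma> F = contour \<gamma> G" if "\<gamma> \<in> \<Gamma>" for \<gamma>
    unfolding contour_def
  proof (rule integral_cong)
    fix t :: real assume "t \<in> {0..1}"
    then have "\<gamma> t \<in> frontier D" using \<Gamma>_D(3) [OF that] by (auto simp: path_image_def)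
    then show "M (path_velocity \<gamma> t) o\<^sub>L F (\<gamma> t) = M (path_velocity \<gamma> t) o\<^sub>L G (\<gamma> t)"
      by (simp add: assms)
  qed
  then show ?thesis by (simp add: loop_integral_def)
qed

lemma continuous_on_boundary_curve:
  assumes "continuous_on (frontier D) F" "\<gamma> \<in> \<Gamma>"
  shows "continuous_on (path_image \<gamma>) F"
  using assms \<Gamma>_D(3) continuous_on_subset by blast

lemma loop_integral_add:
  assumes "continuous_on (frontier D) F" "continuous_on (frontier D) G"
  shows "loop_integral (\<lambda>z. F z + G z) = loop_integral F + loop_integral G"
proof -
  have "(\<Sum>\<gamma>\<in>\<Gamma>. contour \<gamma> (\<lambda>z. F z + G z)) = (\<Sum>\<gamma>\<in>\<Gamma>. contour \<gamma> F + contour \<gamma> G)"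
    using assms by (intro sum.cong refl contour_add continuous_on_boundary_curve \<Gamma>_D)
  then show ?thesis by (simp add: loop_integral_def sum.distrib compose_simps)
qed

lemma loop_integral_diff:
  assumes "continuous_on (frontier D) F" "continuous_on (frontier D) G"
  shows "loop_integral (\<lambda>z. F z - G z) = loop_integral F - loop_integral G"
proof -
  have "(\<Sum>\<gamma>\<in>\<Gamma>. contour \<gamma> (\<lambda>z. F z - G z)) = (\<Sum>\<gamma>\<in>\<Gamma>. contour \<gamma> F - contour \<gamma> G)"
    using assms by (intro sum.cong refl contour_diff continuous_on_boundary_curve \<Gamma>_D)
  then show ?thesis by (simp add: loop_integral_def sum_subtractf compose_simps)
qed

lemma loop_integral_compose_left:
  assumes F: "continuous_on (frontier D) F" and A: "A o\<^sub>L J = J o\<^sub>L A"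
  shows "loop_integral (\<lambda>z. A o\<^sub>L F z) = A o\<^sub>L loop_integral F"
proof -
  have "(\<Sum>\<gamma>\<in>\<Gamma>. contour \<gamma> (\<lambda>z. A o\<^sub>L F z)) = (\<Sum>\<gamma>\<in>\<Gamma>. A o\<^sub>L contour \<gamma> F)"
    using F by (intro sum.cong refl contour_compose_left continuous_on_boundary_curve \<Gamma>_D A)
  then show ?thesis
    using commutes_M [OF A, of "1 / (2 * pi * \<i>)"]
    by (simp only: loop_integral_def blinfun_compose.sum_right [symmetric] compose_assoc [symmetric])
qed

lemma loop_integral_compose_right:
  assumes F: "continuous_on (frontier D) F"
  shows "loop_integral (\<lambda>z. F z o\<^sub>L A) = loop_integral F o\<^sub>L A"
proof -
  have "(\<Sum>\<gamma>\<in>\<Gamma>. contour \<gamma> (\<lambda>z. F z o\<^sub>L A)) = (\<Sum>\<gamma>\<in>\<Gamma>. contour \<gamma> F o\<^sub>L A)"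
    using F by (intro sum.cong refl contour_compose_right continuous_on_boundary_curve \<Gamma>_D)
  then show ?thesis
    by (simp only: loop_integral_def blinfun_compose.sum_left [symmetric] compose_assoc)
qed

lemma loop_integral_commute:
  assumes F: "continuous_on (frontier D) F" and A: "A o\<^sub>L J = J o\<^sub>L A"
    and comm: "\<And>z. z \<in> frontier D \<Longrightarrow> A o\<^sub>L F z = F z o\<^sub>L A"
  shows "A o\<^sub>L loop_integral F = loop_integral F o\<^sub>L A"
  using loop_integral_cong [of "\<lambda>z. A o\<^sub>L F z" "\<lambda>z. F z o\<^sub>L A"] comm loop_integral_compose_left [OF F A] loop_integral_compose_right [OF F, of A]
  by simp

lemma loop_integral_twice:
  assumes F: "continuous_on (frontier D \<times> frontier D) (\<lambda>p. F (fst p) (snd p))"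
  shows "loop_integral (\<lambda>s. loop_integral (\<lambda>p. F s p)) = M (1 / (2 * pi * \<i>)) o\<^sub>L (M (1 / (2 * pi * \<i>)) o\<^sub>L
    (\<Sum>\<gamma>\<in>\<Gamma>. \<Sum>\<delta>\<in>\<Gamma>. contour \<gamma> (\<lambda>s. contour \<delta> (\<lambda>p. F s p))))"
proof -
  have inner: "continuous_on (frontier D) (\<lambda>s. contour \<delta> (\<lambda>p. F s p))" if "\<delta> \<in> \<Gamma>" for \<delta>
    using that \<Gamma>_D by (intro continuous_on_contour_parameter continuous_on_subset [OF F]) auto
  have "loop_integral (\<lambda>s. loop_integral (\<lambda>p. F s p)) = M (1 / (2 * pi * \<i>)) o\<^sub>L loop_integral (\<lambda>s. \<Sum>\<delta>\<in>\<Gamma>. contour \<delta> (\<lambda>p. F s p))"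
    unfolding loop_integral_def [of "F _"]
    by (intro loop_integral_compose_left continuous_on_sum inner commutes_M [OF refl, symmetric])
  moreover have "loop_integral (\<lambda>s. \<Sum>\<delta>\<in>\<Gamma>. contour \<delta> (\<lambda>p. F s p)) = M (1 / (2 * pi * \<i>)) o\<^sub>L
      (\<Sum>\<gamma>\<in>\<Gamma>. \<Sum>\<delta>\<in>\<Gamma>. contour \<gamma> (\<lambda>s. contour \<delta> (\<lambda>p. F s p)))"
    unfolding loop_integral_def
    by (intro arg_cong2 [where f = "(o\<^sub>L)"] sum.cong refl contour_sum finite_\<Gamma> \<Gamma>_D continuous_on_boundary_curve inner)
  ultimately show ?thesis by simp
qed

lemma loop_integral_swap:
  assumes F: "continuous_on (frontier D \<times> frontier D) (\<lambda>p. F (fst p) (snd p))"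
  shows "loop_integral (\<lambda>s. loop_integral (\<lambda>p. F s p)) = loop_integral (\<lambda>p. loop_integral (\<lambda>s. F s p))"
proof -
  have F': "continuous_on (frontier D \<times> frontier D) (\<lambda>p. F (snd p) (fst p))"
    by (rule continuous_on_compose2 [OF F, of _ "\<lambda>p. (snd p, fst p)", simplified])
      (auto intro!: continuous_intros)
  have "(\<Sum>\<gamma>\<in>\<Gamma>. \<Sum>\<delta>\<in>\<Gamma>. contour \<gamma> (\<lambda>s. contour \<delta> (\<lambda>p. F s p))) =
      (\<Sum>\<gamma>\<in>\<Gamma>. \<Sum>\<delta>\<in>\<Gamma>. contour \<delta> (\<lambda>p. contour \<gamma> (\<lambda>s. F s p)))"
    using \<Gamma>_D by (intro sum.cong refl contour_swap continuous_on_subset [OF F]) blast+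
  also have "\<dots> = (\<Sum>\<delta>\<in>\<Gamma>. \<Sum>\<gamma>\<in>\<Gamma>. contour \<delta> (\<lambda>p. contour \<gamma> (\<lambda>s. F s p)))"
    by (rule sum.swap)
  finally show ?thesis using loop_integral_twice [OF F] loop_integral_twice [OF F'] by simp
qed

lemma loop_integral_Cauchy:
  assumes "open W" "closure D \<subseteq> W" "J_holomorphic F W"
  shows "loop_integral F = 0"
proof -
  have "(\<Sum>\<gamma>\<in>\<Gamma>. contour \<gamma> F) = 0"
  proof (rule Cauchy_theorem_cycle_operator [OF assms(1,3) finite_\<Gamma>])
    show "piecewise_C1_path \<gamma> \<and> pathfinish \<gamma> = pathstart \<gamma> \<and> path_image \<gamma> \<subseteq> W" if "\<gamma> \<in> \<Gamma>" for \<gamma>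
      using \<Gamma>_D [OF that] assms(2) by (auto simp: frontier_def)
    show "(\<Sum>\<gamma>\<in>\<Gamma>. winding_number \<gamma> z) = 0" if "z \<notin> W" for z
      using that assms(2) by (intro winding_out) auto
  qed
  then show ?thesis by (simp add: loop_integral_def)
qed

lemma loop_integral_around_everything:
  assumes F: "J_holomorphic F regular" and lim: "((\<lambda>z. M z o\<^sub>L F z) \<longlongrightarrow> C) at_infinity"
  shows "loop_integral F = C"
proof -
  have "(\<Sum>\<gamma>\<in>\<Gamma>. contour \<gamma> F) = M (2 * pi * \<i>) o\<^sub>L C"
  proof (rule contour_around_everything_operator [OF open_regular F finite_\<Gamma> bounded_irregular _ _ lim])
    show "piecewise_C1_path \<gamma> \<and> pathfinish \<gamma> = pathstart \<gamma> \<and> path_image \<gamma> \<subseteq> regular" if "\<gamma> \<in> \<Gamma>" for \<gamma>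
      using \<Gamma>_D [OF that] frontier_regular by auto
    show "(\<Sum>\<gamma>\<in>\<Gamma>. winding_number \<gamma> z) = 1" if "z \<notin> regular" for z
      using that irregular by (intro winding_in) auto
  qed
  then have "loop_integral F = (M (1 / (2 * pi * \<i>)) o\<^sub>L M (2 * pi * \<i>)) o\<^sub>L C" by (simp add: loop_integral_def compose_assoc)
  then show ?thesis by (simp flip: M_mult)
qed

lemma J_holomorphic_MR: "J_holomorphic (\<lambda>z. M z o\<^sub>L R z) regular"
  by (intro J_holomorphic_compose J_holomorphic_R J_holomorphic_M [OF holomorphic_on_ident open_regular] commutes_M [OF refl, symmetric])

lemma loop_integral_R: "loop_integral R = 0"
  by (rule loop_integral_around_everything [OF J_holomorphic_R tendsto_R_infinity(1)])

lemma loop_integral_MR: "loop_integral (\<lambda>z. M z o\<^sub>L R z) = id_blinfun"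
  by (rule loop_integral_around_everything [OF J_holomorphic_MR tendsto_R_infinity(2)])

lemma continuous_on_R: "continuous_on (frontier D) R"
  using J_holomorphic_imp_continuous_on [OF J_holomorphic_R] frontier_regular by (rule continuous_on_subset)

lemma loop_integral_J:
  assumes "continuous_on (frontier D) F" "\<And>z. z \<in> frontier D \<Longrightarrow> F z o\<^sub>L J = J o\<^sub>L F z"
  shows "loop_integral F o\<^sub>L J = J o\<^sub>L loop_integral F"
  using assms by (intro loop_integral_commute [symmetric]) auto

lemma loop_integral_minus:
  assumes "continuous_on (frontier D) F"
  shows "loop_integral (\<lambda>z. - F z) = - loop_integral F"
  using loop_integral_compose_left [OF assms, of "- id_blinfun"] by (simp add: compose_simps)

lemma R_R:
  assumes "s \<in> regular" "p \<in> regular"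
  shows "R p o\<^sub>L R s = R s o\<^sub>L R p"
  using R_commute [OF assms(1), of "R p"] R_commute [OF assms(2), of N] R_J [OF assms(2)]
  by (simp add: N_J)

text \<open>The Leibniz rule.  With \<open>A p = X\<^sub>0 p + X\<^sub>1 = \<integral> \<phi>(s) (s + p) R s ds\<close> and \<open>\<integral> (s + p) R s ds = 1\<close>, the
resolvent equation turns \<open>(A p - \<phi> p) R p\<close> into \<open>\<integral> q(s, p) (R p - R s) ds\<close>, where \<open>q\<close> is the divided
difference of \<open>\<phi>\<close>.  The term with \<open>R p\<close> vanishes by Cauchy's theorem in \<open>s\<close>.  After multiplication by
\<open>G p\<close> and integration over \<open>p\<close> the other term vanishes as well, by Cauchy's theorem in \<open>p\<close>.\<close>

theorem loop_integral_product:
  assumes W: "open W" "closure D \<subseteq> W" and \<phi>: "\<phi> holomorphic_on W" and G: "J_holomorphic G W"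
  shows "(loop_integral (\<lambda>z. M (\<phi> z) o\<^sub>L R z) o\<^sub>L loop_integral (\<lambda>z. M z o\<^sub>L (R z o\<^sub>L G z))) +
      (loop_integral (\<lambda>z. M (\<phi> z) o\<^sub>L (M z o\<^sub>L R z)) o\<^sub>L loop_integral (\<lambda>z. R z o\<^sub>L G z)) =
    loop_integral (\<lambda>z. M (\<phi> z) o\<^sub>L (R z o\<^sub>L G z))"
proof -
  define X0 where "X0 = loop_integral (\<lambda>z. M (\<phi> z) o\<^sub>L R z)"
  define X1 where "X1 = loop_integral (\<lambda>z. M (\<phi> z) o\<^sub>L (M z o\<^sub>L R z))"
  define dd where "dd = divdiff \<phi>"
  have reg: "z \<in> regular" if "z \<in> frontier D" for z using that frontier_regular by blast
  have sub: "frontier D \<subseteq> W" using W(2) by (auto simp: frontier_def)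
  have c\<phi>: "continuous_on (frontier D) \<phi>"
    using holomorphic_on_imp_continuous_on [OF \<phi>] sub by (rule continuous_on_subset)
  have cG: "continuous_on (frontier D) G"
    using J_holomorphic_imp_continuous_on [OF G] sub by (rule continuous_on_subset)
  note cont = continuous_intros continuous_on_R c\<phi> cG
  have dd_hol: "(\<lambda>s. dd s p) holomorphic_on W" "dd p holomorphic_on W" for p
  proof -
    have "divdiff \<phi> p = (\<lambda>s. divdiff \<phi> s p)" by (rule ext) (rule divdiff_commute)
    then show "(\<lambda>s. dd s p) holomorphic_on W" "dd p holomorphic_on W"
      using holomorphic_divdiff_left [OF \<phi> W(1), of p] by (simp_all add: dd_def)
  qed
  have cdd: "continuous_on (frontier D) (\<lambda>s. dd s p)" for p
    using holomorphic_on_imp_continuous_on [OF dd_hol(1)] sub by (rule continuous_on_subset)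
  have cdd2: "continuous_on (frontier D \<times> frontier D) (\<lambda>x. dd (fst x) (snd x))"
    unfolding dd_def
    by (rule continuous_on_subset [OF continuous_on_divdiff [OF \<phi> W(1)]]) (use sub in auto)
  have X0_J: "X0 o\<^sub>L J = J o\<^sub>L X0" and X1_J: "X1 o\<^sub>L J = J o\<^sub>L X1"
    unfolding X0_def X1_def
    by (intro loop_integral_J cont; simp add: compose_assoc R_J [OF reg] M_J_left)+
  have eq: "((X0 o\<^sub>L M p) + X1 - M (\<phi> p)) o\<^sub>L R p = loop_integral (\<lambda>s. - (M (dd s p) o\<^sub>L R s))"
    if p: "p \<in> frontier D" for p
  proof -
    have "(X0 o\<^sub>L M p) + X1 - M (\<phi> p) =
        (X0 o\<^sub>L M p) + X1 - (M (\<phi> p) o\<^sub>L (loop_integral (\<lambda>s. M s o\<^sub>L R s) + (M p o\<^sub>L loop_integral R)))"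
      by (simp add: loop_integral_R loop_integral_MR)
    \<comment> \<open>All terms are collected under one integral over \<open>s\<close>.\<close>
    also have "\<dots> = loop_integral (\<lambda>s. (((M (\<phi> s) o\<^sub>L R s) o\<^sub>L M p) + (M (\<phi> s) o\<^sub>L (M s o\<^sub>L R s)))
        - (M (\<phi> p) o\<^sub>L ((M s o\<^sub>L R s) + (M p o\<^sub>L R s))))"
      unfolding X0_def X1_def
      by (subst loop_integral_diff loop_integral_add loop_integral_compose_left loop_integral_compose_right; (intro cont M_J)?)+ simp
    also have "\<dots> = loop_integral (\<lambda>s. M (\<phi> s - \<phi> p) o\<^sub>L (M (s + p) o\<^sub>L R s))"
      by (rule loop_integral_cong)
        (simp add: compose_simps M_add M_diff compose_assoc commutes_M [OF R_J [OF reg]] M_commute_left [of p])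
    finally have "((X0 o\<^sub>L M p) + X1 - M (\<phi> p)) o\<^sub>L R p =
        loop_integral (\<lambda>s. (M (\<phi> s - \<phi> p) o\<^sub>L (M (s + p) o\<^sub>L R s)) o\<^sub>L R p)"
      by (simp add: loop_integral_compose_right cont)
    \<comment> \<open>The resolvent equation supplies the factor \<open>s - p\<close> that turns the divided difference into \<open>\<phi> s - \<phi> p\<close>.\<close>
    also have "\<dots> = loop_integral (\<lambda>s. (M (dd s p) o\<^sub>L R p) - (M (dd s p) o\<^sub>L R s))"
    proof (rule loop_integral_cong)
      fix s assume s: "s \<in> frontier D"
      have "(M (dd s p) o\<^sub>L R p) - (M (dd s p) o\<^sub>L R s) = M (dd s p) o\<^sub>L (M (s * s - p * p) o\<^sub>L (R p o\<^sub>L R s))"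
        using R_diff [OF reg [OF p] reg [OF s]] by (simp flip: blinfun_compose.diff_right)
      also have "\<dots> = M ((s - p) * dd s p * (s + p)) o\<^sub>L (R s o\<^sub>L R p)"
        by (simp add: R_R [OF reg [OF s] reg [OF p]] algebra_simps flip: compose_assoc M_mult)
      also have "\<dots> = (M (\<phi> s - \<phi> p) o\<^sub>L (M (s + p) o\<^sub>L R s)) o\<^sub>L R p"
        by (simp add: dd_def divdiff_mult M_mult compose_assoc)
      finally show "(M (\<phi> s - \<phi> p) o\<^sub>L (M (s + p) o\<^sub>L R s)) o\<^sub>L R p =
          (M (dd s p) o\<^sub>L R p) - (M (dd s p) o\<^sub>L R s)" ..
    qed
    also have "\<dots> = (loop_integral (\<lambda>s. M (dd s p)) o\<^sub>L R p) - loop_integral (\<lambda>s. M (dd s p) o\<^sub>L R s)"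
      by (subst loop_integral_diff loop_integral_compose_right; (intro cont cdd)?)+ simp
    also have "loop_integral (\<lambda>s. M (dd s p)) = 0"
      by (rule loop_integral_Cauchy [OF W J_holomorphic_M [OF dd_hol(1) W(1)]])
    finally show ?thesis by (simp add: loop_integral_minus cont cdd)
  qed
  have "(X0 o\<^sub>L loop_integral (\<lambda>z. M z o\<^sub>L (R z o\<^sub>L G z))) + (X1 o\<^sub>L loop_integral (\<lambda>z. R z o\<^sub>L G z)) - loop_integral (\<lambda>z. M (\<phi> z) o\<^sub>L (R z o\<^sub>L G z)) =
    loop_integral (\<lambda>z. ((X0 o\<^sub>L (M z o\<^sub>L (R z o\<^sub>L G z))) + (X1 o\<^sub>L (R z o\<^sub>L G z))) - (M (\<phi> z) o\<^sub>L (R z o\<^sub>L G z)))"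
    by (subst loop_integral_diff loop_integral_add loop_integral_compose_left; (intro cont X0_J X1_J)?)+ simp
  also have "\<dots> = loop_integral (\<lambda>p. loop_integral (\<lambda>s. - (M (dd s p) o\<^sub>L R s) o\<^sub>L G p))"
  proof (rule loop_integral_cong)
    \<comment> \<open>The factor in front of \<open>G p\<close> is the one computed in \<open>eq\<close>.\<close>
    fix p assume p: "p \<in> frontier D"
    have "(X0 o\<^sub>L (M p o\<^sub>L (R p o\<^sub>L G p))) + (X1 o\<^sub>L (R p o\<^sub>L G p)) - (M (\<phi> p) o\<^sub>L (R p o\<^sub>L G p)) =
        (((X0 o\<^sub>L M p) + X1 - M (\<phi> p)) o\<^sub>L R p) o\<^sub>L G p"
      by (simp add: compose_simps compose_assoc)
    then show "(X0 o\<^sub>L (M p o\<^sub>L (R p o\<^sub>L G p))) + (X1 o\<^sub>L (R p o\<^sub>L G p)) - (M (\<phi> p) o\<^sub>L (R p o\<^sub>L G p)) =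
        loop_integral (\<lambda>s. - (M (dd s p) o\<^sub>L R s) o\<^sub>L G p)"
      by (simp add: eq [OF p] loop_integral_compose_right cont cdd)
  qed
  also have "\<dots> = loop_integral (\<lambda>s. loop_integral (\<lambda>p. - (M (dd s p) o\<^sub>L R s) o\<^sub>L G p))"
    by (rule loop_integral_swap [symmetric])
      (intro continuous_intros cdd2 continuous_on_compose2 [OF continuous_on_R] continuous_on_compose2 [OF cG]; auto)
  also have "\<dots> = loop_integral (\<lambda>s. 0)"
  proof (rule loop_integral_cong)
    fix s assume s: "s \<in> frontier D"
    have "loop_integral (\<lambda>p. - (M (dd s p) o\<^sub>L R s) o\<^sub>L G p) = loop_integral (\<lambda>p. - R s o\<^sub>L (M (dd s p) o\<^sub>L G p))"
      by (simp add: compose_simps compose_assoc commutes_M [OF R_J [OF reg [OF s]], symmetric] flip: compose_assoc)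
    also have "\<dots> = - R s o\<^sub>L loop_integral (\<lambda>p. M (dd s p) o\<^sub>L G p)"
      by (rule loop_integral_compose_left)
        (use R_J [OF reg [OF s]] in
          \<open>auto simp: compose_simps intro!: cont continuous_on_subset [OF holomorphic_on_imp_continuous_on [OF dd_hol(2)] sub]\<close>)
    also have "loop_integral (\<lambda>p. M (dd s p) o\<^sub>L G p) = 0"
      by (intro loop_integral_Cauchy [OF W] J_holomorphic_compose J_holomorphic_M [OF dd_hol(2) W(1)] M_J G)
    finally show "loop_integral (\<lambda>p. - (M (dd s p) o\<^sub>L R s) o\<^sub>L G p) = 0" by simp
  qed
  also have "\<dots> = 0" by (simp add: loop_integral_def contour_def)
  finally show ?thesis by (simp add: X0_def X1_def)
qed

text \<open>An operator that anticommutes with \<open>J\<close> conjugates the complex numbers that it passes.\<close>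

lemma R_anticommute:
  assumes z: "z \<in> regular" "cnj z \<in> regular" and K: "K o\<^sub>L J = - (J o\<^sub>L K)" "K o\<^sub>L N = N o\<^sub>L K"
  shows "K o\<^sub>L R z = R (cnj z) o\<^sub>L K"
proof (rule mutually_inverse_commute [OF R [OF z(1)] _ R [OF z(2)]])
  show "K o\<^sub>L Q z = Q (cnj z) o\<^sub>L K"
    using K by (simp add: Q_def M_def compose_simps)
qed

text \<open>Moving \<open>K\<close> through the integral replaces the curves by their conjugates, and the factor
\<open>1 / (2 \<pi> \<i>)\<close> by its negative.  The curves and their conjugates together have winding number \<open>0\<close> around
all points off the boundary, so Cauchy's theorem compensates the sign.\<close>

theorem loop_integral_intrinsic_commute:
  assumes W: "open W" "closure D \<subseteq> W" and \<phi>: "\<phi> holomorphic_on W"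
    and real: "\<And>z. z \<in> W \<Longrightarrow> \<phi> (cnj z) = cnj (\<phi> z)" and sym: "\<And>z. z \<in> D \<Longrightarrow> cnj z \<in> D"
    and K: "K o\<^sub>L J = - (J o\<^sub>L K)" "K o\<^sub>L N = N o\<^sub>L K"
  shows "K o\<^sub>L loop_integral (\<lambda>z. M (\<phi> z) o\<^sub>L R z) = loop_integral (\<lambda>z. M (\<phi> z) o\<^sub>L R z) o\<^sub>L K"
proof -
  define F where "F z = M (\<phi> z) o\<^sub>L R z" for z
  have K_M: "K o\<^sub>L M z = M (cnj z) o\<^sub>L K" for z
    using K(1) by (simp add: M_def compose_simps)
  have sym': "cnj z \<in> D \<longleftrightarrow> z \<in> D" for z using sym [of z] sym [of "cnj z"] by auto
  have cnj_D: "cnj ` D = D" using sym' by (auto simp: image_iff) (metis complex_cnj_cnj)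
  have "cnj ` closure D = closure (cnj ` D)"
    by (rule closure_injective_linear_image)
      (auto simp: bounded_linear.linear [OF bounded_linear_cnj] inj_def)
  then have cl: "cnj z \<in> closure D \<longleftrightarrow> z \<in> closure D" for z
    unfolding cnj_D by (metis complex_cnj_cnj image_iff)
  have fr: "cnj z \<in> frontier D" if "z \<in> frontier D" for z
    using that cl sym' open_D by (simp add: frontier_def interior_open)
  have reg: "z \<in> regular" if "z \<in> frontier D" for z using that frontier_regular by blast
  have sub: "frontier D \<subseteq> W" using W(2) by (auto simp: frontier_def)
  have F: "J_holomorphic F (W \<inter> regular)"
    unfolding F_def using \<phi> W(1) open_regular
    by (intro J_holomorphic_compose J_holomorphic_M M_J J_holomorphic_subset [OF J_holomorphic_R])
      (auto intro: holomorphic_on_subset)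
  have F_cont: "continuous_on (frontier D) F"
    using J_holomorphic_imp_continuous_on [OF F] by (rule continuous_on_subset) (use sub frontier_regular in auto)
  have K_F: "K o\<^sub>L F z = F (cnj z) o\<^sub>L K" if z: "z \<in> frontier D" for z
  proof -
    have "K o\<^sub>L F z = M (cnj (\<phi> z)) o\<^sub>L (K o\<^sub>L R z)"
      by (simp only: F_def K_M compose_assoc [symmetric])
    also have "\<dots> = M (\<phi> (cnj z)) o\<^sub>L (R (cnj z) o\<^sub>L K)"
      using R_anticommute [OF reg [OF z] reg [OF fr [OF z]] K] real [of z] sub z by auto
    finally show ?thesis by (simp add: F_def compose_assoc)
  qed
  have contour: "K o\<^sub>L contour \<gamma> F = contour (cnj \<circ> \<gamma>) F o\<^sub>L K" if \<gamma>: "\<gamma> \<in> \<Gamma>" for \<gamma>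
  proof -
    have cnj_\<gamma>: "piecewise_C1_path (cnj \<circ> \<gamma>)" by (rule piecewise_C1_path_cnj [OF \<Gamma>_D(1) [OF \<gamma>]])
    have "path_image (cnj \<circ> \<gamma>) \<subseteq> frontier D"
      using \<Gamma>_D(3) [OF \<gamma>] fr by (auto simp: path_image_def)
    then have cont: "continuous_on (path_image (cnj \<circ> \<gamma>)) F" using F_cont continuous_on_subset by blast
    have "((\<lambda>t. K o\<^sub>L (M (path_velocity \<gamma> t) o\<^sub>L F (\<gamma> t))) has_integral K o\<^sub>L contour \<gamma> F) {0..1}"
      using has_integral_linear [OF has_integral_contour [OF \<Gamma>_D(1) [OF \<gamma>] continuous_on_boundary_curve [OF F_cont \<gamma>]]
          blinfun_compose.bounded_linear_right [of K]] by (simp add: o_def)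
    moreover have "K o\<^sub>L (M (path_velocity \<gamma> t) o\<^sub>L F (\<gamma> t)) = M (cnj (path_velocity \<gamma> t)) o\<^sub>L F (cnj (\<gamma> t)) o\<^sub>L K"
      if "t \<in> {0..1}" for t
    proof -
      have "\<gamma> t \<in> frontier D" using \<Gamma>_D(3) [OF \<gamma>] that by (auto simp: path_image_def)
      then have "K o\<^sub>L F (\<gamma> t) = F (cnj (\<gamma> t)) o\<^sub>L K" by (rule K_F)
      then show ?thesis by (simp add: K_M compose_assoc flip: compose_assoc [of K])
    qed
    ultimately have "((\<lambda>t. M (cnj (path_velocity \<gamma> t)) o\<^sub>L F (cnj (\<gamma> t)) o\<^sub>L K) has_integral K o\<^sub>L contour \<gamma> F) {0..1}"
      by (rule has_integral_eq [rotated])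
    then have "K o\<^sub>L contour \<gamma> F = contour (cnj \<circ> \<gamma>) (\<lambda>z. F z o\<^sub>L K)"
      using contour_cnj [OF \<Gamma>_D(1) [OF \<gamma>], of "\<lambda>z. F z o\<^sub>L K"] by (simp add: integral_unique compose_assoc)
    then show ?thesis using contour_compose_right [OF cnj_\<gamma> cont] by simp
  qed
  \<comment> \<open>The disjoint sum indexes the curves and their conjugates; a curve may occur in both roles.\<close>
  have "(\<Sum>i\<in>\<Gamma> <+> \<Gamma>. contour (case_sum (\<lambda>\<gamma>. \<gamma>) (\<lambda>\<gamma>. cnj \<circ> \<gamma>) i) F) = 0"
  proof (rule Cauchy_theorem_cycle_operator [OF open_Int [OF W(1) open_regular] F])
    show "finite (\<Gamma> <+> \<Gamma>)" using finite_\<Gamma> by simp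
    show "piecewise_C1_path (case_sum (\<lambda>\<gamma>. \<gamma>) (\<lambda>\<gamma>. cnj \<circ> \<gamma>) i) \<and>
        pathfinish (case_sum (\<lambda>\<gamma>. \<gamma>) (\<lambda>\<gamma>. cnj \<circ> \<gamma>) i) = pathstart (case_sum (\<lambda>\<gamma>. \<gamma>) (\<lambda>\<gamma>. cnj \<circ> \<gamma>) i) \<and>
        path_image (case_sum (\<lambda>\<gamma>. \<gamma>) (\<lambda>\<gamma>. cnj \<circ> \<gamma>) i) \<subseteq> W \<inter> regular" if "i \<in> \<Gamma> <+> \<Gamma>" for i
    proof (cases i)
      case (Inl \<gamma>)
      then have "\<gamma> \<in> \<Gamma>" using that by auto
      then show ?thesis using \<Gamma>_D [of \<gamma>] sub frontier_regular Inl by auto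
    next
      case (Inr \<gamma>)
      then have \<gamma>: "\<gamma> \<in> \<Gamma>" using that by auto
      then have "path_image (cnj \<circ> \<gamma>) \<subseteq> frontier D"
        using \<Gamma>_D(3) [OF \<gamma>] fr by (auto simp: path_image_def)
      then show ?thesis using \<Gamma>_D [OF \<gamma>] sub frontier_regular Inr
        by (auto simp: piecewise_C1_path_cnj pathstart_def pathfinish_def)
    qed
    fix z assume z: "z \<notin> W \<inter> regular"
    then have nf: "z \<notin> frontier D" using sub frontier_regular by auto
    have "winding_number (cnj \<circ> \<gamma>) z = - cnj (winding_number \<gamma> (cnj z))" if "\<gamma> \<in> \<Gamma>" for \<gamma>
    proof -
      have "cnj z \<notin> path_image \<gamma>" using nf fr [of "cnj z"] \<Gamma>_D(3) [OF that] by auto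
      then show ?thesis
        using winding_number_cnj [of \<gamma> "cnj z"] \<Gamma>_D(1) [OF that] by (simp add: piecewise_C1_path_def)
    qed
    then have "(\<Sum>i\<in>\<Gamma> <+> \<Gamma>. winding_number (case_sum (\<lambda>\<gamma>. \<gamma>) (\<lambda>\<gamma>. cnj \<circ> \<gamma>) i) z) =
        (\<Sum>\<gamma>\<in>\<Gamma>. winding_number \<gamma> z) - cnj (\<Sum>\<gamma>\<in>\<Gamma>. winding_number \<gamma> (cnj z))"
      using finite_\<Gamma> by (simp add: sum.Plus sum_negf)
    also have "\<dots> = 0"
    proof (cases "z \<in> D")
      case True
      then show ?thesis using winding_in sym by simp
    next
      case False
      then have "z \<notin> closure D" using nf open_D by (simp add: frontier_def interior_open)
      then show ?thesis using winding_out cl by simp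
    qed
    finally show "(\<Sum>i\<in>\<Gamma> <+> \<Gamma>. winding_number (case_sum (\<lambda>\<gamma>. \<gamma>) (\<lambda>\<gamma>. cnj \<circ> \<gamma>) i) z) = 0" .
  qed
  then have sum: "(\<Sum>\<gamma>\<in>\<Gamma>. contour (cnj \<circ> \<gamma>) F) = - (\<Sum>\<gamma>\<in>\<Gamma>. contour \<gamma> F)"
    using finite_\<Gamma> by (simp add: sum.Plus add_eq_0_iff)
  have "K o\<^sub>L loop_integral F = M (cnj (1 / (2 * pi * \<i>))) o\<^sub>L (\<Sum>\<gamma>\<in>\<Gamma>. K o\<^sub>L contour \<gamma> F)"
    by (simp add: loop_integral_def blinfun_compose.sum_right compose_assoc [symmetric] K_M)
  also have "\<dots> = M (cnj (1 / (2 * pi * \<i>))) o\<^sub>L ((\<Sum>\<gamma>\<in>\<Gamma>. contour (cnj \<circ> \<gamma>) F) o\<^sub>L K)"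
    by (simp add: contour blinfun_compose.sum_left)
  also have "\<dots> = M (- cnj (1 / (2 * pi * \<i>))) o\<^sub>L ((\<Sum>\<gamma>\<in>\<Gamma>. contour \<gamma> F) o\<^sub>L K)"
    by (simp only: sum M_minus compose_simps minus_minus)
  also have "- cnj (1 / (2 * pi * \<i>)) = 1 / (2 * pi * \<i>)" by simp
  finally have "K o\<^sub>L loop_integral F = loop_integral F o\<^sub>L K" by (simp add: loop_integral_def compose_assoc)
  then show ?thesis unfolding F_def [abs_def] .
qed

text \<open>An operator is the sum of a part that commutes with \<open>J\<close> and a part that anticommutes with \<open>J\<close>, up
to the factor 2 the operators \<open>B\<close> and \<open>K\<close> of the proof.\<close>

theorem loop_integral_intrinsic_commute_all:
  assumes W: "open W" "closure D \<subseteq> W" and \<phi>: "\<phi> holomorphic_on W"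
    and real: "\<And>z. z \<in> W \<Longrightarrow> \<phi> (cnj z) = cnj (\<phi> z)" and sym: "\<And>z. z \<in> D \<Longrightarrow> cnj z \<in> D"
    and A: "A o\<^sub>L N = N o\<^sub>L A"
  shows "A o\<^sub>L loop_integral (\<lambda>z. M (\<phi> z) o\<^sub>L R z) = loop_integral (\<lambda>z. M (\<phi> z) o\<^sub>L R z) o\<^sub>L A"
proof -
  define B where "B = A - (J o\<^sub>L (A o\<^sub>L J))"
  define K where "K = A + (J o\<^sub>L (A o\<^sub>L J))"
  have NJ_left: "J o\<^sub>L (N o\<^sub>L X) = N o\<^sub>L (J o\<^sub>L X)" for X by (simp add: N_J flip: compose_assoc)
  have NA_left: "A o\<^sub>L (N o\<^sub>L X) = N o\<^sub>L (A o\<^sub>L X)" for X by (simp add: A flip: compose_assoc)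
  have B: "B o\<^sub>L J = J o\<^sub>L B" "B o\<^sub>L N = N o\<^sub>L B"
    by (simp_all add: B_def compose_simps compose_assoc J_square J_J A N_J NA_left NJ_left flip: N_J)
  have K: "K o\<^sub>L J = - (J o\<^sub>L K)" "K o\<^sub>L N = N o\<^sub>L K"
    by (simp_all add: K_def compose_simps compose_assoc J_square J_J A N_J NA_left NJ_left flip: N_J)
  have reg: "z \<in> regular" if "z \<in> frontier D" for z using that frontier_regular by blast
  have sub: "frontier D \<subseteq> W" using W(2) by (auto simp: frontier_def)
  have cont: "continuous_on (frontier D) (\<lambda>z. M (\<phi> z) o\<^sub>L R z)"
    by (intro continuous_intros continuous_on_R continuous_on_subset [OF holomorphic_on_imp_continuous_on [OF \<phi>] sub])
  define X where "X = loop_integral (\<lambda>z. M (\<phi> z) o\<^sub>L R z)"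
  have "B o\<^sub>L X = X o\<^sub>L B"
    unfolding X_def
  proof (rule loop_integral_commute [OF cont B(1)])
    fix z assume "z \<in> frontier D"
    then show "B o\<^sub>L (M (\<phi> z) o\<^sub>L R z) = (M (\<phi> z) o\<^sub>L R z) o\<^sub>L B"
      using R_commute [OF reg B] commutes_M [OF B(1)] by (metis compose_assoc)
  qed
  moreover have "K o\<^sub>L X = X o\<^sub>L K"
    unfolding X_def by (rule loop_integral_intrinsic_commute [OF W \<phi> real sym K])
  moreover have "A = (1 / 2) *\<^sub>R (B + K)" by (simp add: B_def K_def)
  ultimately have "A o\<^sub>L X = X o\<^sub>L A" by (simp add: compose_simps)
  then show ?thesis by (simp add: X_def)
qed

end


section \<open>Operators on the Clifford module\<close>

lemma bounded_linear_left_mult: "bounded_linear (left_mult :: cliff \<Rightarrow> 'v::real_normed_vector cliffop)"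
proof -
  have "linear (left_mult :: cliff \<Rightarrow> 'v cliffop)"
  proof (rule linearI)
    fix a b :: cliff and r :: real
    show "left_mult (a + b) = (left_mult a + left_mult b :: 'v cliffop)"
      by (rule blinfun_eqI)
        (simp add: left_mult.rep_eq blinfun.add_left clmul_def distrib_left scaleR_add_left axis_add sum.distrib)
    show "left_mult (r *\<^sub>R a) = (r *\<^sub>R left_mult a :: 'v cliffop)"
    proof (rule blinfun_eqI)
      fix v :: "'v cliffmod"
      have "axis A ((clsign B C * (r * x)) *\<^sub>R w) = r *\<^sub>R axis A ((clsign B C * x) *\<^sub>R w)" for A B C :: "5 set" and x and w :: 'v
        by (simp add: vec_eq_iff axis_def mult_ac)
      then show "left_mult (r *\<^sub>R a) v = (r *\<^sub>R left_mult a :: 'v cliffop) v"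
        by (simp add: left_mult.rep_eq blinfun.scaleR_left clmul_def scaleR_sum_right)
    qed
  qed
  then show ?thesis by (simp add: linear_conv_bounded_linear)
qed

lemma left_mult_clmul: "left_mult (a \<star> b) = left_mult a o\<^sub>L left_mult b"
  by (rule blinfun_eqI) (simp add: left_mult.rep_eq clmul_assoc)

lemma left_mult_one: "left_mult (cl_basis {}) = id_blinfun"
  by (rule blinfun_eqI) (simp add: left_mult.rep_eq cl_basis_empty_left)

lemmas left_mult_linear =
  linear_add [OF bounded_linear.linear [OF bounded_linear_left_mult]]
  linear_scale [OF bounded_linear.linear [OF bounded_linear_left_mult]]
  linear_neg [OF bounded_linear.linear [OF bounded_linear_left_mult]]
  linear_sum [OF bounded_linear.linear [OF bounded_linear_left_mult]]
  linear_0 [OF bounded_linear.linear [OF bounded_linear_left_mult]]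

text \<open>The module is spanned by the multiples of the basis elements \<open>e\<^sub>A\<close>.\<close>

lemma cliffmod_op_eqI:
  fixes A B :: "'v::real_normed_vector cliffop"
  assumes "\<And>C x. A (axis C x) = B (axis C x)"
  shows "A = B"
proof (rule blinfun_eqI)
  fix v :: "'v cliffmod"
  have "A (\<Sum>C\<in>UNIV. axis C (v $ C)) = B (\<Sum>C\<in>UNIV. axis C (v $ C))"
    by (simp add: blinfun.sum_right assms)
  then show "A v = B v" by (simp flip: cl_axis_sum)
qed

lemma left_mult_axis: "left_mult (axis A r) (axis B x) = axis (sym_diff A B) ((clsign A B * r) *\<^sub>R x)"
  by (simp add: left_mult.rep_eq clmul_axis_axis)

lemma extend_op_axis: "extend_op B (axis A x) = axis A (B x)"
  by (auto simp: vec_eq_iff extend_op_nth axis_def blinfun.zero_right)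

lemma extend_op_compose: "extend_op A o\<^sub>L extend_op B = extend_op (A o\<^sub>L B)"
  by (rule cliffmod_op_eqI) (simp add: extend_op_axis)

lemma extend_op_minus: "extend_op (- B) = - extend_op B"
  by (rule blinfun_eqI) (simp add: vec_eq_iff extend_op_nth blinfun.minus_left)

lemma extend_op_zero: "extend_op 0 = 0"
  by (rule blinfun_eqI) (simp add: vec_eq_iff extend_op_nth)

lemma coeff_op_minus: "coeff_op (- T) A = - coeff_op T A"
  by (rule blinfun_eqI) (simp add: coeff_op.rep_eq blinfun.minus_left)

lemma conj_op_minus: "conj_op (- T) = - conj_op T"
  by (simp add: conj_op_def coeff_op_minus extend_op_minus compose_simps sum_negf)

lemma left_mult_extend_op: "left_mult a o\<^sub>L extend_op B = extend_op B o\<^sub>L left_mult a"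
proof -
  have *: "left_mult (axis A r) o\<^sub>L extend_op B = extend_op B o\<^sub>L left_mult (axis A r)" for A r
    by (rule cliffmod_op_eqI) (simp add: left_mult_axis extend_op_axis blinfun.scaleR_right)
  have "left_mult (\<Sum>A\<in>UNIV. axis A (a $ A)) o\<^sub>L extend_op B = extend_op B o\<^sub>L left_mult (\<Sum>A\<in>UNIV. axis A (a $ A))"
    by (simp only: left_mult_linear blinfun_compose.sum_left blinfun_compose.sum_right *)
  then show ?thesis by (simp flip: cl_axis_sum)
qed

lemma cl_unit_clifford:
  "(left_mult (cl_unit i) o\<^sub>L left_mult (cl_unit j)) + (left_mult (cl_unit j) o\<^sub>L left_mult (cl_unit i)) =
    (if i = j then (- 2) *\<^sub>R id_blinfun else 0)"
proof (cases "i = j")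
  case True
  have "(- 1 :: real) + - 1 = - 2" by simp
  then have "- id_blinfun + - id_blinfun = ((- 2) *\<^sub>R id_blinfun :: 'a cliffop)"
    by (metis scaleR_left_distrib scaleR_minus1_left)
  then show ?thesis
    using True by (simp add: cl_unit_square left_mult_linear left_mult_one flip: left_mult_clmul)
next
  case False
  then show ?thesis
    by (simp add: cl_unit_anticommute left_mult_linear flip: left_mult_clmul left_mult_linear(1))
qed

lemma left_mult_para: "left_mult (para s) = fst s *\<^sub>R id_blinfun + (\<Sum>j\<in>UNIV. (snd s $ j) *\<^sub>R left_mult (cl_unit j))"
  by (simp add: para_def left_mult_linear left_mult_one)

text \<open>In the square of \<open>\<Sum> E\<^sub>j X\<^sub>j\<close> the terms with \<open>i \<noteq> j\<close> cancel in pairs, because the \<open>E\<^sub>j\<close> anticommute and the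
\<open>X\<^sub>j\<close> commute.\<close>

lemma clifford_square:
  fixes E X :: "5 \<Rightarrow> 'a::real_normed_vector \<Rightarrow>\<^sub>L 'a"
  assumes E: "\<And>i j. (E i o\<^sub>L E j) + (E j o\<^sub>L E i) = (if i = j then (- 2) *\<^sub>R id_blinfun else 0)"
    and EX: "\<And>i j. E i o\<^sub>L X j = X j o\<^sub>L E i" and X: "\<And>i j. X i o\<^sub>L X j = X j o\<^sub>L X i"
  shows "(\<Sum>j\<in>UNIV. E j o\<^sub>L X j) o\<^sub>L (\<Sum>j\<in>UNIV. E j o\<^sub>L X j) = - (\<Sum>j\<in>UNIV. X j o\<^sub>L X j)"
    (is "?S = - ?N")
proof -
  have eq: "(E i o\<^sub>L X i) o\<^sub>L (E j o\<^sub>L X j) = (E i o\<^sub>L E j) o\<^sub>L (X i o\<^sub>L X j)" for i j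
    by (metis EX compose_assoc)
  have S: "?S = (\<Sum>i\<in>UNIV. \<Sum>j\<in>UNIV. (E i o\<^sub>L E j) o\<^sub>L (X i o\<^sub>L X j))"
    by (simp only: blinfun_compose.sum_left blinfun_compose.sum_right eq)
      (rule sum.swap)
  also have "\<dots> = (\<Sum>i\<in>UNIV. \<Sum>j\<in>UNIV. (E j o\<^sub>L E i) o\<^sub>L (X i o\<^sub>L X j))"
    by (subst sum.swap) (simp add: X)
  finally have S': "?S = (\<Sum>i\<in>UNIV. \<Sum>j\<in>UNIV. (E j o\<^sub>L E i) o\<^sub>L (X i o\<^sub>L X j))" .
  have "2 *\<^sub>R ?S = ?S + ?S" by (simp add: scaleR_2)
  also have "\<dots> = (\<Sum>i\<in>UNIV. \<Sum>j\<in>UNIV. ((E i o\<^sub>L E j) + (E j o\<^sub>L E i)) o\<^sub>L (X i o\<^sub>L X j))"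
    by (subst (1) S, subst S') (simp add: sum.distrib compose_simps)
  also have "\<dots> = (\<Sum>i\<in>UNIV. \<Sum>j\<in>UNIV. if i = j then (- 2) *\<^sub>R (X i o\<^sub>L X i) else 0)"
    by (intro sum.cong refl) (simp add: E compose_simps)
  also have "\<dots> = 2 *\<^sub>R (- ?N)" by (simp add: scaleR_sum_right sum_negf)
  finally show ?thesis by (simp only: scaleR_cancel_left) simp
qed

lemma para_unit_square:
  assumes "I \<in> imag_sphere"
  shows "left_mult (para (0, I)) o\<^sub>L left_mult (para (0, I)) = - id_blinfun"
proof -
  define E :: "5 \<Rightarrow> 'a cliffop" where "E j = left_mult (cl_unit j)" for j
  define X :: "5 \<Rightarrow> 'a cliffop" where "X j = (I $ j) *\<^sub>R id_blinfun" for j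
  have "(\<Sum>j\<in>UNIV. E j o\<^sub>L X j) o\<^sub>L (\<Sum>j\<in>UNIV. E j o\<^sub>L X j) = - (\<Sum>j\<in>UNIV. X j o\<^sub>L X j)"
    by (rule clifford_square) (simp_all add: E_def X_def cl_unit_clifford compose_simps)
  moreover have "(\<Sum>j\<in>UNIV. X j o\<^sub>L X j) = (\<Sum>j\<in>UNIV. (I $ j)\<^sup>2) *\<^sub>R id_blinfun"
    by (simp add: X_def compose_simps power2_eq_square scaleR_sum_left)
  moreover have "(\<Sum>j\<in>UNIV. (I $ j)\<^sup>2) = 1"
    using assms by (simp add: imag_sphere_def norm_vec_def L2_set_def)
  ultimately show ?thesis by (simp add: left_mult_para E_def X_def compose_simps)
qed

lemma clmul_right_linear:
  "clmul_right (v + w) a = clmul_right v a + clmul_right w a"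
  "clmul_right (r *\<^sub>R v) a = r *\<^sub>R clmul_right v a"
proof -
  show "clmul_right (v + w) a = clmul_right v a + clmul_right w a"
    by (simp add: clmul_right_def scaleR_add_right axis_add sum.distrib)
  have "axis A ((k * r) *\<^sub>R x) = r *\<^sub>R axis A (k *\<^sub>R x)" for A :: "5 set" and k and x :: 'a
    by (simp add: vec_eq_iff axis_def mult.commute)
  then show "clmul_right (r *\<^sub>R v) a = r *\<^sub>R clmul_right v a"
    by (simp add: clmul_right_def scaleR_sum_right)
qed

lemma right_linear_add: "right_linear A \<Longrightarrow> right_linear B \<Longrightarrow> right_linear (A + B)"
  by (simp add: right_linear_def blinfun.add_left clmul_right_linear)

lemma right_linear_scaleR: "right_linear A \<Longrightarrow> right_linear (r *\<^sub>R A)"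
  by (simp add: right_linear_def blinfun.scaleR_left clmul_right_linear)

lemma right_linear_minus: "right_linear A \<Longrightarrow> right_linear (- A)"
  using right_linear_scaleR [of A "- 1"] by simp

lemma right_linear_zero: "right_linear (0 :: 'v::real_normed_vector cliffop)"
proof -
  have "clmul_right (0 :: 'v cliffmod) a = 0" for a using clmul_right_linear(2) [of 0 0 a] by simp
  then show ?thesis by (simp add: right_linear_def)
qed

lemma right_linear_sum: "(\<And>i. i \<in> S \<Longrightarrow> right_linear (A i)) \<Longrightarrow> right_linear (\<Sum>i\<in>S. A i)"
  by (induction S rule: infinite_finite_induct) (auto simp: right_linear_zero intro: right_linear_add)

lemma right_linear_extend_op: "right_linear (extend_op B)"
  unfolding right_linear_def
proof (intro allI)
  fix v :: "'a cliffmod" and a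
  have "extend_op B (clmul_right (\<Sum>C\<in>UNIV. axis C (v $ C)) (\<Sum>A\<in>UNIV. axis A (a $ A))) =
      clmul_right (extend_op B (\<Sum>C\<in>UNIV. axis C (v $ C))) (\<Sum>A\<in>UNIV. axis A (a $ A))"
    by (simp add: clmul_right_sum_left clmul_right_sum_right blinfun.sum_right clmul_right_axis_axis
        extend_op_axis blinfun.scaleR_right)
  then show "extend_op B (clmul_right v a) = clmul_right (extend_op B v) a" by (simp flip: cl_axis_sum)
qed

text \<open>The inverse of a right-linear bijection is right-linear.\<close>

lemma op_inv_eqI:
  assumes A: "right_linear A" and AB: "mutually_inverse A B"
  shows "op_inv A = B"
  unfolding op_inv_def
proof (rule the_equality)
  have "B (clmul_right v a) = clmul_right (B v) a" for v a
  proof -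
    have cancel: "A (B w) = w" "B (A w) = w" for w
      using AB blinfun_apply_blinfun_compose [of A B w] blinfun_apply_blinfun_compose [of B A w]
      by (simp_all add: mutually_inverse_def)
    have "B (clmul_right (A (B v)) a) = B (A (clmul_right (B v) a))"
      using A by (simp add: right_linear_def)
    then show ?thesis by (simp add: cancel)
  qed
  then show "inverse_pair A B"
    using AB by (simp add: inverse_pair_def mutually_inverse_def right_linear_def)
  show "C = B" if "inverse_pair A C" for C
    using that AB mutually_inverse_unique [of A C B] by (simp add: inverse_pair_def mutually_inverse_def)
qed

text \<open>The automorphism \<open>e\<^sub>j \<mapsto> - e\<^sub>j\<close> of the Clifford algebra, acting on the module.  Conjugation by it sends a
vector operator to its negative.\<close>

lift_definition grade_involution :: "'v::real_normed_vector cliffop" is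
  "\<lambda>v. \<Sum>A\<in>UNIV. axis A ((- 1) ^ card A *\<^sub>R v $ A)"
  by (intro bounded_linear_sum bounded_linear_compose [OF bounded_linear_axis]
      bounded_linear_compose [OF bounded_linear_scaleR_right] bounded_linear_vec_nth)

lemma grade_involution_axis: "grade_involution (axis A x) = axis A ((- 1) ^ card A *\<^sub>R x)"
proof -
  have "grade_involution (axis A x) $ B = axis A ((- 1) ^ card A *\<^sub>R x) $ B" for B
    by (simp add: grade_involution.rep_eq) (simp add: axis_def)
  then show ?thesis by (simp add: vec_eq_iff)
qed

lemma grade_involution_square: "grade_involution o\<^sub>L grade_involution = id_blinfun"
  by (rule cliffmod_op_eqI) (simp add: grade_involution_axis flip: power_add)

lemma grade_involution_extend_op: "grade_involution o\<^sub>L extend_op B = extend_op B o\<^sub>L grade_involution"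
  by (rule cliffmod_op_eqI) (simp add: grade_involution_axis extend_op_axis blinfun.scaleR_right)

lemma grade_involution_cl_unit:
  "grade_involution o\<^sub>L left_mult (cl_unit j) = - (left_mult (cl_unit j) o\<^sub>L grade_involution)"
proof (rule cliffmod_op_eqI)
  fix C :: "5 set" and x :: 'a
  have "(- 1 :: real) ^ card (sym_diff {j} C) = - ((- 1) ^ card C)"
  proof (cases "j \<in> C")
    case True
    then have eq: "sym_diff {j} C = C - {j}" by auto
    have "Suc (card (C - {j})) = card C" using True by (intro card_Suc_Diff1) auto
    then have "(- 1 :: real) ^ card C = - ((- 1) ^ card (C - {j}))" by (metis power_Suc mult_minus1)
    then show ?thesis unfolding eq by simp
  next
    case False
    then have eq: "sym_diff {j} C = insert j C" by auto
    show ?thesis unfolding eq using False by simp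
  qed
  moreover have "axis A (- y) = - axis A y" for A :: "5 set" and y :: 'a
    by (simp add: vec_eq_iff axis_def)
  ultimately show "(grade_involution o\<^sub>L left_mult (cl_unit j)) (axis C x) =
      (- (left_mult (cl_unit j) o\<^sub>L grade_involution)) (axis C x)"
    by (simp add: cl_basis_def grade_involution_axis left_mult_axis blinfun.minus_left mult.commute)
qed

locale vector_operator =
  fixes T :: "'v::banach cliffop" and Ts :: "5 \<Rightarrow> 'v \<Rightarrow>\<^sub>L 'v"
  assumes T_eq: "T = (\<Sum>j\<in>UNIV. left_mult (cl_unit j) o\<^sub>L extend_op (Ts j))"
    and Ts_commute: "\<And>i j. Ts i o\<^sub>L Ts j = Ts j o\<^sub>L Ts i"
begin

lemma T_square: "T o\<^sub>L T = - (\<Sum>j\<in>UNIV. extend_op (Ts j o\<^sub>L Ts j))"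
  using clifford_square [of "\<lambda>j. left_mult (cl_unit j)" "\<lambda>j. extend_op (Ts j)"]
  by (simp add: T_eq cl_unit_clifford left_mult_extend_op extend_op_compose Ts_commute)

lemma T_square_left_mult: "(T o\<^sub>L T) o\<^sub>L left_mult a = left_mult a o\<^sub>L (T o\<^sub>L T)"
  by (simp add: T_square compose_simps blinfun_compose.sum_left blinfun_compose.sum_right left_mult_extend_op)

lemma conj_T: "conj_op T = - T"
proof -
  have "T = paravector_op 0 Ts" by (simp add: T_eq paravector_op_def extend_op_zero)
  then have "coeff_op T {} = 0" "\<And>j. coeff_op T {j} = Ts j"
    by (simp_all only: coeff_op_paravector_op)
  then show ?thesis by (simp add: conj_op_def extend_op_zero T_eq)
qed

lemma right_linear_T_square: "right_linear (T o\<^sub>L T)"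
  unfolding T_square by (intro right_linear_minus right_linear_sum right_linear_extend_op)

text \<open>Conjugation by the grade involution turns \<open>T\<close> into \<open>- T\<close>.\<close>

lemma conjugate_inverse:
  assumes "mutually_inverse ((T o\<^sub>L T) - r *\<^sub>R T + c *\<^sub>R id_blinfun) B"
  shows "\<exists>C. mutually_inverse ((T o\<^sub>L T) + r *\<^sub>R T + c *\<^sub>R id_blinfun) C"
proof -
  define g where "g = (grade_involution :: 'v cliffop)"
  have gg: "g o\<^sub>L g = id_blinfun" unfolding g_def by (rule grade_involution_square)
  then have gg_left: "g o\<^sub>L (g o\<^sub>L X) = X" for X by (simp flip: compose_assoc)
  have gT: "g o\<^sub>L T = - (T o\<^sub>L g)"
  proof -
    have "g o\<^sub>L (left_mult (cl_unit j) o\<^sub>L extend_op (Ts j)) = - ((left_mult (cl_unit j) o\<^sub>L extend_op (Ts j)) o\<^sub>L g)" for j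
    proof -
      have "g o\<^sub>L (left_mult (cl_unit j) o\<^sub>L extend_op (Ts j)) = (g o\<^sub>L left_mult (cl_unit j)) o\<^sub>L extend_op (Ts j)"
        by (simp add: compose_assoc)
      also have "\<dots> = - (left_mult (cl_unit j) o\<^sub>L (g o\<^sub>L extend_op (Ts j)))"
        unfolding g_def grade_involution_cl_unit by (simp add: compose_simps compose_assoc)
      also have "\<dots> = - ((left_mult (cl_unit j) o\<^sub>L extend_op (Ts j)) o\<^sub>L g)"
        unfolding g_def grade_involution_extend_op by (simp add: compose_assoc)
      finally show ?thesis .
    qed
    then show ?thesis
      by (simp add: T_eq blinfun_compose.sum_left blinfun_compose.sum_right sum_negf)
  qed
  define A where "A = (T o\<^sub>L T) - r *\<^sub>R T + c *\<^sub>R id_blinfun"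
  define A' where "A' = (T o\<^sub>L T) + r *\<^sub>R T + c *\<^sub>R id_blinfun"
  have gTT: "g o\<^sub>L (T o\<^sub>L T) = (T o\<^sub>L T) o\<^sub>L g"
  proof -
    have "g o\<^sub>L (T o\<^sub>L X) = - (T o\<^sub>L (g o\<^sub>L X))" for X :: "'v cliffop"
      using gT by (simp add: compose_simps flip: compose_assoc)
    then show ?thesis by (simp add: gT compose_simps compose_assoc)
  qed
  have "g o\<^sub>L A = A' o\<^sub>L g"
    by (simp add: A_def A'_def compose_simps gTT gT)
  then have "g o\<^sub>L (A o\<^sub>L g) = (A' o\<^sub>L g) o\<^sub>L g" by (simp flip: compose_assoc)
  then have A': "A' = g o\<^sub>L (A o\<^sub>L g)" by (simp add: compose_assoc gg)
  have AB: "A o\<^sub>L B = id_blinfun" "B o\<^sub>L A = id_blinfun"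
    using assms by (simp_all add: mutually_inverse_def A_def)
  then have AB_left: "A o\<^sub>L (B o\<^sub>L X) = X" "B o\<^sub>L (A o\<^sub>L X) = X" for X
    by (simp_all flip: compose_assoc)
  have "mutually_inverse A' (g o\<^sub>L (B o\<^sub>L g))"
    by (simp add: A' mutually_inverse_def compose_assoc gg gg_left AB_left)
  then show ?thesis by (auto simp: A'_def)
qed

end

locale vector_operator_slice = vector_operator +
  fixes I :: "real ^ 5"
  assumes I: "I \<in> imag_sphere"

sublocale vector_operator_slice \<subseteq> quadratic_pencil "left_mult (para (0, I))" "- (T o\<^sub>L T)"
  by unfold_locales
    (simp_all add: para_unit_square I compose_simps T_square_left_mult)

context vector_operator_slice
begin

lemma left_mult_slice: "left_mult (para (slice I z)) = M z"
proof -
  have "left_mult (para (slice I z)) = Re z *\<^sub>R id_blinfun + Im z *\<^sub>R (left_mult (para (0, I)) :: 'a cliffop)"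
    by (simp add: left_mult_para slice_def scaleR_sum_right)
  then show ?thesis by (simp only: M_def)
qed

lemma Qc_slice: "Qc (slice I z) T = Q z" "Qc (slice I z) (conj_op T) = Q z"
  by (simp_all add: Qc_def Q_def conj_T conj_op_minus left_mult_clmul left_mult_slice M_mult compose_simps)

lemma right_linear_Q: "right_linear (Q z)"
  unfolding Q_def left_mult_slice [symmetric]
  by (intro right_linear_add right_linear_left_mult right_linear_minus right_linear_T_square)

lemma Qc_inv_slice:
  assumes "z \<in> regular"
  shows "Qc_inv (slice I z) T = R z" "Qc_inv (slice I z) (conj_op T) = R z"
  using op_inv_eqI [OF right_linear_Q R [OF assms]] by (simp_all add: Qc_inv_def Qc_slice)

text \<open>Here \<open>conj_op T = - T\<close>, and \<open>T\<close> need not commute with \<open>M z\<close>; so the two terms are kept apart.\<close>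

lemma SL_inv_slice:
  assumes "z \<in> regular"
  shows "SL_inv (slice I z) T = (M z o\<^sub>L R z) + (T o\<^sub>L R z)"
    and "SL_inv (slice I z) (conj_op T) = (M z o\<^sub>L R z) - (T o\<^sub>L R z)"
  unfolding SL_inv_def Qc_inv_slice [OF assms]
  by (simp_all add: left_mult_slice conj_T conj_op_minus compose_simps)

lemma norm_slice: "norm (slice I z) = norm z"
  using I by (simp add: slice_def norm_prod_def imag_sphere_def cmod_def)

lemma fst_slice: "fst (slice I z) = Re z"
  by (simp add: slice_def)

text \<open>With \<open>c = \<bar>z\<bar>\<^sup>2\<close> and \<open>r = 2 Re z\<close>, the operators \<open>T\<^sup>2 - r T + c\<close> and \<open>T\<^sup>2 + r T + c\<close> have the product
\<open>T\<^sup>4 + (2 c - r\<^sup>2) T\<^sup>2 + c\<^sup>2\<close>, and so have \<open>z\<^sup>2 - T\<^sup>2\<close> and its conjugate.  If the first factor is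
invertible, so is the second, hence the product, hence both factors of its second factorisation,
which commute.\<close>

lemma not_S_spectrum_imp_regular:
  assumes "slice I z \<notin> S_spectrum T"
  shows "z \<in> regular"
proof -
  define S where "S = T o\<^sub>L T"
  define c where "c = (norm z)\<^sup>2"
  define r where "r = 2 * Re z"
  define A where "A = S - r *\<^sub>R T + c *\<^sub>R id_blinfun"
  define A' where "A' = S + r *\<^sub>R T + c *\<^sub>R id_blinfun"
  obtain B where B: "mutually_inverse A B"
    using assms
    unfolding S_spectrum_def A_def S_def c_def r_def mutually_inverse_def
    by (auto simp: inverse_pair_def norm_slice fst_slice)
  obtain B' where B': "mutually_inverse A' B'"
    using conjugate_inverse [OF B [unfolded A_def S_def]] by (auto simp: A'_def S_def)
  have ST: "S o\<^sub>L T = T o\<^sub>L S" by (simp add: S_def compose_assoc)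
  have SM: "S o\<^sub>L M w = M w o\<^sub>L S" for w
    unfolding S_def left_mult_slice [symmetric] by (rule T_square_left_mult)
  have Q_eq: "Q w = M (w * w) - S" for w by (simp add: Q_def S_def)
  have QQ: "Q z o\<^sub>L Q (cnj z) = Q (cnj z) o\<^sub>L Q z"
    by (simp add: Q_eq compose_simps SM M_commute)
  have AA': "A o\<^sub>L A' = Q z o\<^sub>L Q (cnj z)"
  proof -
    have TT: "T o\<^sub>L T = S" by (simp add: S_def)
    have e1: "A o\<^sub>L A' = (S o\<^sub>L S) + c *\<^sub>R S + c *\<^sub>R S - (r * r) *\<^sub>R S + (c * c) *\<^sub>R id_blinfun"
      by (simp add: A_def A'_def compose_simps ST TT algebra_simps)
    have e2: "Q z o\<^sub>L Q (cnj z) =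
        M ((z * z) * (cnj z * cnj z)) - (M (z * z + cnj z * cnj z) o\<^sub>L S) + (S o\<^sub>L S)"
      by (simp only: Q_eq compose_simps SM M_mult [of "z * z" "cnj z * cnj z"] M_add) simp
    have e3: "(z * z) * (cnj z * cnj z) = of_real (c * c)"
    proof -
      have "z * cnj z = of_real c" unfolding c_def by (rule complex_norm_square [symmetric])
      then show ?thesis by (metis mult.assoc mult.commute of_real_mult)
    qed
    have e4: "z * z + cnj z * cnj z = of_real (r * r - c - c)"
    proof -
      have "c = Re z * Re z + Im z * Im z" unfolding c_def cmod_power2 by (simp only: power2_eq_square)
      then show ?thesis by (simp add: r_def complex_eq_iff algebra_simps)
    qed
    show ?thesis
      unfolding e1 e2 e3 e4 M_of_real by (simp add: compose_simps scaleR_left_diff_distrib) (metis mult_2 scaleR_left_distrib)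
  qed
  define P where "P = B' o\<^sub>L B"
  have "(Q z o\<^sub>L Q (cnj z)) o\<^sub>L P = A o\<^sub>L ((A' o\<^sub>L B') o\<^sub>L B)"
    unfolding AA' [symmetric] P_def by (simp add: compose_assoc)
  also have "\<dots> = id_blinfun" using B B' by (simp add: mutually_inverse_def)
  finally have right: "Q z o\<^sub>L (Q (cnj z) o\<^sub>L P) = id_blinfun" by (simp add: compose_assoc)
  have "P o\<^sub>L (Q z o\<^sub>L Q (cnj z)) = B' o\<^sub>L ((B o\<^sub>L A) o\<^sub>L A')"
    unfolding AA' [symmetric] P_def by (simp add: compose_assoc)
  also have "\<dots> = id_blinfun" using B B' by (simp add: mutually_inverse_def)
  finally have left: "(P o\<^sub>L Q (cnj z)) o\<^sub>L Q z = id_blinfun" by (simp add: QQ compose_assoc)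
  have "P o\<^sub>L Q (cnj z) = (P o\<^sub>L Q (cnj z)) o\<^sub>L (Q z o\<^sub>L (Q (cnj z) o\<^sub>L P))" by (simp add: right)
  also have "\<dots> = ((P o\<^sub>L Q (cnj z)) o\<^sub>L Q z) o\<^sub>L (Q (cnj z) o\<^sub>L P)" by (simp only: compose_assoc)
  also have "\<dots> = Q (cnj z) o\<^sub>L P" by (simp add: left)
  finally have "mutually_inverse (Q z) (Q (cnj z) o\<^sub>L P)"
    using left right by (simp add: mutually_inverse_def)
  then show ?thesis by (auto simp: regular_def)
qed

end


section \<open>Slice functions as operator-valued functions\<close>

lemma continuous_on_slice: "continuous_on A (slice I)"
  unfolding slice_def by (intro continuous_intros)

lemma open_slice_vimage: "open W \<Longrightarrow> open (slice I -` W)"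
  using continuous_on_slice [of UNIV] by (rule open_vimage [rotated])

lemma closed_slice_vimage: "closed W \<Longrightarrow> closed (slice I -` W)"
  using continuous_on_slice [of UNIV] by (rule closed_vimage [rotated])

text \<open>The sphere through a point only records the absolute value of the imaginary part; a negative
imaginary part is absorbed in the imaginary unit.\<close>

lemma slice_domainI:
  assumes "axially_symmetric W" "I \<in> imag_sphere" "slice I z \<in> W"
  shows "(Re z, Im z) \<in> slice_domain W"
  unfolding slice_domain_def
proof (clarify)
  fix K assume K: "K \<in> imag_sphere"
  define K' where "K' = (if Im z \<ge> 0 then K else - K)"
  have K': "K' \<in> imag_sphere" using K by (simp add: K'_def imag_sphere_def)
  have "slice K (Complex (Re z) (Im z)) = slice K' (Complex (fst (slice I z)) (norm (snd (slice I z))))"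
    using assms(2) by (simp add: slice_def K'_def imag_sphere_def)
  then have "slice K (Complex (Re z) (Im z)) \<in> sphere_of (slice I z)"
    using K' by (auto simp: sphere_of_def)
  then show "slice K (Complex (Re z) (Im z)) \<in> W"
    using assms unfolding axially_symmetric_def by blast
qed

lemma slice_domainD:
  assumes "(Re z, Im z) \<in> slice_domain W" "I \<in> imag_sphere"
  shows "slice I z \<in> W" "slice I (cnj z) \<in> W"
proof -
  have *: "slice K z \<in> W" if "K \<in> imag_sphere" for K
    using assms(1) that by (simp add: slice_domain_def)
  show "slice I z \<in> W" using * assms(2) .
  have "slice I (cnj z) = slice (- I) z" by (simp add: slice_def)
  moreover have "- I \<in> imag_sphere" using assms(2) by (simp add: imag_sphere_def)
  ultimately show "slice I (cnj z) \<in> W" using * by simp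
qed

text \<open>The Cauchy-Riemann equations express the partial derivatives in \<open>v\<close> by those in \<open>u\<close>, which are \<open>a\<close>
and \<open>b\<close>.\<close>

lemma slice_components_has_derivative:
  fixes f :: "paravector \<Rightarrow> cliff"
  assumes "slice_components W f \<alpha> \<beta>" "(Re z, Im z) \<in> slice_domain W"
  obtains a b where
    "((\<lambda>z. \<alpha> (Re z, Im z)) has_derivative (\<lambda>h. Re h *\<^sub>R a - Im h *\<^sub>R b)) (at z)"
    "((\<lambda>z. \<beta> (Re z, Im z)) has_derivative (\<lambda>h. Re h *\<^sub>R b + Im h *\<^sub>R a)) (at z)"
proof -
  define p where "p = (Re z, Im z)"
  define D\<alpha> where "D\<alpha> = frechet_derivative \<alpha> (at p)"
  define D\<beta> where "D\<beta> = frechet_derivative \<beta> (at p)"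
  have cr: "\<alpha> differentiable (at p)" "\<beta> differentiable (at p)" "D\<alpha> (1, 0) = D\<beta> (0, 1)" "D\<alpha> (0, 1) = - D\<beta> (1, 0)"
    using assms unfolding slice_components_def p_def D\<alpha>_def D\<beta>_def by auto
  have D: "(\<alpha> has_derivative D\<alpha>) (at p)" "(\<beta> has_derivative D\<beta>) (at p)"
    using cr unfolding D\<alpha>_def D\<beta>_def by (simp_all add: frechet_derivative_works)
  have split: "F (x, y) = x *\<^sub>R F (1, 0) + y *\<^sub>R F (0, 1)"
    if "(g has_derivative F) (at p)" for g F :: "real \<times> real \<Rightarrow> cliff" and x y
  proof -
    have lin: "linear F" using that by (simp add: has_derivative_linear)
    have "F (x, y) = F (x *\<^sub>R (1, 0) + y *\<^sub>R (0, 1))" by simp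
    also have "\<dots> = x *\<^sub>R F (1, 0) + y *\<^sub>R F (0, 1)"
      by (simp only: linear_add [OF lin] linear_scale [OF lin])
    finally show ?thesis .
  qed
  have coords: "((\<lambda>z. (Re z, Im z)) has_derivative (\<lambda>h. (Re h, Im h))) (at z)"
    by (intro has_derivative_Pair bounded_linear_imp_has_derivative bounded_linear_Re bounded_linear_Im)
  have "((\<lambda>z. \<alpha> (Re z, Im z)) has_derivative (\<lambda>h. D\<alpha> (Re h, Im h))) (at z)"
    using has_derivative_compose [OF coords, of \<alpha> D\<alpha>] D(1) by (simp add: p_def)
  moreover have "((\<lambda>z. \<beta> (Re z, Im z)) has_derivative (\<lambda>h. D\<beta> (Re h, Im h))) (at z)"
    using has_derivative_compose [OF coords, of \<beta> D\<beta>] D(2) by (simp add: p_def)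
  moreover have "(\<lambda>h. D\<alpha> (Re h, Im h)) = (\<lambda>h. Re h *\<^sub>R D\<alpha> (1, 0) - Im h *\<^sub>R D\<beta> (1, 0))"
    by (rule ext) (subst split [OF D(1)], simp add: cr(4))
  moreover have "(\<lambda>h. D\<beta> (Re h, Im h)) = (\<lambda>h. Re h *\<^sub>R D\<beta> (1, 0) + Im h *\<^sub>R D\<alpha> (1, 0))"
    by (rule ext) (subst split [OF D(2)], simp add: cr(3))
  ultimately show ?thesis using that [of "D\<alpha> (1, 0)" "D\<beta> (1, 0)"] by simp
qed

context vector_operator_slice
begin

lemma left_mult_slice_components:
  assumes "slice_components W f \<alpha> \<beta>" "slice I z \<in> W"
  shows "left_mult (f (slice I z)) = left_mult (\<alpha> (Re z, Im z)) + (left_mult (para (0, I)) o\<^sub>L (left_mult (\<beta> (Re z, Im z)) :: 'a cliffop))"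
proof -
  have "f (slice I (Complex (Re z) (Im z))) = \<alpha> (Re z, Im z) + para (0, I) \<star> \<beta> (Re z, Im z)"
    using assms(1) [unfolded slice_components_def, THEN conjunct1, rule_format, OF I, of "Re z" "Im z"] assms(2)
    by simp
  then show ?thesis by (simp add: left_mult_linear left_mult_clmul)
qed

lemma J_holomorphic_left_slice_hyperholomorphic:
  assumes "left_slice_hyperholomorphic_on W f"
  shows "J_holomorphic (\<lambda>z. left_mult (f (slice I z))) (slice I -` W)"
  unfolding J_holomorphic_def
proof
  obtain \<alpha> \<beta> where W: "open W" "axially_symmetric W" and c: "slice_components W f \<alpha> \<beta>"
    using assms unfolding left_slice_hyperholomorphic_on_def by blast
  define J where "J = (left_mult (para (0, I)) :: 'a cliffop)"
  fix z assume z: "z \<in> slice I -` W"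
  then have "(Re z, Im z) \<in> slice_domain W" using slice_domainI [OF W(2) I] by simp
  then obtain a b where
    ab: "((\<lambda>z. \<alpha> (Re z, Im z)) has_derivative (\<lambda>h. Re h *\<^sub>R a - Im h *\<^sub>R b)) (at z)"
    "((\<lambda>z. \<beta> (Re z, Im z)) has_derivative (\<lambda>h. Re h *\<^sub>R b + Im h *\<^sub>R a)) (at z)"
    using slice_components_has_derivative [OF c] by blast
  note lin = bounded_linear.has_derivative [OF bounded_linear_left_mult]
  have "((\<lambda>w. left_mult (\<alpha> (Re w, Im w)) + (J o\<^sub>L (left_mult (\<beta> (Re w, Im w)) :: 'a cliffop)))
      has_derivative (\<lambda>h. left_mult (Re h *\<^sub>R a - Im h *\<^sub>R b) + (J o\<^sub>L left_mult (Re h *\<^sub>R b + Im h *\<^sub>R a)))) (at z)"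
    by (intro has_derivative_add bounded_linear.has_derivative [OF blinfun_compose.bounded_linear_right] lin ab)
  moreover have "(left_mult (Re h *\<^sub>R a - Im h *\<^sub>R b) + (J o\<^sub>L left_mult (Re h *\<^sub>R b + Im h *\<^sub>R a)) :: 'a cliffop) =
      M h o\<^sub>L (left_mult a + (J o\<^sub>L left_mult b))" for h
    unfolding J_def
    by (simp add: M_def compose_simps J_J left_mult_linear algebra_simps
        linear_diff [OF bounded_linear.linear [OF bounded_linear_left_mult]])
  ultimately have "((\<lambda>w. left_mult (\<alpha> (Re w, Im w)) + (J o\<^sub>L (left_mult (\<beta> (Re w, Im w)) :: 'a cliffop)))
      has_derivative (\<lambda>h. M h o\<^sub>L (left_mult a + (J o\<^sub>L left_mult b)))) (at z)" by simp
  then have "((\<lambda>w. left_mult (f (slice I w)) :: 'a cliffop) has_derivative (\<lambda>h. M h o\<^sub>L (left_mult a + (J o\<^sub>L left_mult b)))) (at z)"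
    by (rule has_derivative_transform_within_open [OF _ open_slice_vimage [OF W(1)] z])
      (simp add: J_def left_mult_slice_components [OF c])
  then show "\<exists>c. ((\<lambda>z. left_mult (f (slice I z))) has_derivative (\<lambda>h. M h o\<^sub>L c)) (at z)" ..
qed

lemma intrinsic_slice_scalar:
  assumes "intrinsic_slice_hyperholomorphic_on W f"
  obtains \<phi> where "\<phi> holomorphic_on slice I -` W"
    "\<forall>z\<in>slice I -` W. left_mult (f (slice I z)) = M (\<phi> z)"
    "\<forall>z\<in>slice I -` W. \<phi> (cnj z) = cnj (\<phi> z)"
proof -
  obtain \<alpha> \<beta> where W: "open W" "axially_symmetric W" and c: "slice_components W f \<alpha> \<beta>"
    and real: "\<And>p. p \<in> slice_domain W \<Longrightarrow> \<alpha> p \<in> range (\<lambda>r. r *\<^sub>R cl_basis {}) \<and> \<beta> p \<in> range (\<lambda>r. r *\<^sub>R cl_basis {})"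
    using assms unfolding intrinsic_slice_hyperholomorphic_on_def by blast
  have dom: "(Re z, Im z) \<in> slice_domain W" if "z \<in> slice I -` W" for z
    using slice_domainI [OF W(2) I] that by simp
  define \<phi> where "\<phi> z = complex_of_real (\<alpha> (Re z, Im z) $ {}) + \<i> * complex_of_real (\<beta> (Re z, Im z) $ {})" for z
  have "\<phi> holomorphic_on slice I -` W"
    unfolding holomorphic_on_def field_differentiable_def
  proof
    fix z assume z: "z \<in> slice I -` W"
    obtain a b where
      ab: "((\<lambda>z. \<alpha> (Re z, Im z)) has_derivative (\<lambda>h. Re h *\<^sub>R a - Im h *\<^sub>R b)) (at z)"
      "((\<lambda>z. \<beta> (Re z, Im z)) has_derivative (\<lambda>h. Re h *\<^sub>R b + Im h *\<^sub>R a)) (at z)"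
      using slice_components_has_derivative [OF c dom [OF z]] by blast
    have "(\<phi> has_derivative (\<lambda>h. of_real ((Re h *\<^sub>R a - Im h *\<^sub>R b) $ {}) + \<i> * of_real ((Re h *\<^sub>R b + Im h *\<^sub>R a) $ {}))) (at z)"
      unfolding \<phi>_def
      by (intro has_derivative_add has_derivative_mult_right has_derivative_of_real
          bounded_linear.has_derivative [OF bounded_linear_vec_nth] ab)
    moreover have "of_real ((Re h *\<^sub>R a - Im h *\<^sub>R b) $ {}) + \<i> * of_real ((Re h *\<^sub>R b + Im h *\<^sub>R a) $ {}) =
        (complex_of_real (a $ {}) + \<i> * of_real (b $ {})) * h" for h
      by (simp add: complex_eq_iff algebra_simps)
    ultimately have "(\<phi> has_field_derivative (complex_of_real (a $ {}) + \<i> * of_real (b $ {}))) (at z)"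
      by (simp add: has_field_derivative_def)
    then show "\<exists>d. (\<phi> has_field_derivative d) (at z within slice I -` W)"
      using has_field_derivative_at_within by blast
  qed
  moreover have "\<forall>z\<in>slice I -` W. left_mult (f (slice I z)) = M (\<phi> z)"
  proof
    fix z assume z: "z \<in> slice I -` W"
    obtain r s where rs: "\<alpha> (Re z, Im z) = r *\<^sub>R cl_basis {}" "\<beta> (Re z, Im z) = s *\<^sub>R cl_basis {}"
      using real [OF dom [OF z]] by auto
    have "left_mult (f (slice I z)) = M (Complex r s)"
      using left_mult_slice_components [OF c, of z] z
      by (simp add: rs left_mult_linear left_mult_one compose_simps M_def)
    moreover have "\<phi> z = Complex r s"
      by (simp add: \<phi>_def rs cl_basis_def axis_def complex_eq_iff)
    ultimately show "left_mult (f (slice I z)) = M (\<phi> z)" by simp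
  qed
  moreover have "\<forall>z\<in>slice I -` W. \<phi> (cnj z) = cnj (\<phi> z)"
  proof
    fix z assume z: "z \<in> slice I -` W"
    have "\<alpha> (Re z, - Im z) = \<alpha> (Re z, Im z)" "\<beta> (Re z, - Im z) = - \<beta> (Re z, Im z)"
      using c dom [OF z] unfolding slice_components_def by auto
    then show "\<phi> (cnj z) = cnj (\<phi> z)" by (simp add: \<phi>_def)
  qed
  ultimately show ?thesis by (rule that)
qed

end


section \<open>The product rule\<close>

locale vector_operator_contour =
  vector_operator_slice T Ts I + pencil_contour "left_mult (para (0, I))" "- (T o\<^sub>L T)" D \<Gamma>
  for T Ts I D \<Gamma>
begin

text \<open>The factor \<open>S\<close> need not commute with \<open>J\<close>, but it stands to the left of the whole integrand; this covers
all kernels of the functional calculi, with \<open>S\<close> one of \<open>0\<close>, \<open>T\<close> and \<open>- T\<close>.\<close>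

lemma slice_integral_eq_loop_integral:
  fixes h :: "paravector \<Rightarrow> cliff"
  defines "H \<equiv> \<lambda>z. left_mult (h (slice I z))"
  assumes p: "continuous_on (frontier D) p" and H: "continuous_on (frontier D) H"
    and K: "\<And>z. z \<in> frontier D \<Longrightarrow> K (slice I z) = (M (p z) o\<^sub>L R z) + (S o\<^sub>L R z)"
  shows "(1 / (2 * pi)) *\<^sub>R slice_integral I \<Gamma> K h =
    loop_integral (\<lambda>z. M (p z) o\<^sub>L (R z o\<^sub>L H z)) + (S o\<^sub>L loop_integral (\<lambda>z. R z o\<^sub>L H z))"
proof -
  define F1 where "F1 z = M (p z) o\<^sub>L (R z o\<^sub>L H z)" for z
  define F2 where "F2 z = R z o\<^sub>L H z" for z
  have cont: "continuous_on (frontier D) F1" "continuous_on (frontier D) F2"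
    unfolding F1_def F2_def by (intro continuous_intros continuous_on_R p H)+
  have J: "left_mult (- para (0, I)) = M (- \<i>)" by (simp only: left_mult_linear M_minus M_ii)
  have curve: "integral {0..1} (\<lambda>t. K (slice I (\<gamma> t)) o\<^sub>L
      left_mult (para (slice I (path_velocity \<gamma> t)) \<star> (- para (0, I)) \<star> h (slice I (\<gamma> t)))) =
    (M (- \<i>) o\<^sub>L contour \<gamma> F1) + (S o\<^sub>L (M (- \<i>) o\<^sub>L contour \<gamma> F2))" if \<gamma>: "\<gamma> \<in> \<Gamma>" for \<gamma>
  proof (rule integral_unique)
    note int = has_integral_contour [OF \<Gamma>_D(1) [OF \<gamma>] continuous_on_boundary_curve [OF _ \<gamma>]]
    have "((\<lambda>t. (M (- \<i>) o\<^sub>L (M (path_velocity \<gamma> t) o\<^sub>L F1 (\<gamma> t))) + (S o\<^sub>L (M (- \<i>) o\<^sub>L (M (path_velocity \<gamma> t) o\<^sub>L F2 (\<gamma> t)))))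
      has_integral (M (- \<i>) o\<^sub>L contour \<gamma> F1) + (S o\<^sub>L (M (- \<i>) o\<^sub>L contour \<gamma> F2))) {0..1}"
      using has_integral_linear [OF int [OF cont(1)] blinfun_compose.bounded_linear_right [of "M (- \<i>)"]]
        has_integral_linear [OF has_integral_linear [OF int [OF cont(2)] blinfun_compose.bounded_linear_right [of "M (- \<i>)"]]
          blinfun_compose.bounded_linear_right [of S]]
      by (intro has_integral_add) (simp_all add: o_def)
    then show "((\<lambda>t. K (slice I (\<gamma> t)) o\<^sub>L
        left_mult (para (slice I (path_velocity \<gamma> t)) \<star> (- para (0, I)) \<star> h (slice I (\<gamma> t)))) has_integral
      (M (- \<i>) o\<^sub>L contour \<gamma> F1) + (S o\<^sub>L (M (- \<i>) o\<^sub>L contour \<gamma> F2))) {0..1}"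
    proof (rule has_integral_eq [rotated])
      fix t :: real assume "t \<in> {0..1}"
      then have z: "\<gamma> t \<in> frontier D" using \<Gamma>_D(3) [OF \<gamma>] by (auto simp: path_image_def)
      define v where "v = path_velocity \<gamma> t"
      have "left_mult (para (slice I v) \<star> (- para (0, I)) \<star> h (slice I (\<gamma> t))) = M v o\<^sub>L (M (- \<i>) o\<^sub>L H (\<gamma> t))"
        by (simp only: left_mult_clmul left_mult_slice J H_def)
      moreover have RM: "R (\<gamma> t) o\<^sub>L (M w o\<^sub>L X) = M w o\<^sub>L (R (\<gamma> t) o\<^sub>L X)" for w X
        using commutes_M [OF R_J, of "\<gamma> t" w] subsetD [OF frontier_regular z] by (simp flip: compose_assoc)
      ultimately show "(M (- \<i>) o\<^sub>L (M (path_velocity \<gamma> t) o\<^sub>L F1 (\<gamma> t))) + (S o\<^sub>L (M (- \<i>) o\<^sub>L (M (path_velocity \<gamma> t) o\<^sub>L F2 (\<gamma> t)))) =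
        K (slice I (\<gamma> t)) o\<^sub>L
        left_mult (para (slice I (path_velocity \<gamma> t)) \<star> (- para (0, I)) \<star> h (slice I (\<gamma> t)))"
        unfolding v_def [symmetric]
        by (simp add: K [OF z] F1_def F2_def compose_simps compose_assoc RM
            M_commute_left [of v "- \<i>"] M_commute_left [of "p (\<gamma> t)" "- \<i>"] M_commute_left [of "p (\<gamma> t)" v])
    qed
  qed
  have "slice_integral I \<Gamma> K h =
      (M (- \<i>) o\<^sub>L (\<Sum>\<gamma>\<in>\<Gamma>. contour \<gamma> F1)) + (S o\<^sub>L (M (- \<i>) o\<^sub>L (\<Sum>\<gamma>\<in>\<Gamma>. contour \<gamma> F2)))"
    unfolding slice_integral_def by (simp add: curve sum.distrib blinfun_compose.sum_right)
  moreover have "1 / (2 * pi * \<i>) = (1 / (2 * pi)) *\<^sub>R (- \<i>)"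
    by (simp add: scaleR_conv_of_real field_simps)
  then have "M (1 / (2 * pi * \<i>)) = (1 / (2 * pi)) *\<^sub>R M (- \<i>)" by (simp only: M_scaleR)
  ultimately show ?thesis
    unfolding loop_integral_def F1_def [abs_def] F2_def [abs_def] by (simp add: compose_simps scaleR_add_right)
qed

end

theorem theorem3p10:
  fixes T :: "'v::banach cliffop"
    and U :: "paravector set"
    and f g :: "paravector \<Rightarrow> cliff"
    and I :: "real ^ 5"
    and \<Gamma> :: "(real \<Rightarrow> complex) set"
  assumes "T \<in> BC01"
    and "\<forall>j::5. complex_spectrum (coeff_op T {j}) \<subseteq> \<real>"
    and "coeff_op T {} = 0"
    and "bounded_slice_Cauchy_domain U"
    and "f \<in> SN T U"
    and "g \<in> SHL T U"
    and "I \<in> imag_sphere"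
    and "positive_boundary (slice I -` U) \<Gamma>"
  shows "biharmonic_calculus I \<Gamma> (\<lambda>x. f x \<star> g x) T =
      (biharmonic_calculus I \<Gamma> f T o\<^sub>L SL_calculus I \<Gamma> g T) +
      (SL_calculus I \<Gamma> f (conj_op T) o\<^sub>L biharmonic_calculus I \<Gamma> g T)"
proof -
  define D where "D = slice I -` U"
  obtain T0 Ts where T: "T = paravector_op T0 Ts" and comm: "\<And>i j. Ts i o\<^sub>L Ts j = Ts j o\<^sub>L Ts i"
    using assms(1) by (auto simp: BC01_def)
  have "T0 = 0" using assms(3) by (simp add: T coeff_op_paravector_op)
  then have vec: "T = (\<Sum>j\<in>UNIV. left_mult (cl_unit j) o\<^sub>L extend_op (Ts j))"
    by (simp add: T paravector_op_def extend_op_zero)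
  interpret vector_operator_slice T Ts I
    by unfold_locales (fact vec comm assms(7))+
  have U: "open U" "axially_symmetric U" using assms(4) by (auto simp: bounded_slice_Cauchy_domain_def)
  obtain Wf where Wf: "closure U \<subseteq> Wf" "intrinsic_slice_hyperholomorphic_on Wf f" and spec: "S_spectrum T \<subseteq> U"
    using assms(5) by (auto simp: SN_def)
  obtain Wg where Wg: "closure U \<subseteq> Wg" "left_slice_hyperholomorphic_on Wg g"
    using assms(6) by (auto simp: SHL_def)
  interpret vector_operator_contour T Ts I D \<Gamma>
  proof unfold_locales
    show "open D" unfolding D_def by (rule open_slice_vimage [OF U(1)])
    show "positive_boundary D \<Gamma>" using assms(8) by (simp add: D_def)
    show "- regular \<subseteq> D" using not_S_spectrum_imp_regular spec by (auto simp: D_def)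
  qed
  obtain \<phi> where \<phi>: "\<phi> holomorphic_on slice I -` Wf" "\<forall>z\<in>slice I -` Wf. left_mult (f (slice I z)) = M (\<phi> z)"
    "\<forall>z\<in>slice I -` Wf. \<phi> (cnj z) = cnj (\<phi> z)"
    using intrinsic_slice_scalar [OF Wf(2)] by blast
  define G where "G z = (left_mult (g (slice I z)) :: 'v cliffop)" for z
  have G: "J_holomorphic G (slice I -` Wg)"
    using J_holomorphic_left_slice_hyperholomorphic [OF Wg(2)] by (simp add: G_def [abs_def])
  define W where "W = slice I -` Wf \<inter> slice I -` Wg"
  have W: "open W"
    using Wf(2) Wg(2) unfolding W_def intrinsic_slice_hyperholomorphic_on_def left_slice_hyperholomorphic_on_def
    by (intro open_Int open_slice_vimage) auto
  have clD: "closure D \<subseteq> W"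
  proof -
    have "closure D \<subseteq> slice I -` closure U"
      by (rule closure_minimal) (use closure_subset [of U] in \<open>auto simp: D_def closed_slice_vimage\<close>)
    then show ?thesis using Wf(1) Wg(1) by (auto simp: W_def)
  qed
  have sub: "frontier D \<subseteq> W" using clD by (auto simp: frontier_def)
  have \<phi>W: "\<phi> holomorphic_on W" and GW: "J_holomorphic G W"
    using \<phi>(1) G by (auto simp: W_def intro: holomorphic_on_subset J_holomorphic_subset)
  have sym: "cnj z \<in> D" if "z \<in> D" for z
    using slice_domainD(2) [OF slice_domainI [OF U(2) assms(7)] assms(7)] that by (simp add: D_def)
  have c\<phi>: "continuous_on (frontier D) \<phi>"
    using holomorphic_on_imp_continuous_on [OF \<phi>W] sub by (rule continuous_on_subset)
  have cG: "continuous_on (frontier D) G"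
    using J_holomorphic_imp_continuous_on [OF GW] sub by (rule continuous_on_subset)
  note cont = continuous_intros continuous_on_R c\<phi> cG
  have f_eq: "left_mult (f (slice I z)) = M (\<phi> z)" if "z \<in> frontier D" for z
    using \<phi>(2) sub that by (auto simp: W_def)
  have cf: "continuous_on (frontier D) (\<lambda>z. left_mult (f (slice I z)) :: 'v cliffop)"
    by (rule continuous_on_eq [of _ "\<lambda>z. M (\<phi> z)"]) (auto simp: f_eq intro!: cont)
  have cfg: "continuous_on (frontier D) (\<lambda>z. left_mult (f (slice I z) \<star> g (slice I z)) :: 'v cliffop)"
    by (rule continuous_on_eq [of _ "\<lambda>z. M (\<phi> z) o\<^sub>L G z"]) (intro cont, simp add: f_eq left_mult_clmul G_def)
  have reg: "z \<in> regular" if "z \<in> frontier D" for z using that frontier_regular by blast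
  have RM: "R z o\<^sub>L M w = M w o\<^sub>L R z" if "z \<in> frontier D" for z w
    using commutes_M [OF R_J [OF reg [OF that]]] .
  have bi: "biharmonic_calculus I \<Gamma> h T = (- 4) *\<^sub>R loop_integral (\<lambda>z. R z o\<^sub>L left_mult (h (slice I z)))"
    if h: "continuous_on (frontier D) (\<lambda>z. left_mult (h (slice I z)) :: 'v cliffop)" for h
  proof -
    have "biharmonic_calculus I \<Gamma> h T = loop_integral (\<lambda>z. M (- 4) o\<^sub>L (R z o\<^sub>L left_mult (h (slice I z)))) +
        (0 o\<^sub>L loop_integral (\<lambda>z. R z o\<^sub>L left_mult (h (slice I z))))"
      unfolding biharmonic_calculus_def
    proof (rule slice_integral_eq_loop_integral [OF continuous_on_const h])
      fix z assume "z \<in> frontier D"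
      moreover have "M (- 4) = (- 4) *\<^sub>R id_blinfun" using M_of_real [of "- 4"] by simp
      ultimately show "(- 4) *\<^sub>R Qc_inv (slice I z) T = (M (- 4) o\<^sub>L R z) + (0 o\<^sub>L R z)"
        by (simp add: Qc_inv_slice reg compose_simps)
    qed
    also have "loop_integral (\<lambda>z. M (- 4) o\<^sub>L (R z o\<^sub>L left_mult (h (slice I z)))) =
        M (- 4) o\<^sub>L loop_integral (\<lambda>z. R z o\<^sub>L left_mult (h (slice I z)))"
      by (intro loop_integral_compose_left M_J continuous_intros continuous_on_R h)
    also have "M (- 4) = (- 4) *\<^sub>R id_blinfun" using M_of_real [of "- 4"] by simp
    finally show ?thesis by (simp add: compose_simps)
  qed
  define X0 where "X0 = loop_integral (\<lambda>z. M (\<phi> z) o\<^sub>L R z)"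
  define X1 where "X1 = loop_integral (\<lambda>z. M (\<phi> z) o\<^sub>L (M z o\<^sub>L R z))"
  define G0 where "G0 = loop_integral (\<lambda>z. R z o\<^sub>L G z)"
  define G1 where "G1 = loop_integral (\<lambda>z. M z o\<^sub>L (R z o\<^sub>L G z))"
  have X0: "loop_integral (\<lambda>z. R z o\<^sub>L left_mult (f (slice I z))) = X0"
    unfolding X0_def by (rule loop_integral_cong) (simp add: f_eq RM)
  have X1: "loop_integral (\<lambda>z. M z o\<^sub>L (R z o\<^sub>L left_mult (f (slice I z)))) = X1"
    unfolding X1_def by (rule loop_integral_cong) (simp add: f_eq RM M_commute_left)
  have fD: "biharmonic_calculus I \<Gamma> f T = (- 4) *\<^sub>R X0"
    using bi [OF cf] by (simp add: X0)
  have gD: "biharmonic_calculus I \<Gamma> g T = (- 4) *\<^sub>R G0"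
    using bi [of g] cG by (simp add: G0_def G_def [abs_def])
  have "loop_integral (\<lambda>z. R z o\<^sub>L left_mult (f (slice I z) \<star> g (slice I z))) = loop_integral (\<lambda>z. M (\<phi> z) o\<^sub>L (R z o\<^sub>L G z))"
    by (rule loop_integral_cong) (simp add: left_mult_clmul f_eq RM G_def flip: compose_assoc)
  then have fgD: "biharmonic_calculus I \<Gamma> (\<lambda>x. f x \<star> g x) T = (- 4) *\<^sub>R loop_integral (\<lambda>z. M (\<phi> z) o\<^sub>L (R z o\<^sub>L G z))"
    using bi [OF cfg] by simp
  have gT: "SL_calculus I \<Gamma> g T = G1 + (T o\<^sub>L G0)"
    unfolding SL_calculus_def G0_def G1_def G_def
    by (rule slice_integral_eq_loop_integral) (use cG in \<open>auto simp: SL_inv_slice reg G_def [abs_def]\<close>)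
  have "SL_calculus I \<Gamma> f (conj_op T) = loop_integral (\<lambda>z. M z o\<^sub>L (R z o\<^sub>L left_mult (f (slice I z)))) +
      (- T o\<^sub>L loop_integral (\<lambda>z. R z o\<^sub>L left_mult (f (slice I z))))"
    unfolding SL_calculus_def
    by (rule slice_integral_eq_loop_integral) (use cf in \<open>auto simp: SL_inv_slice reg compose_simps\<close>)
  then have fT: "SL_calculus I \<Gamma> f (conj_op T) = X1 - (T o\<^sub>L X0)"
    by (simp add: X0 X1 compose_simps)
  \<comment> \<open>This makes the two terms with \<open>T\<close> on the right-hand side cancel.\<close>
  have TX: "T o\<^sub>L X0 = X0 o\<^sub>L T"
    unfolding X0_def
  proof (rule loop_integral_intrinsic_commute_all [OF W clD \<phi>W _ sym])
    show "\<phi> (cnj z) = cnj (\<phi> z)" if "z \<in> W" for z using \<phi>(3) that by (simp add: W_def)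
    show "T o\<^sub>L - (T o\<^sub>L T) = - (T o\<^sub>L T) o\<^sub>L T" by (simp add: compose_simps compose_assoc)
  qed
  have "(X0 o\<^sub>L G1) + (X1 o\<^sub>L G0) = loop_integral (\<lambda>z. M (\<phi> z) o\<^sub>L (R z o\<^sub>L G z))"
    unfolding X0_def X1_def G0_def G1_def by (rule loop_integral_product [OF W clD \<phi>W GW])
  moreover have "((- 4) *\<^sub>R X0 o\<^sub>L (G1 + (T o\<^sub>L G0))) + ((X1 - (T o\<^sub>L X0)) o\<^sub>L (- 4) *\<^sub>R G0) =
      (- 4) *\<^sub>R ((X0 o\<^sub>L G1) + (X1 o\<^sub>L G0))"
    unfolding TX by (simp add: compose_simps compose_assoc algebra_simps)
  ultimately show ?thesis by (simp only: fgD fD gD fT gT)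
qed

end
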